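(* Let $\tilde M_\lambda$ be a constant curvature space or spacetime with sectional curvature $\lambda$, and let $\Sigma\subset\tilde M_\lambda$ be an everywhere umbilical hypersurface, i.e. a hypersurface whose extrinsic curvature is proportional to the induced metric $g_{ij}$, $K_{ij}=\sigma g_{ij}$, where $\sigma$ is a priori a (not necessarily constant) function on $\Sigma$. If $\tilde M_\lambda$ is a spacetime, assume that $\Sigma$ is time-like. Then: (1) $\sigma$ is constant on $\Sigma$; (2) $\Sigma$ has constant sectional curvature $\lambda+\sigma^2$, so that, when $\lambda$ is given, $\sigma^2$ uniquely determines the intrinsic geometry of $\Sigma$; (3) $\sigma^2$ also uniquely determines the configuration of $\Sigma$ up to an isometry of $\tilde M_\lambda$: two such hypersurfaces with the same value of $\sigma^2$ are mapped into each other by an isometry of $\tilde M_\lambda$. Thus an everywhere umbilical hypersurface in a constant curvature space or spacetime is rigid.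
   Context: A space (Riemannian) or spacetime (Lorentzian) has constant sectional curvature $\lambda$ if its Riemann tensor is $\tilde R_{\mu\nu\alpha\beta}=\lambda(\tilde g_{\mu\alpha}\tilde g_{\nu\beta}-\tilde g_{\mu\beta}\tilde g_{\nu\alpha})$, where $\tilde g$ is its metric. The constant curvature spaces considered are Euclidean space, the sphere and hyperbolic space; the constant curvature spacetimes are Minkowski, de Sitter and anti-de Sitter spacetime. The extrinsic curvature $K_{ij}$ of a hypersurface is, up to an overall sign convention, the tangential part of the covariant derivative of its unit normal; the sign is immaterial here because only $\sigma^2$ enters. A hypersurface in a spacetime is time-like if its induced metric is Lorentzian.
   Formalization: Σ is taken connected, embedded and of dimension at least 2 (else (1) fails); in (3) an isometry maps one hypersurface onto the other when both are closed in the ambient space, while arbitrary pieces are only matched near any two chosen points (a hemisphere is not congruent to a sphere). *)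

theory Defs
  imports "HOL-Analysis.Analysis"
begin

section \<open>Smooth maps\<close>

definition pd :: "'m::finite \<Rightarrow> (real^'m \<Rightarrow> 'b::real_normed_vector) \<Rightarrow> real^'m \<Rightarrow> 'b"
  where "pd i f p = frechet_derivative f (at p) (axis i 1)"

text \<open>Only meaningful for open \<open>U\<close>, which is the only way it is used.\<close>

primrec Ck_on :: "nat \<Rightarrow> (real^'m::finite) set \<Rightarrow> (real^'m \<Rightarrow> 'b::real_normed_vector) \<Rightarrow> bool"
  where
    "Ck_on 0 U f \<longleftrightarrow> continuous_on U f"
  | "Ck_on (Suc k) U f \<longleftrightarrow> (\<forall>p\<in>U. f differentiable (at p)) \<and> (\<forall>i. Ck_on k U (pd i f))"

definition smooth_on :: "(real^'m::finite) set \<Rightarrow> (real^'m \<Rightarrow> 'b::real_normed_vector) \<Rightarrow> bool"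
  where "smooth_on U f \<longleftrightarrow> (\<forall>k. Ck_on k U f)"


section \<open>Metrics in coordinates\<close>

text \<open>A metric on a coordinate domain is a matrix-valued function \<open>g\<close>.\<close>

definition christoffel ::
  "(real^'m::finite \<Rightarrow> real^'m^'m) \<Rightarrow> 'm \<Rightarrow> 'm \<Rightarrow> 'm \<Rightarrow> real^'m \<Rightarrow> real"
  where "christoffel g \<mu> \<alpha> \<beta> p =
    (1/2) * (\<Sum>\<nu>\<in>UNIV. matrix_inv (g p) $ \<mu> $ \<nu> *
      (pd \<alpha> (\<lambda>q. g q $ \<nu> $ \<beta>) p + pd \<beta> (\<lambda>q. g q $ \<nu> $ \<alpha>) p - pd \<nu> (\<lambda>q. g q $ \<alpha> $ \<beta>) p))"

text \<open>\<open>riemann_up g \<mu> \<nu> \<alpha> \<beta>\<close> is the component with first index \<open>\<mu>\<close> raised; the sign convention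
  makes round spheres positively curved.\<close>

definition riemann_up ::
  "(real^'m::finite \<Rightarrow> real^'m^'m) \<Rightarrow> 'm \<Rightarrow> 'm \<Rightarrow> 'm \<Rightarrow> 'm \<Rightarrow> real^'m \<Rightarrow> real"
  where "riemann_up g \<mu> \<nu> \<alpha> \<beta> p =
    pd \<alpha> (christoffel g \<mu> \<nu> \<beta>) p - pd \<beta> (christoffel g \<mu> \<nu> \<alpha>) p
    + (\<Sum>\<rho>\<in>UNIV. christoffel g \<mu> \<alpha> \<rho> p * christoffel g \<rho> \<nu> \<beta> p
               - christoffel g \<mu> \<beta> \<rho> p * christoffel g \<rho> \<nu> \<alpha> p)"

definition riemann ::
  "(real^'m::finite \<Rightarrow> real^'m^'m) \<Rightarrow> 'm \<Rightarrow> 'm \<Rightarrow> 'm \<Rightarrow> 'm \<Rightarrow> real^'m \<Rightarrow> real"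
  where "riemann g \<mu> \<nu> \<alpha> \<beta> p = (\<Sum>\<rho>\<in>UNIV. g p $ \<mu> $ \<rho> * riemann_up g \<rho> \<nu> \<alpha> \<beta> p)"

definition mform :: "real^'m^'m \<Rightarrow> real^'m::finite \<Rightarrow> real^'m \<Rightarrow> real"
  where "mform G v w = v \<bullet> (G *v w)"

definition lorentzian_matrix :: "real^'m^'m::finite \<Rightarrow> bool"
  where "lorentzian_matrix G \<longleftrightarrow>
    (\<exists>(P :: real^'m^'m) t. invertible P \<and>
      transpose P ** G ** P = (\<chi> i j. if i = j then (if i = t then -1 else 1) else 0))"


section \<open>Submanifolds of pseudo-Euclidean space\<close>

text \<open>The pseudo-Euclidean form on \<open>real^'k\<close> whose negative directions are the axes in \<open>T\<close>.\<close>

definition eta :: "'k::finite set \<Rightarrow> real^'k \<Rightarrow> real^'k \<Rightarrow> real"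
  where "eta T v w = (\<Sum>i\<in>UNIV. (if i \<in> T then -1 else 1) * v $ i * w $ i)"

text \<open>Local parametrisations (inverse charts) of an embedded submanifold \<open>S\<close> of dimension
  \<open>CARD('m)\<close>.\<close>

definition local_param ::
  "(real^'k::finite) set \<Rightarrow> (real^'m::finite) set \<Rightarrow> (real^'m \<Rightarrow> real^'k) \<Rightarrow> bool"
  where "local_param S U x \<longleftrightarrow>
    open U \<and> smooth_on U x \<and>
    (\<forall>u\<in>U. inj (frechet_derivative x (at u))) \<and>
    openin (top_of_set S) (x ` U) \<and>
    (\<exists>y. homeomorphism U (x ` U) x y)"

definition induced_metric ::
  "'k::finite set \<Rightarrow> (real^'m::finite \<Rightarrow> real^'k) \<Rightarrow> real^'m \<Rightarrow> real^'m^'m"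
  where "induced_metric T x u = (\<chi> i j. eta T (pd i x u) (pd j x u))"

definition constant_curvature ::
  "'m::finite itself \<Rightarrow> 'k::finite set \<Rightarrow> (real^'k) set \<Rightarrow> real \<Rightarrow> bool"
  where "constant_curvature _ T S \<kappa> \<longleftrightarrow>
    (\<forall>(U :: (real^'m) set) x. local_param S U x \<longrightarrow>
      (let g = induced_metric T x in
        \<forall>u\<in>U. \<forall>\<mu> \<nu> \<alpha> \<beta>. riemann g \<mu> \<nu> \<alpha> \<beta> u =
          \<kappa> * (g u $ \<mu> $ \<alpha> * g u $ \<nu> $ \<beta> - g u $ \<mu> $ \<beta> * g u $ \<nu> $ \<alpha>)))"

definition timelike :: "'n::finite itself \<Rightarrow> 'k::finite set \<Rightarrow> (real^'k) set \<Rightarrow> bool"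
  where "timelike _ T S \<longleftrightarrow>
    (\<forall>(U :: (real^'n) set) x. local_param S U x \<longrightarrow>
      (\<forall>u\<in>U. lorentzian_matrix (induced_metric T x u)))"

text \<open>For submanifolds, mapping parametrisations to parametrisations says that the bijection
  \<open>\<phi>\<close> is a diffeomorphism.\<close>

definition metric_isometry ::
  "'m::finite itself \<Rightarrow> 'k::finite set \<Rightarrow> (real^'k) set \<Rightarrow> (real^'k) set \<Rightarrow> (real^'k \<Rightarrow> real^'k) \<Rightarrow> bool"
  where "metric_isometry _ T S S' \<phi> \<longleftrightarrow>
    bij_betw \<phi> S S' \<and>
    (\<forall>(U :: (real^'m) set) x. local_param S U x \<longrightarrow>
      local_param S' U (\<phi> \<circ> x) \<and>
      (\<forall>u\<in>U. induced_metric T (\<phi> \<circ> x) u = induced_metric T x u))"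

definition locally_isometric ::
  "'n::finite itself \<Rightarrow> 'k::finite set \<Rightarrow> (real^'k) set \<Rightarrow> (real^'k) set \<Rightarrow> bool"
  where "locally_isometric _ T S S' \<longleftrightarrow>
    (\<forall>p\<in>S. \<forall>q\<in>S'. \<exists>(U :: (real^'n) set) x x'. \<exists>u\<in>U.
      local_param S U x \<and> local_param S' U x' \<and> x u = p \<and> x' u = q \<and>
      (\<forall>v\<in>U. induced_metric T x v = induced_metric T x' v))"


section \<open>Umbilical hypersurfaces\<close>

text \<open>The ambient manifold \<open>M\<close> has coordinates \<open>Y\<close> with values in \<open>real^'m\<close>; the hypersurface is
  given in them by \<open>z\<close>, and \<open>n\<close> holds the components of a vector field of \<open>M\<close> along it.
  \<open>cov_deriv T Y z n i\<close> is the covariant derivative of \<open>n\<close>, with respect to the Levi-Civita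
  connection of \<open>M\<close>, in the direction of the i-th coordinate of the hypersurface.\<close>

definition cov_deriv ::
  "'k::finite set \<Rightarrow> (real^'m::finite \<Rightarrow> real^'k) \<Rightarrow> (real^'n::finite \<Rightarrow> real^'m) \<Rightarrow>
   (real^'n \<Rightarrow> real^'m) \<Rightarrow> 'n \<Rightarrow> real^'n \<Rightarrow> real^'m"
  where "cov_deriv T Y z n i u =
    (\<chi> \<mu>. pd i n u $ \<mu> + (\<Sum>\<alpha>\<in>UNIV. \<Sum>\<beta>\<in>UNIV.
      christoffel (induced_metric T Y) \<mu> \<alpha> \<beta> (z u) * pd i z u $ \<alpha> * n u $ \<beta>))"

definition unit_normal ::
  "'k::finite set \<Rightarrow> (real^'m::finite \<Rightarrow> real^'k) \<Rightarrow> (real^'n::finite) set \<Rightarrow>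
   (real^'n \<Rightarrow> real^'m) \<Rightarrow> (real^'n \<Rightarrow> real^'m) \<Rightarrow> bool"
  where "unit_normal T Y U z n \<longleftrightarrow>
    smooth_on U n \<and>
    (\<forall>u\<in>U. \<bar>mform (induced_metric T Y (z u)) (n u) (n u)\<bar> = 1 \<and>
      (\<forall>i. mform (induced_metric T Y (z u)) (n u) (pd i z u) = 0))"

definition extrinsic_curvature ::
  "'k::finite set \<Rightarrow> (real^'m::finite \<Rightarrow> real^'k) \<Rightarrow> (real^'n::finite \<Rightarrow> real^'m) \<Rightarrow>
   (real^'n \<Rightarrow> real^'m) \<Rightarrow> 'n \<Rightarrow> 'n \<Rightarrow> real^'n \<Rightarrow> real"
  where "extrinsic_curvature T Y z n i j u =
    mform (induced_metric T Y (z u)) (cov_deriv T Y z n i u) (pd j z u)"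

text \<open>The unit normal is only chosen locally, but compatibly with the one function \<open>\<sigma>\<close>; no
  global two-sidedness is assumed.\<close>

definition umbilical_hypersurface ::
  "'m::finite itself \<Rightarrow> 'n::finite itself \<Rightarrow> 'k::finite set \<Rightarrow> (real^'k) set \<Rightarrow> (real^'k) set \<Rightarrow>
   (real^'k \<Rightarrow> real) \<Rightarrow> bool"
  where "umbilical_hypersurface _ _ T M S \<sigma> \<longleftrightarrow>
    S \<noteq> {} \<and> connected S \<and>
    (\<forall>p\<in>S. \<exists>(V :: (real^'m) set) Y (U :: (real^'n) set) z n.
      local_param M V Y \<and> smooth_on U z \<and> z ` U \<subseteq> V \<and>
      local_param S U (Y \<circ> z) \<and> p \<in> (Y \<circ> z) ` U \<and>
      unit_normal T Y U z n \<and>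
      (\<forall>u\<in>U. \<forall>i j. extrinsic_curvature T Y z n i j u =
        \<sigma> (Y (z u)) * induced_metric T (Y \<circ> z) u $ i $ j))"


section \<open>The constant curvature spaces and spacetimes\<close>

text \<open>In both definitions \<open>d\<close> is the dimension of \<open>M\<close>, whose metric is induced by \<open>eta T\<close>.
  Curved models are hyperquadrics (hyperbolic space: one sheet), flat ones the whole space.\<close>

definition riemannian_model :: "nat \<Rightarrow> 'k::finite set \<Rightarrow> (real^'k) set \<Rightarrow> bool"
  where "riemannian_model d T M \<longleftrightarrow>
     CARD('k) = d \<and> T = {} \<and> M = UNIV
   \<or> CARD('k) = d + 1 \<and> T = {} \<and> (\<exists>r>0. M = sphere 0 r)
   \<or> CARD('k) = d + 1 \<and> (\<exists>t. T = {t} \<and> (\<exists>r>0. M = {x. eta T x x = - (r\<^sup>2) \<and> x $ t > 0}))"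

text \<open>Minkowski, de Sitter and anti-de Sitter spacetime; the last is the hyperquadric itself, not
  its universal cover.\<close>

definition lorentzian_model :: "nat \<Rightarrow> 'k::finite set \<Rightarrow> (real^'k) set \<Rightarrow> bool"
  where "lorentzian_model d T M \<longleftrightarrow>
     CARD('k) = d \<and> card T = 1 \<and> M = UNIV
   \<or> CARD('k) = d + 1 \<and> card T = 1 \<and> (\<exists>r>0. M = {x. eta T x x = r\<^sup>2})
   \<or> CARD('k) = d + 1 \<and> card T = 2 \<and> (\<exists>r>0. M = {x. eta T x x = - (r\<^sup>2)})"

end

theory Submission
  imports Defs
begin

text \<open>Every model is an affine space or a hyperquadric, so inside the ambient pseudo-Euclidean space a
  hypersurface carries the normal \<open>N\<close> and, in the curved case, the position vector as a second
  normal. Umbilicity says \<open>dN = \<sigma> dx\<close>; symmetry of the second derivatives of \<open>N\<close> forces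
  \<open>d\<sigma> = 0\<close>, hence \<open>N = \<sigma> x + C\<close>, and \<open>S\<close> lies in the quadric
  \<open>\<sigma> \<langle>x,x\<rangle> + 2 \<langle>C,x\<rangle> = \<beta>\<close>. The curvature is then read off the Gauss equation: each quadric with
  leading coefficient \<open>c\<close> and unit normal of square \<open>\<epsilon>\<close> contributes \<open>c\<^sup>2 / \<epsilon>\<close>. By Witt's theorem
  a linear isometry matches the normals of two such hypersurfaces at given points, and since a
  quadric is determined by its leading coefficient, a point and the normal there, it carries one quadric
  onto the other. \<open>S\<close> is open in its quadric section by invariance of domain.\<close>

section \<open>Partial derivatives and smooth maps\<close>

text \<open>One computation serves \<open>M\<close> and \<open>S\<close> alike: \<open>M\<close> is
  cut out by the quadrics in \<open>A\<close>, a piece of \<open>S\<close> by those and one more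
  quadric \<open>a\<close>. Non-degeneracy of the induced metrics is derived from the orthogonal,
  non-isotropic normals. The time-like hypothesis enters only through signature: it forces the unit
  normal of \<open>S\<close> to have square +1, so that its contribution to the curvature is
  +\<sigma>^2 and not -\<sigma>^2. Two obstacles shape the rest. The unit normal is chosen only
  locally, so when \<sigma> = 0 the quadric of a patch is known only up to reversing all its
  coefficients; patches are therefore glued along the set \<open>cap a\<close>, not along the triple
  \<open>a\<close>, by connectedness of \<open>S\<close>. The same reversal explains why \<sigma>^2
  rather than \<sigma> fixes the configuration. Moreover, \<open>S\<close> need not be complete but
  may be an open piece of a cap: two hypersurfaces with equal \<sigma>^2 then agree after a motion
  near prescribed points, and everywhere if both are closed in \<open>M\<close>.\<close>

lemma frechet_derivative_pd:
  fixes f :: "real^'m::finite \<Rightarrow> 'b::real_normed_vector"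
  assumes "f differentiable (at p)"
  shows "frechet_derivative f (at p) h = (\<Sum>i\<in>UNIV. h $ i *\<^sub>R pd i f p)"
proof -
  have l: "linear (frechet_derivative f (at p))"
    using assms linear_frechet_derivative by blast
  have "h = (\<Sum>i\<in>UNIV. h $ i *\<^sub>R axis i 1)"
    by (simp add: basis_expansion flip: scalar_mult_eq_scaleR)
  then have "frechet_derivative f (at p) h = frechet_derivative f (at p) (\<Sum>i\<in>UNIV. h $ i *\<^sub>R axis i 1)"
    by simp
  then show ?thesis
    by (simp add: linear_sum[OF l] linear_cmul[OF l] pd_def)
qed

lemma has_derivative_pd:
  fixes f :: "real^'m::finite \<Rightarrow> 'b::real_normed_vector"
  assumes "f differentiable (at p)"
  shows "(f has_derivative (\<lambda>h. \<Sum>i\<in>UNIV. h $ i *\<^sub>R pd i f p)) (at p)"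
  using frechet_derivative_works[of f "at p"] assms frechet_derivative_pd[OF assms]
  by (metis (no_types, lifting) ext)

lemma pd_eqI:
  fixes f :: "real^'m::finite \<Rightarrow> 'b::real_normed_vector"
  assumes "(f has_derivative D) (at p)"
  shows "pd i f p = D (axis i 1)"
  unfolding pd_def using frechet_derivative_at[OF assms] by simp

lemma sum_axis_scaleR [simp]:
  fixes f :: "'m::finite \<Rightarrow> 'b::real_vector"
  shows "(\<Sum>j\<in>UNIV. (axis i (1::real) :: real^'m::finite) $ j *\<^sub>R f j) = f i"
proof -
  have "(\<Sum>j\<in>UNIV. (axis i (1::real) :: real^'m::finite) $ j *\<^sub>R f j) = (\<Sum>j\<in>UNIV. if j = i then f j else 0)"
    by (intro sum.cong) (auto simp: axis_def)
  then show ?thesis by simp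
qed

lemma pd_transform:
  fixes f g :: "real^'m::finite \<Rightarrow> 'b::real_normed_vector"
  assumes "open U" "p \<in> U" "\<And>q. q \<in> U \<Longrightarrow> f q = g q"
  shows "pd i f p = pd i g p" "f differentiable (at p) \<longleftrightarrow> g differentiable (at p)"
proof -
  have "(f has_derivative D) (at p) \<longleftrightarrow> (g has_derivative D) (at p)" for D
    using has_derivative_transform_within_open[of f D p UNIV U g]
      has_derivative_transform_within_open[of g D p UNIV U f] assms by auto
  then show "pd i f p = pd i g p" "f differentiable (at p) \<longleftrightarrow> g differentiable (at p)"
    by (simp_all add: pd_def frechet_derivative_def differentiable_def)
qed

lemma pd_const [simp]: "pd i (\<lambda>_. c) p = 0"
  by (simp add: pd_def)

lemma pd_sum:
  fixes f :: "'a \<Rightarrow> real^'m::finite \<Rightarrow> 'b::real_normed_vector"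
  assumes "\<And>a. a \<in> I \<Longrightarrow> f a differentiable (at p)"
  shows "pd i (\<lambda>q. \<Sum>a\<in>I. f a q) p = (\<Sum>a\<in>I. pd i (f a) p)"
proof -
  have "((\<lambda>q. \<Sum>a\<in>I. f a q) has_derivative (\<lambda>h. \<Sum>a\<in>I. \<Sum>i\<in>UNIV. h $ i *\<^sub>R pd i (f a) p)) (at p)"
    by (intro has_derivative_sum has_derivative_pd assms)
  from pd_eqI[OF this] show ?thesis by simp
qed

lemma pd_add:
  fixes f g :: "real^'m::finite \<Rightarrow> 'b::real_normed_vector"
  assumes "f differentiable (at p)" "g differentiable (at p)"
  shows "pd i (\<lambda>q. f q + g q) p = pd i f p + pd i g p"
  by (rule pd_eqI[OF has_derivative_add[OF has_derivative_pd[OF assms(1)] has_derivative_pd[OF assms(2)]], THEN trans]) simp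

lemma pd_diff:
  fixes f g :: "real^'m::finite \<Rightarrow> 'b::real_normed_vector"
  assumes "f differentiable (at p)" "g differentiable (at p)"
  shows "pd i (\<lambda>q. f q - g q) p = pd i f p - pd i g p"
  by (rule pd_eqI[OF has_derivative_diff[OF has_derivative_pd[OF assms(1)] has_derivative_pd[OF assms(2)]], THEN trans]) simp

lemma pd_bilinear:
  fixes f :: "real^'m::finite \<Rightarrow> 'b::real_normed_vector"
  assumes "bounded_bilinear B" "f differentiable (at p)" "g differentiable (at p)"
  shows "pd i (\<lambda>q. B (f q) (g q)) p = B (pd i f p) (g p) + B (f p) (pd i g p)"
  by (rule pd_eqI[OF bounded_bilinear.FDERIV[OF assms(1) has_derivative_pd[OF assms(2)] has_derivative_pd[OF assms(3)]], THEN trans]) 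
    (simp add: add.commute)

lemmas pd_scaleR = pd_bilinear[OF bounded_bilinear_scaleR]

lemma pd_bounded_linear:
  fixes f :: "real^'m::finite \<Rightarrow> 'b::real_normed_vector"
  assumes "bounded_linear L" "f differentiable (at p)"
  shows "pd i (\<lambda>q. L (f q)) p = L (pd i f p)"
  by (rule pd_eqI[OF bounded_linear.has_derivative[OF assms(1) has_derivative_pd[OF assms(2)]], THEN trans]) simp

lemmas pd_nth = pd_bounded_linear[OF bounded_linear_vec_nth]

lemma pd_compose:
  fixes f :: "real^'m::finite \<Rightarrow> 'b::real_normed_vector" and z :: "real^'n::finite \<Rightarrow> real^'m"
  assumes "f differentiable (at (z p))" "z differentiable (at p)"
  shows "pd i (\<lambda>q. f (z q)) p = (\<Sum>\<alpha>\<in>UNIV. pd i z p $ \<alpha> *\<^sub>R pd \<alpha> f (z p))"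
  by (rule pd_eqI[OF has_derivative_compose[OF has_derivative_pd[OF assms(2)] has_derivative_pd[OF assms(1)]], THEN trans]) simp

lemma differentiable_compose_at:
  assumes "f differentiable (at (z p))" "z differentiable (at p)"
  shows "(\<lambda>q. f (z q)) differentiable (at p)"
  using differentiable_chain_at[OF assms(2,1)] by (simp add: o_def)

lemma differentiable_bilinear:
  assumes "bounded_bilinear B" "f differentiable (at p)" "g differentiable (at p)"
  shows "(\<lambda>q. B (f q) (g q)) differentiable (at p)"
  using bounded_bilinear.FDERIV[OF assms(1)] assms(2,3) unfolding differentiable_def by blast

lemma differentiable_linear:
  assumes "bounded_linear L" "f differentiable (at p)"
  shows "(\<lambda>q. L (f q)) differentiable (at p)"
  using bounded_linear.has_derivative[OF assms(1)] assms(2) unfolding differentiable_def by blast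

lemma differentiable_prod:
  fixes f :: "'a \<Rightarrow> 'b::real_normed_vector \<Rightarrow> 'c::real_normed_field"
  assumes "\<And>a. a \<in> I \<Longrightarrow> f a differentiable (at p)"
  shows "(\<lambda>q. \<Prod>a\<in>I. f a q) differentiable (at p)"
  using assms by (induction I rule: infinite_finite_induct) (auto intro: differentiable_mult)

lemma differentiable_nth:
  fixes f :: "'b::real_normed_vector \<Rightarrow> real^'k::finite"
  assumes "f differentiable (at p)"
  shows "(\<lambda>q. f q $ k) differentiable (at p)"
  by (rule differentiable_linear[OF bounded_linear_vec_nth assms])

lemma smooth_on_pd: "smooth_on U f \<Longrightarrow> smooth_on U (pd i f)"
  unfolding smooth_on_def by (meson Ck_on.simps(2))

lemma smooth_on_differentiable: "smooth_on U f \<Longrightarrow> p \<in> U \<Longrightarrow> f differentiable (at p)"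
  unfolding smooth_on_def by (meson Ck_on.simps(2))

lemma smooth_on_continuous: "smooth_on U f \<Longrightarrow> continuous_on U f"
  unfolding smooth_on_def by (meson Ck_on.simps(1))

lemma smooth_on_subset: "smooth_on U f \<Longrightarrow> V \<subseteq> U \<Longrightarrow> smooth_on V f"
proof -
  have "Ck_on k U f \<Longrightarrow> V \<subseteq> U \<Longrightarrow> Ck_on k V f" for k
    by (induction k arbitrary: f) (auto intro: continuous_on_subset)
  then show "smooth_on U f \<Longrightarrow> V \<subseteq> U \<Longrightarrow> smooth_on V f"
    by (auto simp: smooth_on_def)
qed

lemma smooth_on_affine:
  fixes f :: "real^'m::finite \<Rightarrow> 'b::real_normed_vector" and L :: "'b \<Rightarrow> 'c::real_normed_vector"
  assumes U: "open U" and L: "bounded_linear L" and f: "smooth_on U f"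
  shows "smooth_on U (\<lambda>u. b + L (f u))"
proof -
  have cong: "Ck_on k U g \<longleftrightarrow> Ck_on k U h" if "\<And>p. p \<in> U \<Longrightarrow> g p = h p" for k and g h :: "real^'m \<Rightarrow> 'c"
    using that
  proof (induction k arbitrary: g h)
    case 0 then show ?case by simp
  next
    case (Suc k)
    have "Ck_on k U (pd i g) = Ck_on k U (pd i h)" for i
      using Suc pd_transform(1)[OF U] by blast
    moreover have "g differentiable (at p) \<longleftrightarrow> h differentiable (at p)" if "p \<in> U" for p
      using Suc pd_transform(2)[OF U] that by blast
    ultimately show ?case by auto
  qed
  \<comment> \<open>The translation \<open>b\<close> is generalised because differentiation replaces
    it by 0 and leaves a map of the same form.\<close>
  have "Ck_on k U (\<lambda>u. b + L (f u))" if "Ck_on k U f" for k b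
    using that
  proof (induction k arbitrary: f b)
    case 0 then show ?case
      by (auto intro!: continuous_intros bounded_linear.continuous_on[OF L])
  next
    case (Suc k)
    have d: "(\<lambda>u. L (f u)) differentiable (at p)" if "p \<in> U" for p
      using Suc.prems that differentiable_linear[OF L] by auto
    have "pd i (\<lambda>u. b + L (f u)) p = 0 + L (pd i f p)" if "p \<in> U" for i p
      using Suc.prems that by (simp add: pd_add d pd_bounded_linear[OF L])
    moreover have "Ck_on k U (\<lambda>p. 0 + L (pd i f p))" for i
      using Suc.prems by (intro Suc.IH) auto
    ultimately have "Ck_on k U (pd i (\<lambda>u. b + L (f u)))" for i
      using cong[of "pd i (\<lambda>u. b + L (f u))" "\<lambda>p. 0 + L (pd i f p)"] by blast
    then show ?case using d by auto
  qed
  then show ?thesis using f by (auto simp: smooth_on_def)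
qed

section \<open>Symmetry of second derivatives\<close>

text \<open>The mean value theorem in direction \<open>i\<close> turns the second difference into a
  first difference of \<open>pd i f\<close>, which differentiability at the single point
  \<open>p\<close> controls. Continuity of second derivatives is not involved.\<close>

lemma second_difference_tendsto:
  fixes f :: "real^'m::finite \<Rightarrow> real"
  assumes U: "open U" "p \<in> U" and f: "\<And>q. q \<in> U \<Longrightarrow> f differentiable (at q)"
    and d: "pd i f differentiable (at p)"
  shows "((\<lambda>h. (f (p + h *\<^sub>R axis i 1 + h *\<^sub>R axis j 1) - f (p + h *\<^sub>R axis i 1)
            - f (p + h *\<^sub>R axis j 1) + f p) / h\<^sup>2) \<longlongrightarrow> pd j (pd i f) p) (at_right 0)"
    (is "((\<lambda>h. ?D h / h\<^sup>2) \<longlongrightarrow> _) _")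
proof -
  define a b where "a = (axis i 1 :: real^'m)" and "b = (axis j 1 :: real^'m)"
  define F where "F = frechet_derivative (pd i f) (at p)"
  have F: "(pd i f has_derivative F) (at p)"
    unfolding F_def using d frechet_derivative_works by blast
  then have lF: "linear F" by (rule has_derivative_linear)
  have Fb: "F b = pd j (pd i f) p"
    unfolding F_def pd_def b_def by simp
  have nab: "norm a = 1" "norm b = 1" unfolding a_def b_def by (simp_all add: norm_axis_1)
  show ?thesis
    unfolding a_def[symmetric] b_def[symmetric] Fb[symmetric]
  proof (rule tendstoI)
    fix e :: real assume e: "e > 0"
    \<comment> \<open>Two points at distance at most \<open>2 * h\<close> from \<open>p\<close> are
      compared, so the factor \<open>e/4\<close> makes each error at most \<open>e * h / 2\<close>.
      The second point lies at distance \<open>t < h\<close>, which makes its bound strict.\<close>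
    from F obtain \<delta>1 where \<delta>1: "\<delta>1 > 0"
      "\<And>y. norm (y - p) < \<delta>1 \<Longrightarrow> norm (pd i f y - pd i f p - F (y - p)) \<le> (e/4) * norm (y - p)"
      using e unfolding has_derivative_at_alt by (metis divide_pos_pos zero_less_numeral)
    obtain \<delta>2 where \<delta>2: "\<delta>2 > 0" "ball p \<delta>2 \<subseteq> U" using U openE by blast
    define \<delta> where "\<delta> = min \<delta>1 \<delta>2 / 2"
    have \<delta>: "\<delta> > 0" "2 * \<delta> \<le> \<delta>1" "2 * \<delta> \<le> \<delta>2" using \<delta>1 \<delta>2 by (auto simp: \<delta>_def)
    have "dist ((f (p + h *\<^sub>R a + h *\<^sub>R b) - f (p + h *\<^sub>R a) - f (p + h *\<^sub>R b) + f p) / h\<^sup>2) (F b) < e"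
      if h: "0 < h" "h < \<delta>" for h
    proof -
      \<comment> \<open>The second difference is \<open>\<phi> h - \<phi> 0\<close>, an increment of
        a function of one variable.\<close>
      define \<phi> where "\<phi> t = f (p + t *\<^sub>R a + h *\<^sub>R b) - f (p + t *\<^sub>R a)" for t
      have near: "norm ((p + t *\<^sub>R a + s *\<^sub>R b) - p) \<le> 2 * h" if "0 \<le> t" "t \<le> h" "0 \<le> s" "s \<le> h" for t s
      proof -
        have "norm (t *\<^sub>R a + s *\<^sub>R b) \<le> norm (t *\<^sub>R a) + norm (s *\<^sub>R b)" by (rule norm_triangle_ineq)
        also have "\<dots> \<le> 2 * h" using that by (simp add: nab)
        finally show ?thesis by (simp add: algebra_simps)
      qed
      have inU: "p + t *\<^sub>R a + s *\<^sub>R b \<in> U" if "0 \<le> t" "t \<le> h" "0 \<le> s" "s \<le> h" for t s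
      proof -
        have "dist p (p + t *\<^sub>R a + s *\<^sub>R b) < \<delta>2"
          unfolding dist_norm norm_minus_commute[of p] using near[OF that] h \<delta> by linarith

        then show ?thesis using \<delta>2 by auto
      qed
      have fd: "((\<lambda>t. f (p + t *\<^sub>R a + s *\<^sub>R b)) has_derivative
          (\<lambda>r. r * pd i f (p + t *\<^sub>R a + s *\<^sub>R b))) (at t)"
        if "0 \<le> t" "t \<le> h" "0 \<le> s" "s \<le> h" for t s
      proof -
        have "((\<lambda>t. p + t *\<^sub>R a + s *\<^sub>R b) has_derivative (\<lambda>r. r *\<^sub>R a)) (at t)"
          by (auto intro!: derivative_eq_intros)
        from has_derivative_compose[OF this has_derivative_pd[OF f[OF inU[OF that]]]]
        have "((\<lambda>t. f (p + t *\<^sub>R a + s *\<^sub>R b)) has_derivative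
          (\<lambda>r. \<Sum>k\<in>UNIV. (r *\<^sub>R a) $ k *\<^sub>R pd k f (p + t *\<^sub>R a + s *\<^sub>R b))) (at t)" .
        moreover have "(\<lambda>r. \<Sum>k\<in>UNIV. (r *\<^sub>R a) $ k *\<^sub>R pd k f (p + t *\<^sub>R a + s *\<^sub>R b)) =
          (\<lambda>r. r * pd i f (p + t *\<^sub>R a + s *\<^sub>R b))"
        proof
          fix r
          have "(\<Sum>k\<in>UNIV. (r *\<^sub>R a) $ k *\<^sub>R pd k f (p + t *\<^sub>R a + s *\<^sub>R b)) =
            r * (\<Sum>k\<in>UNIV. a $ k *\<^sub>R pd k f (p + t *\<^sub>R a + s *\<^sub>R b))"
            by (simp add: sum_distrib_left mult.assoc)
          then show "(\<Sum>k\<in>UNIV. (r *\<^sub>R a) $ k *\<^sub>R pd k f (p + t *\<^sub>R a + s *\<^sub>R b)) =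
            r * pd i f (p + t *\<^sub>R a + s *\<^sub>R b)"
            using sum_axis_scaleR[of i "\<lambda>k. pd k f (p + t *\<^sub>R a + s *\<^sub>R b)"]
            unfolding a_def by simp
        qed
        ultimately show ?thesis by simp
      qed
      have \<phi>d: "(\<phi> has_derivative (\<lambda>r. r * (pd i f (p + t *\<^sub>R a + h *\<^sub>R b) - pd i f (p + t *\<^sub>R a)))) (at t)"
        if "0 \<le> t" "t \<le> h" for t
        using has_derivative_diff[OF fd[OF that, of h] fd[OF that, of 0]] h
        unfolding \<phi>_def by (simp add: right_diff_distrib)
      have "\<exists>t\<in>{0<..<h}. \<phi> h - \<phi> 0 = (h - 0) * (pd i f (p + t *\<^sub>R a + h *\<^sub>R b) - pd i f (p + t *\<^sub>R a))"
        by (rule mvt_simple[where f' = "\<lambda>t r. r * (pd i f (p + t *\<^sub>R a + h *\<^sub>R b) - pd i f (p + t *\<^sub>R a))"])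
          (use h in \<open>simp_all add: has_derivative_at_withinI[OF \<phi>d]\<close>)
      then obtain t where t: "0 < t" "t < h"
        and eq: "\<phi> h - \<phi> 0 = h * (pd i f (p + t *\<^sub>R a + h *\<^sub>R b) - pd i f (p + t *\<^sub>R a))" by auto
      define y1 y2 where "y1 = p + t *\<^sub>R a + h *\<^sub>R b" and "y2 = p + t *\<^sub>R a"
      have n: "norm (y1 - p) \<le> 2 * h" "norm (y2 - p) \<le> 2 * h"
        using near[of t h] near[of t 0] t h by (simp_all add: y1_def y2_def)
      have "norm (pd i f y1 - pd i f p - F (y1 - p)) \<le> (e/4) * norm (y1 - p)"
        using n h \<delta> by (intro \<delta>1) linarith
      also have "\<dots> \<le> (e/4) * (2 * h)" using n e by (intro mult_left_mono) auto
      finally have "norm (pd i f y1 - pd i f p - F (y1 - p)) \<le> e * h / 2" by simp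
      moreover have "norm (pd i f y2 - pd i f p - F (y2 - p)) < e * h / 2"
      proof -
        have "norm (pd i f y2 - pd i f p - F (y2 - p)) \<le> (e/4) * norm (y2 - p)"
          using n h \<delta> by (intro \<delta>1) linarith
        also have "norm (y2 - p) = t" using t by (simp add: y2_def nab)
        finally have "norm (pd i f y2 - pd i f p - F (y2 - p)) \<le> e * t / 4" by simp
        moreover have "0 < e * t" "e * t < e * h" using t e by simp_all
        ultimately show ?thesis by linarith
      qed
      moreover have "F (y1 - p) - F (y2 - p) = h * F b"
        using linear_diff[OF lF, of "y1 - p" "y2 - p"] linear_cmul[OF lF, of h b]
        by (simp add: y1_def y2_def)
      ultimately have "\<bar>(pd i f y1 - pd i f y2) - h * F b\<bar> < e * h"
        by (simp add: abs_if split: if_splits)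
      then have "\<bar>h * ((pd i f y1 - pd i f y2) - h * F b)\<bar> < e * h\<^sup>2"
        using h by (simp add: abs_mult power2_eq_square mult.commute mult.left_commute)
      moreover have "\<phi> h - \<phi> 0 = h * (pd i f y1 - pd i f y2)"
        using eq by (simp only: y1_def y2_def)
      ultimately have "\<bar>(\<phi> h - \<phi> 0) - h\<^sup>2 * F b\<bar> < e * h\<^sup>2"
        by (simp add: algebra_simps power2_eq_square)
      then have "\<bar>(\<phi> h - \<phi> 0) / h\<^sup>2 - F b\<bar> < e"
      proof -
        have "(\<phi> h - \<phi> 0) / h\<^sup>2 - F b = ((\<phi> h - \<phi> 0) - h\<^sup>2 * F b) / h\<^sup>2"
          using h by (simp add: diff_divide_distrib)
        then show ?thesis
          using h \<open>\<bar>(\<phi> h - \<phi> 0) - h\<^sup>2 * F b\<bar> < e * h\<^sup>2\<close> by (simp add: pos_divide_less_eq)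
      qed
      moreover have "\<phi> h - \<phi> 0 = f (p + h *\<^sub>R a + h *\<^sub>R b) - f (p + h *\<^sub>R a) - f (p + h *\<^sub>R b) + f p"
        by (simp add: \<phi>_def)
      ultimately show ?thesis by (simp add: dist_real_def)
    qed
    then show "\<forall>\<^sub>F h in at_right 0. dist ((f (p + h *\<^sub>R a + h *\<^sub>R b) - f (p + h *\<^sub>R a) - f (p + h *\<^sub>R b) + f p) / h\<^sup>2) (F b) < e"
      using \<delta>(1) unfolding eventually_at_right_field by auto
  qed
qed

text \<open>The second difference quotient is symmetric in \<open>i\<close> and \<open>j\<close>, so
  both mixed derivatives are its limit. The weak hypotheses matter: the embedded unit normal, to
  which this is applied later, is only shown to be twice differentiable.\<close>

lemma pd_commute:
  fixes f :: "real^'m::finite \<Rightarrow> real^'k::finite"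
  assumes U: "open U" "p \<in> U" and f: "\<And>q. q \<in> U \<Longrightarrow> f differentiable (at q)"
    and d: "pd i f differentiable (at p)" "pd j f differentiable (at p)"
  shows "pd j (pd i f) p = pd i (pd j f) p"
proof (rule vec_eq_iff[THEN iffD2], rule allI)
  fix k
  define g where "g = (\<lambda>q. f q $ k)"
  have g: "g differentiable (at q)" if "q \<in> U" for q
    unfolding g_def by (rule differentiable_nth[OF f[OF that]])
  have pg: "pd i f q $ k = pd i g q" if "q \<in> U" for i q
    unfolding g_def by (simp add: pd_nth[OF f[OF that]])
  have dg: "pd i g differentiable (at p)" "pd j g differentiable (at p)"
    using pd_transform(2)[OF U, of "\<lambda>q. pd i f q $ k" "pd i g", OF pg]
      pd_transform(2)[OF U, of "\<lambda>q. pd j f q $ k" "pd j g", OF pg]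
      differentiable_nth[OF d(1), of k] differentiable_nth[OF d(2), of k] by auto
  have eq: "pd j (pd i f) p $ k = pd j (pd i g) p" "pd i (pd j f) p $ k = pd i (pd j g) p"
    using pd_nth[OF d(1), where i=j] pd_nth[OF d(2), where i=i]
      pd_transform(1)[OF U, of "\<lambda>q. pd i f q $ k" "pd i g" j, OF pg]
      pd_transform(1)[OF U, of "\<lambda>q. pd j f q $ k" "pd j g" i, OF pg] by simp_all
  have "((\<lambda>h. (g (p + h *\<^sub>R axis i 1 + h *\<^sub>R axis j 1) - g (p + h *\<^sub>R axis i 1)
            - g (p + h *\<^sub>R axis j 1) + g p) / h\<^sup>2) \<longlongrightarrow> pd i (pd j g) p) (at_right 0)"
    using second_difference_tendsto[OF U g dg(2), of i] by (simp add: algebra_simps)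
  then show "pd j (pd i f) p $ k = pd i (pd j f) p $ k"
    unfolding eq using second_difference_tendsto[OF U g dg(1), of j]
    by (intro tendsto_unique[of "at_right (0::real)"]) auto
qed

lemma smooth_on_pd_commute:
  fixes f :: "real^'m::finite \<Rightarrow> real^'k::finite"
  assumes "open U" "smooth_on U f" "p \<in> U"
  shows "pd j (pd i f) p = pd i (pd j f) p"
  using assms by (intro pd_commute) (auto intro: smooth_on_differentiable smooth_on_pd)

section \<open>The form eta\<close>

lemma eta_inner: "eta T v w = (\<chi> i. (if i \<in> T then -1 else 1) * v $ i) \<bullet> w"
  by (simp add: eta_def inner_vec_def)

lemma eta_commute: "eta T v w = eta T w v"
  by (simp add: eta_def mult_ac)

interpretation eta: bounded_bilinear "eta T" for T :: "'k::finite set"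
proof -
  have "bilinear (eta T)"
    unfolding bilinear_def eta_inner
    by (auto intro!: linearI simp: inner_add_right inner_vec_def algebra_simps sum.distrib sum_distrib_left sum_negf)
  then show "bounded_bilinear (eta T)"
    by (simp add: bilinear_conv_bounded_bilinear)
qed

lemma eta_nondegenerate:
  assumes "\<And>w. eta T v w = 0"
  shows "v = 0"
proof (rule vec_eq_iff[THEN iffD2], rule allI)
  fix i
  have "eta T v (axis i 1) = (\<Sum>j\<in>UNIV. if j = i then (if i \<in> T then -1 else 1) * v $ i else 0)"
    unfolding eta_def by (intro sum.cong) (auto simp: axis_def)
  then show "v $ i = 0 $ i" using assms[of "axis i 1"] by (simp split: if_splits)
qed

section \<open>Frames made of tangent vectors and orthogonal normals\<close>

lemma dim_frame:
  fixes D :: "'b::euclidean_space \<Rightarrow> real^'k::finite"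
  assumes D: "linear D" "inj D" and A: "finite A"
    and v: "\<And>a b. a \<in> A \<Longrightarrow> b \<in> A \<Longrightarrow> a \<noteq> b \<Longrightarrow> eta T (v a) (v b) = 0"
      "\<And>a. a \<in> A \<Longrightarrow> eta T (v a) (v a) \<noteq> 0" "\<And>a h. a \<in> A \<Longrightarrow> eta T (v a) (D h) = 0"
  shows "dim (range D \<union> v ` A) = DIM('b) + card A"
  using A v
proof (induction A rule: finite_induct)
  case empty
  have "dim (range D) = DIM('b)" using dim_image_eq[OF D(1), of UNIV] D(2) by simp
  then show ?case by simp
next
  case (insert a A)
  have "eta T (v a) w = 0" if "w \<in> span (range D \<union> v ` A)" for w
    using that
  proof (induction rule: span_induct_alt)
    case base then show ?case by (simp add: eta.zero_right)
  next
    case (step c x y)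
    then have "eta T (v a) x = 0" using insert.prems insert.hyps by auto
    then show ?case using step by (simp add: eta.add_right eta.scaleR_right)
  qed
  moreover have "eta T (v a) (v a) \<noteq> 0" using insert.prems by simp
  \<comment> \<open>A vector orthogonal to a span but not to itself lies outside that span, so each
    normal raises the dimension by one.\<close>
  ultimately have "v a \<notin> span (range D \<union> v ` A)" by blast
  moreover have "dim (range D \<union> v ` A) = DIM('b) + card A"
    using insert by (intro insert.IH) auto
  ultimately show ?case using insert.hyps by (simp add: dim_insert)
qed

text \<open>The image of \<open>D\<close> plays the tangent space and \<open>v\<close> an orthogonal
  basis of its normal space. The form restricted to the tangent space is not assumed non-degenerate;
  that follows from the dimension count and from \<open>e\<close> having no zeros.\<close>

locale frame =
  fixes T :: "'k::finite set" and D :: "real^'n::finite \<Rightarrow> real^'k" and A :: "'a set"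
    and v :: "'a \<Rightarrow> real^'k" and e :: "'a \<Rightarrow> real"
  assumes D: "linear D" "inj D" and finite_A: "finite A" and card_A: "CARD('n) + card A = CARD('k)"
    and v_orth: "\<And>a b. a \<in> A \<Longrightarrow> b \<in> A \<Longrightarrow> eta T (v a) (v b) = (if a = b then e a else 0)"
    and e_nz: "\<And>a. a \<in> A \<Longrightarrow> e a \<noteq> 0"
    and v_D: "\<And>a h. a \<in> A \<Longrightarrow> eta T (v a) (D h) = 0"
begin

lemma span_frame: "span (range D \<union> v ` A) = UNIV"
proof -
  have "dim (range D \<union> v ` A) = CARD('n) + card A"
    using dim_frame[OF D finite_A, of T v] v_orth e_nz v_D by auto
  then show ?thesis using card_A by (simp add: dim_eq_full[symmetric])
qed

lemma frame_zero:
  assumes "\<And>h. eta T (D h) w = 0" "\<And>a. a \<in> A \<Longrightarrow> eta T (v a) w = 0"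
  shows "w = 0"
proof (rule eta_nondegenerate)
  fix x
  have "x \<in> span (range D \<union> v ` A)" using span_frame by simp
  then show "eta T w x = 0"
  proof (induction rule: span_induct_alt)
    case base then show ?case by (simp add: eta.zero_right)
  next
    case (step c x y)
    then have "eta T w x = 0" using assms by (auto simp: eta_commute[of T w])
    then show ?case using step by (simp add: eta.add_right eta.scaleR_right)
  qed
qed

lemma normal_expansion:
  assumes "\<And>h. eta T (D h) w = 0"
  shows "w = (\<Sum>a\<in>A. (eta T (v a) w / e a) *\<^sub>R v a)"
proof -
  have "w - (\<Sum>a\<in>A. (eta T (v a) w / e a) *\<^sub>R v a) = 0"
  proof (rule frame_zero)
    show "eta T (D h) (w - (\<Sum>a\<in>A. (eta T (v a) w / e a) *\<^sub>R v a)) = 0" for h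
      using assms v_D by (simp add: eta.diff_right eta.sum_right eta.scaleR_right eta_commute[of T "D h"])
    fix b assume b: "b \<in> A"
    have "eta T (v b) (\<Sum>a\<in>A. (eta T (v a) w / e a) *\<^sub>R v a) = (\<Sum>a\<in>A. if a = b then eta T (v b) w else 0)"
      unfolding eta.sum_right using b v_orth e_nz by (intro sum.cong) (auto simp: eta.scaleR_right)
    then show "eta T (v b) (w - (\<Sum>a\<in>A. (eta T (v a) w / e a) *\<^sub>R v a)) = 0"
      using b finite_A by (simp add: eta.diff_right)
  qed
  then show ?thesis by simp
qed

text \<open>If \<open>h\<close> is in the kernel of the Gram matrix, then \<open>D h\<close> is
  orthogonal to all tangent vectors, and to the normals anyway; hence \<open>D h = 0\<close>, and
  \<open>D\<close> is injective.\<close>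

lemma gram_invertible: "invertible (\<chi> i j. eta T (D (axis i 1)) (D (axis j 1)))" (is "invertible ?G")
proof -
  have "h = 0" if "?G *v h = 0" for h
  proof -
    have Dh: "D h = (\<Sum>j\<in>UNIV. h $ j *\<^sub>R D (axis j 1))" for h
    proof -
      have "D h = D (\<Sum>j\<in>UNIV. h $ j *\<^sub>R axis j 1)"
        by (simp add: basis_expansion flip: scalar_mult_eq_scaleR)
      then show ?thesis by (simp add: linear_sum[OF D(1)] linear_cmul[OF D(1)])
    qed
    have "eta T (D (axis i 1)) (D h) = 0" for i
    proof -
      have "(?G *v h) $ i = eta T (D (axis i 1)) (D h)"
        by (subst Dh[of h]) (simp add: matrix_vector_mult_def eta.sum_right eta.scaleR_right mult.commute)
      then show ?thesis using that by simp
    qed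
    then have "eta T (D k) (D h) = 0" for k
      by (subst Dh[of k]) (simp add: eta.sum_left eta.scaleR_left)
    then have "D h = 0" using v_D by (intro frame_zero) auto
    then show "h = 0" using D by (metis linear_0 injD)
  qed
  then have "inj ((*v) ?G)"
    by (subst linear_injective_0) auto
  then obtain B where "B ** ?G = mat 1" using matrix_left_invertible_injective by blast
  then show ?thesis using invertible_def matrix_left_right_inverse by blast
qed

end

lemma dim_coordinates: "dim {x :: real^'k::finite. \<forall>i. i \<notin> T \<longrightarrow> x $ i = 0} = card T"
  using dim_substandard_cart[of T, where 'a=real] by (simp add: dim_vec_eq)

text \<open>Sylvester's law of inertia, in the direction needed to exclude time-like normals.\<close>

lemma card_negative_le:
  fixes v :: "'a \<Rightarrow> real^'k::finite"
  assumes A: "finite A" and v: "\<And>a b. a \<in> A \<Longrightarrow> b \<in> A \<Longrightarrow> a \<noteq> b \<Longrightarrow> eta T (v a) (v b) = 0"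
      and neg: "\<And>a. a \<in> A \<Longrightarrow> eta T (v a) (v a) < 0"
  shows "card A \<le> card T"
proof -
  \<comment> \<open>\<open>P\<close> projects to the negative axes. The form is non-negative on the
    kernel of \<open>P\<close> and negative definite on the span of the \<open>v a\<close>, so
    \<open>P\<close> is injective on that span.\<close>
  define P where "P x = (\<chi> i. if i \<in> T then x $ i else 0)" for x :: "real^'k"
  have lP: "linear P" by (auto intro!: linearI simp: P_def vec_eq_iff)
  have inj: "inj_on v A"
    using v neg by (metis (no_types, lifting) inj_onI less_irrefl)
  have indep: "independent (v ` A)"
    using A v neg
  proof (induction A rule: finite_induct)
    case (insert a A)
    have "eta T (v a) w = 0" if "w \<in> span (v ` A)" for w
      using that
    proof (induction rule: span_induct_alt)
      case base then show ?case by (simp add: eta.zero_right)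
    next
      case (step c x y)
      then have "eta T (v a) x = 0" using insert.prems insert.hyps by auto
      then show ?case using step by (simp add: eta.add_right eta.scaleR_right)
    qed
    moreover have "eta T (v a) (v a) < 0" using insert.prems by simp
    ultimately have "v a \<notin> span (v ` A)" by force
    then show ?case using insert by (simp add: independent_insertI)
  qed (simp add: independent_empty)
  have neg_span: "w = 0" if w: "w \<in> span (v ` A)" and P0: "P w = 0" for w
  proof -
    obtain u where u: "w = (\<Sum>x\<in>v ` A. u x *\<^sub>R x)"
      using w span_finite[of "v ` A"] A by auto
    then have wu: "w = (\<Sum>a\<in>A. u (v a) *\<^sub>R v a)"
      by (simp add: sum.reindex[OF inj])
    have ew: "eta T w (v a) = u (v a) * eta T (v a) (v a)" if "a \<in> A" for a
    proof -
      have "eta T w (v a) = (\<Sum>b\<in>A. if b = a then u (v a) * eta T (v a) (v a) else 0)"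
        unfolding wu eta.sum_left using v that by (intro sum.cong) (auto simp: eta.scaleR_left)
      then show ?thesis using A that by simp
    qed
    have "eta T w w = (\<Sum>a\<in>A. u (v a) * eta T w (v a))"
      by (subst (2) wu) (simp add: eta.sum_right eta.scaleR_right)
    then have eq: "eta T w w = (\<Sum>a\<in>A. (u (v a))\<^sup>2 * eta T (v a) (v a))"
      by (simp add: ew power2_eq_square mult.assoc)
    have "w $ i = 0" if "i \<in> T" for i
      using P0 that by (auto simp: P_def vec_eq_iff dest: spec[of _ i])
    then have "0 \<le> eta T w w"
      unfolding eta_def by (intro sum_nonneg) auto
    moreover have np: "(u (v a))\<^sup>2 * eta T (v a) (v a) \<le> 0" if "a \<in> A" for a
      using neg[OF that] by (simp add: mult_le_0_iff)
    ultimately have "(\<Sum>a\<in>A. - ((u (v a))\<^sup>2 * eta T (v a) (v a))) = 0"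
      using sum_nonpos[of A "\<lambda>a. (u (v a))\<^sup>2 * eta T (v a) (v a)"] eq by (simp add: sum_negf)
    then have "\<forall>a\<in>A. - ((u (v a))\<^sup>2 * eta T (v a) (v a)) = 0"
      using A np by (subst (asm) sum_nonneg_eq_0_iff) auto
    then have "\<forall>a\<in>A. u (v a) = 0" using neg by fastforce
    then show "w = 0" by (simp add: wu)
  qed
  have "inj_on P (span (v ` A))"
    using neg_span by (intro linear_inj_on_span_iff_independent_image[THEN iffD2] inj_onI)
      (metis (no_types, lifting) eq_iff_diff_eq_0 lP linear_diff span_diff)
  then have "dim (P ` v ` A) = dim (v ` A)"
    by (intro dim_image_eq lP)
  also have "\<dots> = card A" using indep by (simp add: dim_eq_card_independent card_image[OF inj])
  finally have "card A = dim (P ` v ` A)" by simp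
  also have "\<dots> \<le> dim {x :: real^'k. \<forall>i. i \<notin> T \<longrightarrow> x $ i = 0}"
    by (intro dim_subset) (auto simp: P_def)
  finally show ?thesis by (simp add: dim_coordinates)
qed

section \<open>Linear isometries\<close>

definition eta_isometry :: "'k::finite set \<Rightarrow> (real^'k \<Rightarrow> real^'k) \<Rightarrow> bool"
  where "eta_isometry T L \<longleftrightarrow> linear L \<and> (\<forall>x y. eta T (L x) (L y) = eta T x y)"

lemma eta_isometry_bij: 
  assumes "eta_isometry T L" shows "bij L"
proof -
  have L: "linear L" "\<And>x y. eta T (L x) (L y) = eta T x y" using assms by (auto simp: eta_isometry_def)
  have "x = 0" if "L x = 0" for x
    by (rule eta_nondegenerate[of T]) (metis L(2) that eta.zero_left)
  then have "inj L" using linear_injective_0[OF L(1)] by blast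
  then show ?thesis using linear_injective_imp_surjective[OF L(1)] by (simp add: bij_def)
qed

definition reflection :: "'k::finite set \<Rightarrow> real^'k \<Rightarrow> real^'k \<Rightarrow> real^'k"
  where "reflection T u x = x - (2 * eta T x u / eta T u u) *\<^sub>R u"

lemma eta_isometry_reflection:
  assumes "eta T u u \<noteq> 0"
  shows "eta_isometry T (reflection T u)"
  unfolding eta_isometry_def
proof (intro conjI allI)
  show "linear (reflection T u)"
    by (intro linearI) (simp_all add: reflection_def eta.add_left eta.scaleR_left algebra_simps add_divide_distrib)
  fix x y
  show "eta T (reflection T u x) (reflection T u y) = eta T x y"
    using assms eta_commute[of T u y]
    by (simp add: reflection_def eta.diff_left eta.diff_right eta.scaleR_left eta.scaleR_right field_simps)
qed

lemma reflection_fix: "eta T x u = 0 \<Longrightarrow> reflection T u x = x"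
  by (simp add: reflection_def)

lemma eta_isometry_compose: "eta_isometry T L \<Longrightarrow> eta_isometry T R \<Longrightarrow> eta_isometry T (R \<circ> L)"
  by (auto simp: eta_isometry_def intro: linear_compose)

text \<open>One of \<open>v - w\<close> and \<open>v + w\<close> is not isotropic, and the reflection in it maps \<open>v\<close> to \<open>\<plusminus>w\<close>.\<close>

lemma witt_vector:
  assumes vw: "eta T v v = eta T w w" and nz: "eta T w w \<noteq> 0"
  shows "\<exists>L. eta_isometry T L \<and> L v = w \<and> (\<forall>x. eta T x v = 0 \<and> eta T x w = 0 \<longrightarrow> L x = x)"
proof (cases "eta T (v - w) (v - w) = 0")
  case False
  have "2 * eta T v (v - w) = eta T (v - w) (v - w)"
    using vw eta_commute[of T v w] by (simp add: eta.diff_left eta.diff_right)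
  then have "reflection T (v - w) v = w"
    using False by (simp add: reflection_def)
  then show ?thesis
    using eta_isometry_reflection[OF False]
    by (intro exI[of _ "reflection T (v - w)"]) (auto simp: reflection_fix eta.diff_right)
next
  case True
  have "eta T (v + w) (v + w) + eta T (v - w) (v - w) = 4 * eta T w w"
    using vw by (simp add: eta.diff_left eta.diff_right eta.add_left eta.add_right)
  with True nz have nz': "eta T (v + w) (v + w) \<noteq> 0" by simp
  have "2 * eta T v (v + w) = eta T (v + w) (v + w)"
    using vw eta_commute[of T v w] by (simp add: eta.add_left eta.add_right)
  then have "reflection T (v + w) v = - w"
    using nz' by (simp add: reflection_def)
  moreover have "reflection T w (- w) = w"
    using nz by (simp add: reflection_def eta.minus_left scaleR_2)
  ultimately show ?thesis
    using eta_isometry_compose[OF eta_isometry_reflection[OF nz'] eta_isometry_reflection[OF nz]]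
    by (intro exI[of _ "reflection T w \<circ> reflection T (v + w)"]) (auto simp: reflection_fix eta.add_right)
qed

text \<open>Induction on the family: after matching the vectors indexed by \<open>A\<close>, the
  remaining one is corrected by an isometry that fixes everything orthogonal to both its current and
  its desired position. The vectors already matched are among these.\<close>

lemma witt:
  assumes "finite A"
    and "\<And>a b. a \<in> A \<Longrightarrow> b \<in> A \<Longrightarrow> eta T (v a) (v b) = (if a = b then e a else 0)"
    and "\<And>a b. a \<in> A \<Longrightarrow> b \<in> A \<Longrightarrow> eta T (w a) (w b) = (if a = b then e a else 0)"
    and "\<And>a. a \<in> A \<Longrightarrow> e a \<noteq> 0"
  shows "\<exists>L. eta_isometry T L \<and> (\<forall>a\<in>A. L (v a) = w a)"
  using assms
proof (induction A rule: finite_induct)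
  case empty
  have "eta_isometry T id" by (simp add: eta_isometry_def linear_id)
  then show ?case by blast
next
  case (insert a A)
  obtain L where L: "eta_isometry T L" "\<And>b. b \<in> A \<Longrightarrow> L (v b) = w b"
    using insert.IH insert.prems by (smt (verit) insertCI)
  have pres: "eta T (L x) (L y) = eta T x y" for x y using L by (simp add: eta_isometry_def)
  obtain R where R: "eta_isometry T R" "R (L (v a)) = w a"
    and Rfix: "\<And>x. eta T x (L (v a)) = 0 \<Longrightarrow> eta T x (w a) = 0 \<Longrightarrow> R x = x"
    using witt_vector[of T "L (v a)" "w a"] insert.prems pres by auto
  have "R (w b) = w b" if "b \<in> A" for b
  proof (rule Rfix)
    show "eta T (w b) (L (v a)) = 0"
      using pres[of "v b" "v a"] insert.prems(1)[of b a] insert.hyps(2) that L(2)[OF that] by auto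
    show "eta T (w b) (w a) = 0"
      using insert.prems(2)[of b a] insert.hyps(2) that by auto
  qed
  then have "\<forall>b\<in>insert a A. (R \<circ> L) (v b) = w b"
    using R L by auto
  then show ?case using eta_isometry_compose[OF L(1) R(1)] by blast
qed

section \<open>Quadrics\<close>

text \<open>A triple \<open>(c, C, \<beta>)\<close> stands for the quadric \<open>c \<langle>y,y\<rangle> + 2 \<langle>C,y\<rangle> = \<beta>\<close>, a hyperplane if \<open>c = 0\<close>;
  \<open>nrm\<close> is half the gradient of \<open>quad\<close> with respect to \<open>eta\<close>.\<close>

definition quad :: "'k::finite set \<Rightarrow> real \<times> (real^'k) \<times> real \<Rightarrow> real^'k \<Rightarrow> real"
  where "quad T a y = fst a * eta T y y + 2 * eta T (fst (snd a)) y - snd (snd a)"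

definition nrm :: "real \<times> (real^'k::finite) \<times> real \<Rightarrow> real^'k \<Rightarrow> real^'k"
  where "nrm a y = fst a *\<^sub>R y + fst (snd a)"

lemma quad_add: "quad T a (y + h) = quad T a y + 2 * eta T (nrm a y) h + fst a * eta T h h"
  using eta_commute[of T y h]
  by (simp add: quad_def nrm_def eta.add_left eta.add_right eta.scaleR_left algebra_simps)

lemma nrm_add: "nrm a (y + h) = nrm a y + fst a *\<^sub>R h"
  by (simp add: nrm_def algebra_simps)

text \<open>The trapezoidal rule is exact for quadratic functions, \<open>nrm\<close> being half the
  gradient. For two points of one quadric it makes their chord orthogonal to the sum of the two
  normals.\<close>

lemma quad_diff: "quad T a y' - quad T a y = eta T (nrm a y + nrm a y') (y' - y)"
  using quad_add[of T a y "y' - y"] nrm_add[of a y "y' - y"]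
    eta.add_left[of T "nrm a y" "nrm a y'"] eta.add_left[of T "nrm a y"]
  by (simp add: eta.scaleR_left)

text \<open>The expansions of \<open>quad\<close> at \<open>p\<close> and at \<open>q\<close> have
  three terms each: the values vanish, \<open>L\<close> matches the gradients, and the quadratic
  terms agree because \<open>L\<close> preserves \<open>eta\<close>.\<close>

lemma quad_image:
  assumes L: "eta_isometry T L" and Lp: "L (nrm a p) = nrm a' q" and "fst a = fst a'"
    and "quad T a p = 0" "quad T a' q = 0"
  shows "quad T a' (q + L (y - p)) = quad T a y"
proof -
  have pres: "eta T (L x) (L y) = eta T x y" for x y using L by (simp add: eta_isometry_def)
  have "quad T a' (q + L (y - p)) = quad T a (p + (y - p))"
    unfolding quad_add Lp[symmetric] pres using assms by simp
  then show ?thesis by simp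
qed

section \<open>The Gauss equation for immersions into intersections of quadrics\<close>

lemma christoffel_commute:
  "christoffel (induced_metric T x) \<mu> \<alpha> \<beta> = christoffel (induced_metric T x) \<mu> \<beta> \<alpha>"
proof -
  have *: "(\<lambda>q. induced_metric T x q $ \<alpha> $ \<beta>) = (\<lambda>q. induced_metric T x q $ \<beta> $ \<alpha>)" for \<alpha> \<beta>
    by (simp add: induced_metric_def eta_commute)
  show ?thesis
    by (rule ext) (simp add: christoffel_def *[of \<alpha> \<beta>] add.commute)
qed

lemma matrix_inv_right:
  fixes M :: "real^'n::finite^'n"
  assumes "invertible M" shows "M ** matrix_inv M = mat 1"
  using assms unfolding invertible_def matrix_inv_def by (metis (mono_tags, lifting) someI_ex)

text \<open>The Koszul formula for an induced metric. Differentiating the metric gives six products;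
  by symmetry of second derivatives four cancel and the other two coincide, which absorbs the factor
  1/2.\<close>

lemma christoffel_lower:
  fixes x :: "real^'m::finite \<Rightarrow> real^'k::finite"
  assumes U: "open U" "u \<in> U" and x: "smooth_on U x" and inv: "invertible (induced_metric T x u)"
  shows "(\<Sum>\<mu>\<in>UNIV. induced_metric T x u $ l $ \<mu> * christoffel (induced_metric T x) \<mu> \<alpha> \<beta> u) =
    eta T (pd l x u) (pd \<alpha> (pd \<beta> x) u)"
proof -
  define g where "g = induced_metric T x"
  have d: "pd i x differentiable (at u)" for i
    using x U by (intro smooth_on_differentiable[of U] smooth_on_pd)
  have dg: "pd k (\<lambda>q. g q $ i $ j) u = eta T (pd k (pd i x) u) (pd j x u) + eta T (pd i x u) (pd k (pd j x) u)" for i j k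
    unfolding g_def induced_metric_def using pd_bilinear[OF eta.bounded_bilinear_axioms d d] by simp
  have comm: "pd i (pd j x) u = pd j (pd i x) u" for i j
    using smooth_on_pd_commute[OF U(1) x U(2)] .
  have b: "(1/2) * (pd \<alpha> (\<lambda>q. g q $ \<nu> $ \<beta>) u + pd \<beta> (\<lambda>q. g q $ \<nu> $ \<alpha>) u - pd \<nu> (\<lambda>q. g q $ \<alpha> $ \<beta>) u) =
    eta T (pd \<nu> x u) (pd \<alpha> (pd \<beta> x) u)" for \<nu>
    unfolding dg using comm[of \<alpha> \<nu>] comm[of \<beta> \<nu>] comm[of \<beta> \<alpha>] 
      eta_commute[of T "pd \<nu> (pd \<alpha> x) u" "pd \<beta> x u"] eta_commute[of T "pd \<nu> (pd \<beta> x) u" "pd \<alpha> x u"]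
    by simp
  define w where "w = (\<chi> \<nu>. eta T (pd \<nu> x u) (pd \<alpha> (pd \<beta> x) u))"
  have chr: "christoffel g \<mu> \<alpha> \<beta> u = (matrix_inv (g u) *v w) $ \<mu>" for \<mu>
    unfolding christoffel_def w_def matrix_vector_mult_def
    by (simp add: b[symmetric] sum_distrib_left mult_ac sum_divide_distrib)
  have "(\<Sum>\<mu>\<in>UNIV. g u $ l $ \<mu> * christoffel g \<mu> \<alpha> \<beta> u) = (g u *v (matrix_inv (g u) *v w)) $ l"
    by (simp add: matrix_vector_mult_def[of "g u"] chr)
  also have "\<dots> = w $ l"
    using matrix_inv_right[OF inv] by (simp add: matrix_vector_mul_assoc g_def)
  finally show ?thesis by (simp add: g_def w_def)
qed

lemma differentiable_det:
  fixes M :: "'b::real_normed_vector \<Rightarrow> real^'n::finite^'n"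
  assumes "\<And>i j. (\<lambda>u. M u $ i $ j) differentiable (at u)"
  shows "(\<lambda>u. det (M u)) differentiable (at u)"
  unfolding det_def
  by (intro differentiable_sum ballI differentiable_mult differentiable_const differentiable_prod assms)
    (simp add: finite_permutations)

text \<open>As many quadrics as the codimension, with mutually orthogonal normals of constant
  non-zero square. Charts of \<open>M\<close> are instances with the set \<open>A\<close>, patches
  of the hypersurface with one quadric added, so a single Gauss equation yields both
  curvatures.\<close>

locale quadric_immersion =
  fixes T :: "'k::finite set" and U :: "(real^'n::finite) set" and x :: "real^'n \<Rightarrow> real^'k"
    and A :: "(real \<times> (real^'k) \<times> real) set" and e :: "real \<times> (real^'k) \<times> real \<Rightarrow> real"
  assumes U: "open U" and x: "smooth_on U x"
    and inj_x: "\<And>u. u \<in> U \<Longrightarrow> inj (frechet_derivative x (at u))"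
    and finite_A: "finite A" and card_A: "CARD('n) + card A = CARD('k)"
    and quad_x: "\<And>u a. u \<in> U \<Longrightarrow> a \<in> A \<Longrightarrow> quad T a (x u) = 0"
    and nrm_x: "\<And>u a b. u \<in> U \<Longrightarrow> a \<in> A \<Longrightarrow> b \<in> A \<Longrightarrow>
      eta T (nrm a (x u)) (nrm b (x u)) = (if a = b then e a else 0)"
    and e_nz: "\<And>a. a \<in> A \<Longrightarrow> e a \<noteq> 0"

lemma has_derivative_quad:
  assumes "x differentiable (at u)"
  shows "((\<lambda>u. quad T a (x u)) has_derivative
      (\<lambda>h. 2 * eta T (nrm a (x u)) (frechet_derivative x (at u) h))) (at u)"
proof -
  have x: "(x has_derivative frechet_derivative x (at u)) (at u)"
    using assms frechet_derivative_works by blast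
  show ?thesis
    unfolding quad_def
    by (auto intro!: derivative_eq_intros eta.FDERIV x simp: eta_commute[of T _ "x u"] nrm_def
       eta.add_left eta.scaleR_left eta.zero_left algebra_simps)
qed

lemma quad_tangent:
  assumes U: "open U" "u \<in> U" and x: "x differentiable (at u)" 
    and quad_x: "\<And>u. u \<in> U \<Longrightarrow> quad T a (x u) = c"
  shows "eta T (nrm a (x u)) (frechet_derivative x (at u) h) = 0"
proof -
  have "((\<lambda>u. c) has_derivative (\<lambda>h. 2 * eta T (nrm a (x u)) (frechet_derivative x (at u) h))) (at u)"
    by (rule has_derivative_transform_within_open[OF has_derivative_quad[OF x] U]) (simp add: quad_x)
  from has_derivative_unique[OF this has_derivative_const]
  have "2 * eta T (nrm a (x u)) (frechet_derivative x (at u) h) = 0" by meson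
  then show ?thesis by simp
qed

lemma eta_frechet_zero:
  assumes "x differentiable (at u)" "\<And>i. eta T (pd i x u) w = 0"
  shows "eta T (frechet_derivative x (at u) h) w = 0"
  unfolding frechet_derivative_pd[OF assms(1)] by (simp add: eta.sum_left eta.scaleR_left assms(2))

context quadric_immersion
begin

abbreviation "g \<equiv> induced_metric T x"
abbreviation "\<Gamma> \<equiv> christoffel g"

lemma diff_x: "u \<in> U \<Longrightarrow> x differentiable (at u)"
  using smooth_on_differentiable x by blast

lemma frame: 
  assumes u: "u \<in> U"
  shows "frame T (frechet_derivative x (at u)) A (\<lambda>a. nrm a (x u)) e"
proof (rule frame.intro)
  show "linear (frechet_derivative x (at u))"
    using diff_x[OF u] linear_frechet_derivative by blast
  show "eta T (nrm a (x u)) (frechet_derivative x (at u) h) = 0" if "a \<in> A" for a h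
    using quad_tangent[OF U u diff_x[OF u]] quad_x that by blast
qed (use u inj_x finite_A card_A nrm_x e_nz in auto)

lemma g_invertible: 
  assumes "u \<in> U" shows "invertible (g u)"
proof -
  interpret frame T "frechet_derivative x (at u)" A "\<lambda>a. nrm a (x u)" e using frame[OF assms] .
  show ?thesis using gram_invertible by (simp add: induced_metric_def pd_def)
qed

lemma christoffel_g:
  assumes "u \<in> U"
  shows "(\<Sum>\<mu>\<in>UNIV. g u $ i $ \<mu> * \<Gamma> \<mu> j k u) = eta T (pd i x u) (pd j (pd k x) u)"
  using christoffel_lower[OF U assms x g_invertible[OF assms]] .

text \<open>Cramer's rule applied to \<open>christoffel_g\<close> exhibits the symbols as quotients
  of determinants with differentiable entries, which avoids differentiating
  \<open>matrix_inv\<close>.\<close>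

lemma christoffel_differentiable:
  assumes u: "u \<in> U"
  shows "\<Gamma> \<mu> j k differentiable (at u)"
proof -
  have dpd: "pd i x differentiable (at u)" "pd j (pd i x) differentiable (at u)" for i j
    using x u by (intro smooth_on_differentiable[of U] smooth_on_pd; simp)+
  have dg: "(\<lambda>u. g u $ i $ j) differentiable (at u)" for i j
    unfolding induced_metric_def using differentiable_bilinear[OF eta.bounded_bilinear_axioms dpd(1) dpd(1)] by simp
  have db: "(\<lambda>u. eta T (pd i x u) (pd j (pd k x) u)) differentiable (at u)" for i j k
    by (rule differentiable_bilinear[OF eta.bounded_bilinear_axioms dpd])
  define R where "R u = det (\<chi> i l. if l = \<mu> then (\<chi> i. eta T (pd i x u) (pd j (pd k x) u)) $ i else g u $ i $ l) / det (g u)" for u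
  have det_nz: "det (g u) \<noteq> 0" if "u \<in> U" for u
    using g_invertible[OF that] by (simp add: invertible_det_nz)
  have eq: "\<Gamma> \<mu> j k u = R u" if "u \<in> U" for u
  proof -
    have "g u *v (\<chi> \<mu>. \<Gamma> \<mu> j k u) = (\<chi> i. eta T (pd i x u) (pd j (pd k x) u))"
      by (simp add: matrix_vector_mult_def christoffel_g[OF that])
    then show ?thesis
      unfolding cramer[OF det_nz[OF that]] R_def by (metis (no_types, lifting) vec_lambda_beta)
  qed
  have "R differentiable (at u)"
    unfolding R_def
  proof (rule differentiable_divide)
    show "(\<lambda>u. det (\<chi> i l. if l = \<mu> then (\<chi> i. eta T (pd i x u) (pd j (pd k x) u)) $ i else g u $ i $ l)) differentiable (at u)"
      by (rule differentiable_det, rename_tac i l, case_tac "l = \<mu>") (use dg db in auto)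
    show "(\<lambda>u. det (g u)) differentiable (at u)"
      by (rule differentiable_det) (rule dg)
  qed (use det_nz u in auto)
  then show ?thesis using pd_transform(2)[OF U u, of "\<Gamma> \<mu> j k" R, OF eq] by blast
qed

lemma nrm_differentiable: "u \<in> U \<Longrightarrow> (\<lambda>u. nrm a (x u)) differentiable (at u)"
  unfolding nrm_def by (intro differentiable_add differentiable_const differentiable_linear[OF bounded_linear_scaleR_right] diff_x)

lemma pd_nrm: 
  assumes "u \<in> U" shows "pd i (\<lambda>u. nrm a (x u)) u = fst a *\<^sub>R pd i x u"
proof -
  have "(\<lambda>u. fst a *\<^sub>R x u) differentiable (at u)"
    by (intro differentiable_linear[OF bounded_linear_scaleR_right] diff_x assms)
  then show ?thesis
    unfolding nrm_def by (simp add: pd_add pd_bounded_linear[OF bounded_linear_scaleR_right diff_x[OF assms]])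
qed

text \<open>Obtained by differentiating the orthogonality of \<open>nrm a\<close> and
  \<open>pd j x\<close>. It says that the second fundamental form in each normal direction is a
  constant multiple of the metric.\<close>

lemma nrm_second:
  assumes u: "u \<in> U" and a: "a \<in> A"
  shows "eta T (nrm a (x u)) (pd i (pd j x) u) = - fst a * g u $ i $ j"
proof -
  have dpd: "pd j x differentiable (at u)"
    using x u by (intro smooth_on_differentiable[of U] smooth_on_pd)
  have "pd i (\<lambda>u. eta T (nrm a (x u)) (pd j x u)) u = pd i (\<lambda>u. 0) u"
  proof (rule pd_transform(1)[OF U u])
    fix q assume "q \<in> U"
    then show "eta T (nrm a (x q)) (pd j x q) = 0"
      using quad_tangent[OF U _ diff_x] quad_x a by (simp add: pd_def)
  qed
  then show ?thesis
    unfolding pd_bilinear[OF eta.bounded_bilinear_axioms nrm_differentiable[OF u] dpd] pd_nrm[OF u]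
    by (simp add: eta.scaleR_left induced_metric_def)
qed

text \<open>Subtracting the Levi-Civita part leaves a vector orthogonal to all tangents, which is
  then expanded in the normals with the coefficients from \<open>nrm_second\<close>.\<close>

lemma gauss_formula:
  assumes u: "u \<in> U"
  shows "pd i (pd j x) u = (\<Sum>\<mu>\<in>UNIV. \<Gamma> \<mu> i j u *\<^sub>R pd \<mu> x u)
     - (\<Sum>a\<in>A. (fst a / e a) *\<^sub>R (g u $ i $ j *\<^sub>R nrm a (x u)))"
proof -
  interpret frame T "frechet_derivative x (at u)" A "\<lambda>a. nrm a (x u)" e using frame[OF u] .
  define w where "w = pd i (pd j x) u - (\<Sum>\<mu>\<in>UNIV. \<Gamma> \<mu> i j u *\<^sub>R pd \<mu> x u)"
  have "eta T (pd l x u) w = 0" for l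
    using christoffel_g[OF u, of l i j]
    by (simp add: w_def eta.diff_right eta.sum_right eta.scaleR_right induced_metric_def mult.commute)
  then have w: "w = (\<Sum>a\<in>A. (eta T (nrm a (x u)) w / e a) *\<^sub>R nrm a (x u))"
    by (intro normal_expansion eta_frechet_zero diff_x u)
  have "eta T (nrm a (x u)) w = - fst a * g u $ i $ j" if "a \<in> A" for a
    using nrm_second[OF u that] v_D[OF that]
    by (simp add: w_def eta.diff_right eta.sum_right eta.scaleR_right pd_def)
  then have "w = (\<Sum>a\<in>A. - ((fst a / e a) *\<^sub>R (g u $ i $ j *\<^sub>R nrm a (x u))))"
    by (subst w) (rule sum.cong, simp_all)
  then show ?thesis by (simp add: w_def sum_negf algebra_simps)
qed

text \<open>Differentiate the Gauss formula and pair with a tangent vector: the terms with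
  derivatives of the metric are multiples of normals and drop out. The square of
  \<open>fst a\<close> has one factor from the second fundamental form and one from differentiating
  \<open>nrm a\<close>.\<close>

lemma eta_third:
  assumes u: "u \<in> U"
  shows "eta T (pd l x u) (pd k (pd i (pd j x)) u) =
    (\<Sum>\<mu>\<in>UNIV. g u $ l $ \<mu> * (pd k (\<Gamma> \<mu> i j) u + (\<Sum>\<rho>\<in>UNIV. \<Gamma> \<mu> k \<rho> u * \<Gamma> \<rho> i j u)))
     - (\<Sum>a\<in>A. (fst a)\<^sup>2 / e a) * (g u $ i $ j * g u $ l $ k)"
proof -
  interpret frame T "frechet_derivative x (at u)" A "\<lambda>a. nrm a (x u)" e using frame[OF u] .
  have dpd: "pd i x differentiable (at u)" for i
    using x u by (intro smooth_on_differentiable[of U] smooth_on_pd)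
  have dg: "(\<lambda>u. g u $ i $ j) differentiable (at u)" for i j
    unfolding induced_metric_def using differentiable_bilinear[OF eta.bounded_bilinear_axioms dpd dpd] by simp
  note d1 = differentiable_bilinear[OF bounded_bilinear_scaleR christoffel_differentiable[OF u] dpd]
  note d2 = differentiable_bilinear[OF bounded_bilinear_scaleR dg nrm_differentiable[OF u]]
  note d3 = differentiable_linear[OF bounded_linear_scaleR_right d2]
  have "pd k (pd i (pd j x)) u = pd k (\<lambda>u. (\<Sum>\<mu>\<in>UNIV. \<Gamma> \<mu> i j u *\<^sub>R pd \<mu> x u)
     - (\<Sum>a\<in>A. (fst a / e a) *\<^sub>R (g u $ i $ j *\<^sub>R nrm a (x u)))) u"
    by (rule pd_transform(1)[OF U u gauss_formula])
  also have "\<dots> = pd k (\<lambda>u. \<Sum>\<mu>\<in>UNIV. \<Gamma> \<mu> i j u *\<^sub>R pd \<mu> x u) u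
     - pd k (\<lambda>u. \<Sum>a\<in>A. (fst a / e a) *\<^sub>R (g u $ i $ j *\<^sub>R nrm a (x u))) u"
    by (rule pd_diff) (intro differentiable_sum ballI finite_A finite d1 d3)+
  also have "pd k (\<lambda>u. \<Sum>\<mu>\<in>UNIV. \<Gamma> \<mu> i j u *\<^sub>R pd \<mu> x u) u =
      (\<Sum>\<mu>\<in>UNIV. pd k (\<Gamma> \<mu> i j) u *\<^sub>R pd \<mu> x u + \<Gamma> \<mu> i j u *\<^sub>R pd k (pd \<mu> x) u)"
    by (simp add: pd_sum[OF d1] pd_scaleR[OF christoffel_differentiable[OF u] dpd])
  also have "pd k (\<lambda>u. \<Sum>a\<in>A. (fst a / e a) *\<^sub>R (g u $ i $ j *\<^sub>R nrm a (x u))) u =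
      (\<Sum>a\<in>A. (fst a / e a) *\<^sub>R (pd k (\<lambda>u. g u $ i $ j) u *\<^sub>R nrm a (x u) + g u $ i $ j *\<^sub>R fst a *\<^sub>R pd k x u))"
    unfolding pd_sum[OF d3] pd_bounded_linear[OF bounded_linear_scaleR_right d2]
          pd_scaleR[OF dg nrm_differentiable[OF u]] pd_nrm[OF u] by (simp add: add.commute)
  finally have third: "pd k (pd i (pd j x)) u =
    (\<Sum>\<mu>\<in>UNIV. pd k (\<Gamma> \<mu> i j) u *\<^sub>R pd \<mu> x u + \<Gamma> \<mu> i j u *\<^sub>R pd k (pd \<mu> x) u) -
    (\<Sum>a\<in>A. (fst a / e a) *\<^sub>R (pd k (\<lambda>u. g u $ i $ j) u *\<^sub>R nrm a (x u) + g u $ i $ j *\<^sub>R fst a *\<^sub>R pd k x u))" .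
  have n0: "eta T (pd l x u) (nrm a (x u)) = 0" if "a \<in> A" for a
    using v_D[OF that] by (simp add: pd_def eta_commute[of T _ "nrm a (x u)"])
  have "eta T (pd l x u) (\<Sum>a\<in>A. (fst a / e a) *\<^sub>R (pd k (\<lambda>u. g u $ i $ j) u *\<^sub>R nrm a (x u) + g u $ i $ j *\<^sub>R fst a *\<^sub>R pd k x u))
    = (\<Sum>a\<in>A. (fst a)\<^sup>2 / e a * (g u $ i $ j * g u $ l $ k))"
    unfolding eta.sum_right
    by (rule sum.cong) (simp_all add: n0 eta.scaleR_right eta.add_right induced_metric_def power2_eq_square)
  moreover have "eta T (pd l x u) (\<Sum>\<mu>\<in>UNIV. pd k (\<Gamma> \<mu> i j) u *\<^sub>R pd \<mu> x u + \<Gamma> \<mu> i j u *\<^sub>R pd k (pd \<mu> x) u)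
    = (\<Sum>\<mu>\<in>UNIV. pd k (\<Gamma> \<mu> i j) u * g u $ l $ \<mu>) + (\<Sum>\<rho>\<in>UNIV. \<Gamma> \<rho> i j u * (\<Sum>\<mu>\<in>UNIV. g u $ l $ \<mu> * \<Gamma> \<mu> k \<rho> u))"
    unfolding christoffel_g[OF u] eta.sum_right
    by (simp add: eta.scaleR_right eta.add_right induced_metric_def sum.distrib)
  moreover have "(\<Sum>\<rho>\<in>UNIV. \<Gamma> \<rho> i j u * (\<Sum>\<mu>\<in>UNIV. g u $ l $ \<mu> * \<Gamma> \<mu> k \<rho> u)) =
    (\<Sum>\<mu>\<in>UNIV. g u $ l $ \<mu> * (\<Sum>\<rho>\<in>UNIV. \<Gamma> \<mu> k \<rho> u * \<Gamma> \<rho> i j u))"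
    unfolding sum_distrib_left by (subst sum.swap) (simp add: mult_ac)
  ultimately show ?thesis
    unfolding third eta.diff_right by (simp add: distrib_left sum.distrib sum_distrib_right mult.commute)
qed

text \<open>Antisymmetrising \<open>eta_third\<close> in the first two derivatives makes its left
  side vanish, since third derivatives commute. On the right remain the Riemann tensor and the
  quadric terms.\<close>

lemma riemann_eq:
  assumes u: "u \<in> U"
  shows "riemann g \<mu> \<nu> \<alpha> \<beta> u =
    (\<Sum>a\<in>A. (fst a)\<^sup>2 / e a) * (g u $ \<mu> $ \<alpha> * g u $ \<nu> $ \<beta> - g u $ \<mu> $ \<beta> * g u $ \<nu> $ \<alpha>)"
proof -
  have sym: "g u $ i $ j = g u $ j $ i" for i j
    by (simp add: induced_metric_def eta_commute)
  have "pd \<alpha> (pd \<beta> (pd \<nu> x)) u = pd \<beta> (pd \<alpha> (pd \<nu> x)) u"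
    by (rule smooth_on_pd_commute[OF U smooth_on_pd[OF x] u])
  then have "eta T (pd \<mu> x u) (pd \<alpha> (pd \<beta> (pd \<nu> x)) u) = eta T (pd \<mu> x u) (pd \<beta> (pd \<alpha> (pd \<nu> x)) u)"
    by simp
  then show ?thesis
    unfolding eta_third[OF u] riemann_def riemann_up_def christoffel_commute[of T x _ \<nu>] 
    by (simp add: sum_subtractf sum.distrib right_diff_distrib distrib_left sym[of \<nu>] algebra_simps)
qed

end

section \<open>Umbilical hypersurfaces of space forms\<close>

lemma local_paramD:
  assumes "local_param S U x"
  shows "open U" "smooth_on U x" "\<And>u. u \<in> U \<Longrightarrow> inj (frechet_derivative x (at u))"
    "openin (top_of_set S) (x ` U)" "\<exists>y. homeomorphism U (x ` U) x y"
    "x ` U \<subseteq> S" "inj_on x U" "continuous_on U x" "\<And>u. u \<in> U \<Longrightarrow> x differentiable (at u)"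
proof -
  show *: "open U" "smooth_on U x" "\<And>u. u \<in> U \<Longrightarrow> inj (frechet_derivative x (at u))"
    "openin (top_of_set S) (x ` U)" "\<exists>y. homeomorphism U (x ` U) x y"
    using assms unfolding local_param_def by blast+
  show "x ` U \<subseteq> S" using *(4) openin_imp_subset by blast
  obtain y where "homeomorphism U (x ` U) x y" using *(5) by blast
  then show "inj_on x U"
    by (intro inj_on_inverseI[of U y x]) (simp add: homeomorphism_def)
  show "continuous_on U x" using *(2) smooth_on_continuous by blast
  show "\<And>u. u \<in> U \<Longrightarrow> x differentiable (at u)" using *(2) smooth_on_differentiable by blast
qed

lemma local_param_openin_image:
  assumes "local_param S U x" "open V" "V \<subseteq> U"
  shows "openin (top_of_set S) (x ` V)"
proof -
  obtain y where "homeomorphism U (x ` U) x y" using local_paramD(5)[OF assms(1)] by blast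
  moreover have "openin (top_of_set U) V" using assms by (auto simp: openin_open)
  ultimately have "openin (top_of_set (x ` U)) (x ` V)"
    using homeomorphism_imp_open_map by blast
  then show ?thesis using local_paramD(4)[OF assms(1)] openin_trans by blast
qed

lemma local_param_subset:
  assumes "local_param S U x" "open V" "V \<subseteq> U"
  shows "local_param S V x"
proof -
  obtain y where "homeomorphism U (x ` U) x y" using local_paramD(5)[OF assms(1)] by blast
  then have "homeomorphism V (x ` V) x y"
    using assms(3) homeomorphism_of_subsets[of U "x ` U" x y V "x ` V"] by blast
  then show ?thesis
    using local_param_openin_image[OF assms] assms local_paramD[OF assms(1)] smooth_on_subset
    unfolding local_param_def by blast
qed

lemma mform_induced_metric:
  assumes "Y differentiable (at p)"
  shows "mform (induced_metric T Y p) v w = eta T (frechet_derivative Y (at p) v) (frechet_derivative Y (at p) w)"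
  unfolding frechet_derivative_pd[OF assms]
  by (simp add: mform_def induced_metric_def inner_vec_def matrix_vector_mult_def eta.sum_left eta.sum_right
      eta.scaleR_left eta.scaleR_right sum_distrib_left mult_ac)
    (rule sum.swap)

text \<open>Needed to read off \<kappa>: the constant curvature equation determines its factor only
  where some 2 by 2 minor of the metric is non-zero.\<close>

lemma exists_minor_nonzero:
  fixes G :: "real^'m::finite^'m"
  assumes "invertible G" "CARD('m) \<ge> 2"
  shows "\<exists>\<mu> \<nu> \<alpha> \<beta>. G $ \<mu> $ \<alpha> * G $ \<nu> $ \<beta> \<noteq> G $ \<mu> $ \<beta> * G $ \<nu> $ \<alpha>"
proof (rule ccontr)
  assume "\<not> ?thesis"
  then have z: "G $ \<mu> $ \<alpha> * G $ \<nu> $ \<beta> = G $ \<mu> $ \<beta> * G $ \<nu> $ \<alpha>" for \<mu> \<nu> \<alpha> \<beta> by blast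
  obtain i j :: 'm where ij: "i \<noteq> j"
    using assms(2) card_le_Suc0_iff_eq[of "UNIV :: 'm set"] by auto
  have inj: "w = 0" if "G *v w = 0" for w
    using assms(1) that unfolding invertible_def
    by (metis matrix_vector_mul_assoc matrix_vector_mul_lid matrix_vector_mult_0_right)
  have G0: "G $ \<nu> $ j = 0" for \<nu>
  proof -
    \<comment> \<open>If all minors vanish, this combination of two basis vectors is in the kernel
      of \<open>G\<close>; invertibility then kills a whole column.\<close>
    define w :: "real^'m" where "w = G $ \<nu> $ j *\<^sub>R axis i 1 - G $ \<nu> $ i *\<^sub>R axis j 1"
    have "G *v w = 0"
      by (simp add: w_def matrix_vector_mult_diff_distrib matrix_vector_mult_scaleR matrix_vector_mult_basis
          vec_eq_iff column_def z[of _ i \<nu> j] mult.commute)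
    from inj[OF this] have "w $ i = 0" by simp
    then show ?thesis using ij by (simp add: w_def axis_def)
  qed
  have "G *v axis j 1 = 0"
    by (simp add: matrix_vector_mult_basis column_def vec_eq_iff G0)
  then have "axis j (1::real) = (0 :: real^'m)" by (rule inj)
  then show False by (simp add: axis_eq_0_iff)
qed

text \<open>The coordinate expression of the Levi-Civita connection is the tangential part of the flat
  derivative of the embedded vector field \<open>N\<close>.\<close>

lemma eta_cov_deriv:
  fixes Y :: "real^'m::finite \<Rightarrow> real^'k::finite" and z n :: "real^'n::finite \<Rightarrow> real^'m"
  defines "N \<equiv> \<lambda>u. \<Sum>\<beta>\<in>UNIV. n u $ \<beta> *\<^sub>R pd \<beta> Y (z u)"
  assumes V: "open V" "z u \<in> V" and Y: "smooth_on V Y" and inv: "invertible (induced_metric T Y (z u))"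
    and z: "z differentiable (at u)" and n: "n differentiable (at u)"
  shows "mform (induced_metric T Y (z u)) (cov_deriv T Y z n i u) w =
    eta T (pd i N u) (frechet_derivative Y (at (z u)) w)"
proof -
  define D where "D = frechet_derivative Y (at (z u))"
  have dY: "Y differentiable (at (z u))" and dpY: "pd \<beta> Y differentiable (at (z u))" for \<beta>
    using Y V smooth_on_differentiable smooth_on_pd by blast+
  note dn = differentiable_nth[OF n] and dpYz = differentiable_compose_at[OF dpY z]
  have pN: "pd i N u = (\<Sum>\<beta>\<in>UNIV. pd i n u $ \<beta> *\<^sub>R pd \<beta> Y (z u)) +
    (\<Sum>\<alpha>\<in>UNIV. \<Sum>\<beta>\<in>UNIV. (pd i z u $ \<alpha> * n u $ \<beta>) *\<^sub>R pd \<alpha> (pd \<beta> Y) (z u))"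
  proof -
    have "pd i N u = (\<Sum>\<beta>\<in>UNIV. pd i n u $ \<beta> *\<^sub>R pd \<beta> Y (z u) +
        n u $ \<beta> *\<^sub>R (\<Sum>\<alpha>\<in>UNIV. pd i z u $ \<alpha> *\<^sub>R pd \<alpha> (pd \<beta> Y) (z u)))"
      unfolding N_def pd_sum[OF differentiable_bilinear[OF bounded_bilinear_scaleR dn dpYz]]
        pd_scaleR[OF dn dpYz] pd_nth[OF n] pd_compose[OF dpY z] ..
    also have "\<dots> = (\<Sum>\<beta>\<in>UNIV. pd i n u $ \<beta> *\<^sub>R pd \<beta> Y (z u)) +
      (\<Sum>\<beta>\<in>UNIV. \<Sum>\<alpha>\<in>UNIV. (pd i z u $ \<alpha> * n u $ \<beta>) *\<^sub>R pd \<alpha> (pd \<beta> Y) (z u))"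
      by (simp add: sum.distrib scaleR_sum_right mult.commute)
    also have "(\<Sum>\<beta>\<in>UNIV. \<Sum>\<alpha>\<in>UNIV. (pd i z u $ \<alpha> * n u $ \<beta>) *\<^sub>R pd \<alpha> (pd \<beta> Y) (z u)) =
      (\<Sum>\<alpha>\<in>UNIV. \<Sum>\<beta>\<in>UNIV. (pd i z u $ \<alpha> * n u $ \<beta>) *\<^sub>R pd \<alpha> (pd \<beta> Y) (z u))"
      by (rule sum.swap)
    finally show ?thesis .
  qed
  define c where "c = cov_deriv T Y z n i u"
  \<comment> \<open>\<open>D c\<close> and \<open>pd i N u\<close> are compared only through their
    pairings with tangent vectors of the ambient manifold, because \<open>pd i N u\<close> may also
    have a component normal to it.\<close>
  have "eta T (pd \<nu> Y (z u)) (D c) = eta T (pd \<nu> Y (z u)) (pd i N u)" for \<nu>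
  proof -
    define G where "G \<mu> = induced_metric T Y (z u) $ \<nu> $ \<mu>" for \<mu>
    have G: "eta T (pd \<nu> Y (z u)) (pd \<mu> Y (z u)) = G \<mu>" for \<mu>
      by (simp add: G_def induced_metric_def)
    have chr: "(\<Sum>\<mu>\<in>UNIV. G \<mu> * christoffel (induced_metric T Y) \<mu> \<alpha> \<beta> (z u)) =
      eta T (pd \<nu> Y (z u)) (pd \<alpha> (pd \<beta> Y) (z u))" for \<alpha> \<beta>
      unfolding G_def by (rule christoffel_lower[OF V Y inv])
    have "eta T (pd \<nu> Y (z u)) (D c) = (\<Sum>\<mu>\<in>UNIV. c $ \<mu> * G \<mu>)"
      by (simp add: D_def frechet_derivative_pd[OF dY] eta.sum_right eta.scaleR_right G)
    also have "\<dots> = (\<Sum>\<mu>\<in>UNIV. pd i n u $ \<mu> * G \<mu>) + (\<Sum>\<mu>\<in>UNIV. \<Sum>\<alpha>\<in>UNIV. \<Sum>\<beta>\<in>UNIV.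
      (pd i z u $ \<alpha> * n u $ \<beta>) * (G \<mu> * christoffel (induced_metric T Y) \<mu> \<alpha> \<beta> (z u)))"
      by (simp add: c_def cov_deriv_def distrib_left sum.distrib sum_distrib_left mult_ac)
    also have "(\<Sum>\<mu>\<in>UNIV. \<Sum>\<alpha>\<in>UNIV. \<Sum>\<beta>\<in>UNIV.
      (pd i z u $ \<alpha> * n u $ \<beta>) * (G \<mu> * christoffel (induced_metric T Y) \<mu> \<alpha> \<beta> (z u))) =
      (\<Sum>\<alpha>\<in>UNIV. \<Sum>\<beta>\<in>UNIV. \<Sum>\<mu>\<in>UNIV.
      (pd i z u $ \<alpha> * n u $ \<beta>) * (G \<mu> * christoffel (induced_metric T Y) \<mu> \<alpha> \<beta> (z u)))"
      by (subst sum.swap) (intro sum.cong refl sum.swap)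
    also have "\<dots> = (\<Sum>\<alpha>\<in>UNIV. \<Sum>\<beta>\<in>UNIV. (pd i z u $ \<alpha> * n u $ \<beta>) * eta T (pd \<nu> Y (z u)) (pd \<alpha> (pd \<beta> Y) (z u)))"
      by (simp only: sum_distrib_left[symmetric] chr)
    finally show ?thesis
      by (simp add: pN eta.add_right eta.sum_right eta.scaleR_right G)
  qed
  then have "eta T (pd \<nu> Y (z u)) (D c - pd i N u) = 0" for \<nu>
    by (simp add: eta.diff_right)
  then have "eta T (D w) (D c - pd i N u) = 0"
    unfolding D_def by (intro eta_frechet_zero dY)
  then show ?thesis
    unfolding mform_induced_metric[OF dY] c_def[symmetric] D_def[symmetric]
    using eta_commute[of T "D w"] by (simp add: eta.diff_right)
qed

text \<open>Two derivatives of the embedded field are all that \<open>pd_commute\<close> requires.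
  The explicit formula for the first derivative holds on all of \<open>U\<close>, so it may be
  differentiated again.\<close>

lemma embedded_normal_differentiable:
  fixes Y :: "real^'m::finite \<Rightarrow> real^'k::finite" and z n :: "real^'n::finite \<Rightarrow> real^'m"
  defines "N \<equiv> \<lambda>u. \<Sum>\<beta>\<in>UNIV. n u $ \<beta> *\<^sub>R pd \<beta> Y (z u)"
  assumes U: "open U" "u \<in> U" and z: "smooth_on U z" and n: "smooth_on U n" and zU: "z ` U \<subseteq> V" and Y: "smooth_on V Y"
  shows "N differentiable (at u)" "pd i N differentiable (at u)"
proof -
  have dz: "z differentiable (at u)" "(\<lambda>u. pd i z u $ k) differentiable (at u)"
    and dn: "n differentiable (at u)" "(\<lambda>u. n u $ k) differentiable (at u)" "(\<lambda>u. pd i n u $ k) differentiable (at u)"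
    and dYz: "(\<lambda>u. pd \<beta> Y (z u)) differentiable (at u)" "(\<lambda>u. pd \<alpha> (pd \<beta> Y) (z u)) differentiable (at u)"
    and dY: "pd \<beta> Y differentiable (at (z u))"
    if u: "u \<in> U" for u i k \<alpha> \<beta>
  proof -
    have zu: "z u \<in> V" using zU u by blast
    show d1: "z differentiable (at u)" "n differentiable (at u)" using smooth_on_differentiable u z n by blast+
    show "(\<lambda>u. n u $ k) differentiable (at u)" "(\<lambda>u. pd i n u $ k) differentiable (at u)" "(\<lambda>u. pd i z u $ k) differentiable (at u)"
      using smooth_on_differentiable smooth_on_pd u z n by (intro differentiable_nth; blast)+
    have d2: "pd \<beta> Y differentiable (at (z u))" "pd \<alpha> (pd \<beta> Y) differentiable (at (z u))" for \<alpha> \<beta>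
      using smooth_on_differentiable smooth_on_pd zu Y by blast+
    show "(\<lambda>u. pd \<beta> Y (z u)) differentiable (at u)" "(\<lambda>u. pd \<alpha> (pd \<beta> Y) (z u)) differentiable (at u)"
      using differentiable_compose_at d1 d2 by blast+
    show "pd \<beta> Y differentiable (at (z u))" using d2 by blast
  qed
  note B = differentiable_bilinear[OF bounded_bilinear_scaleR]
  show "N differentiable (at u)"
    unfolding N_def using dn dYz U(2) by (intro differentiable_sum ballI B) auto
  have pN: "pd i N u = (\<Sum>\<beta>\<in>UNIV. pd i n u $ \<beta> *\<^sub>R pd \<beta> Y (z u) +
        n u $ \<beta> *\<^sub>R (\<Sum>\<alpha>\<in>UNIV. pd i z u $ \<alpha> *\<^sub>R pd \<alpha> (pd \<beta> Y) (z u)))" if "u \<in> U" for u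
    unfolding N_def pd_sum[OF B[OF dn(2) dYz(1)], OF that that] pd_scaleR[OF dn(2)[OF that] dYz(1)[OF that]]
      pd_nth[OF dn(1)[OF that]] pd_compose[OF dY[OF that] dz(1)[OF that]] ..
  have "(\<lambda>u. \<Sum>\<beta>\<in>UNIV. pd i n u $ \<beta> *\<^sub>R pd \<beta> Y (z u) +
        n u $ \<beta> *\<^sub>R (\<Sum>\<alpha>\<in>UNIV. pd i z u $ \<alpha> *\<^sub>R pd \<alpha> (pd \<beta> Y) (z u))) differentiable (at u)"
    using dn dYz dz U(2) by (intro differentiable_sum differentiable_add ballI B) auto
  then show "pd i N differentiable (at u)"
    using pd_transform(2)[OF U, of "pd i N", OF pN] by blast
qed

text \<open>Equating the mixed derivatives of \<open>N\<close> leaves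
  \<open>pd j f u *\<^sub>R pd i X u = pd i f u *\<^sub>R pd j X u\<close>. For \<open>i\<close> and
  \<open>j\<close> distinct the two tangent vectors are independent, so both factors vanish; this is
  where dimension at least 2 is used. Then \<open>f\<close> and \<open>N - f X\<close> are constant
  on a ball.\<close>

lemma proportional_derivatives:
  fixes X N :: "real^'n::finite \<Rightarrow> real^'k::finite" and f :: "real^'n \<Rightarrow> real"
  assumes U: "open U" "u0 \<in> U" and X: "smooth_on U X"
    and inj: "\<And>u. u \<in> U \<Longrightarrow> inj (frechet_derivative X (at u))"
    and N: "\<And>u. u \<in> U \<Longrightarrow> N differentiable (at u)" "\<And>u i. u \<in> U \<Longrightarrow> pd i N differentiable (at u)"
    and eq: "\<And>u i. u \<in> U \<Longrightarrow> pd i N u = f u *\<^sub>R pd i X u"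
    and card: "CARD('n) \<ge> 2"
  shows "\<exists>B c C. open B \<and> convex B \<and> u0 \<in> B \<and> B \<subseteq> U \<and> (\<forall>u\<in>B. f u = c \<and> N u = c *\<^sub>R X u + C)"
proof -
  have dX: "X differentiable (at u)" "pd i X differentiable (at u)" if "u \<in> U" for u i
    using that X smooth_on_differentiable smooth_on_pd by blast+
  have lin: "linear (frechet_derivative X (at u))" if "u \<in> U" for u
    using dX[OF that] linear_frechet_derivative by blast
  have indep: "a = 0 \<and> b = 0" if u: "u \<in> U" and ij: "i \<noteq> j" and ab: "a *\<^sub>R pd i X u = b *\<^sub>R pd j X u" for u i j a b
  proof -
    have "frechet_derivative X (at u) (a *\<^sub>R axis i 1) = frechet_derivative X (at u) (b *\<^sub>R axis j 1)"
      using ab lin[OF u] by (simp add: pd_def linear_cmul)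
    then have "a *\<^sub>R axis i 1 = b *\<^sub>R (axis j 1 :: real^'n)"
      using inj[OF u] by (simp add: inj_eq)
    then have "(a *\<^sub>R axis i 1 :: real^'n) $ i = (b *\<^sub>R axis j 1 :: real^'n) $ i"
      "(a *\<^sub>R axis i 1 :: real^'n) $ j = (b *\<^sub>R axis j 1 :: real^'n) $ j" by simp_all
    then show ?thesis using ij by (simp add: axis_def)
  qed
  have ex: "\<exists>j::'n. j \<noteq> i" for i
    using card card_le_Suc0_iff_eq[of "UNIV :: 'n set"] by auto metis
  have pX: "pd i X u \<noteq> 0" if "u \<in> U" for u i
  proof
    assume *: "pd i X u = 0"
    obtain j where "j \<noteq> i" using ex by blast
    with indep[OF that, of i j 1 0] * show False by auto
  qed
  have df: "f differentiable (at u)" if u: "u \<in> U" for u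
  proof -
    define i :: 'n where "i = undefined"
    \<comment> \<open>The factor \<open>f\<close> is not assumed differentiable, so it is recovered
      as a quotient. The Euclidean product is used because \<open>eta\<close> could vanish on
      \<open>pd i X u\<close>.\<close>
    have "f u = (pd i N u \<bullet> pd i X u) / (pd i X u \<bullet> pd i X u)" if "u \<in> U" for u
      using pX[OF that] by (simp add: eq[OF that])
    moreover have "(\<lambda>u. (pd i N u \<bullet> pd i X u) / (pd i X u \<bullet> pd i X u)) differentiable (at u)"
      using pX[OF u] by (intro differentiable_divide differentiable_bilinear[OF bounded_bilinear_inner] N dX u) simp
    ultimately show ?thesis
      using pd_transform(2)[OF U(1) u, of f "\<lambda>u. (pd i N u \<bullet> pd i X u) / (pd i X u \<bullet> pd i X u)"] by blast
  qed
  have pf: "pd i f u = 0" if u: "u \<in> U" for i u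
  proof -
    have second: "pd j (pd i N) u = pd j f u *\<^sub>R pd i X u + f u *\<^sub>R pd j (pd i X) u" for i j
      using pd_transform(1)[OF U(1) u, of "pd i N" "\<lambda>u. f u *\<^sub>R pd i X u" j, OF eq]
        pd_scaleR[OF df[OF u] dX(2)[OF u]] by simp
    obtain j where j: "j \<noteq> i" using ex by blast
    have "pd j (pd i N) u = pd i (pd j N) u"
      by (rule pd_commute[OF U(1) u N(1) N(2)[OF u] N(2)[OF u]])
    moreover have "pd j (pd i X) u = pd i (pd j X) u"
      by (rule smooth_on_pd_commute[OF U(1) X u])
    ultimately have "pd j f u *\<^sub>R pd i X u = pd i f u *\<^sub>R pd j X u"
      by (simp add: second)
    with indep[OF u] j show ?thesis by metis
  qed
  obtain r where r: "r > 0" "ball u0 r \<subseteq> U" using U openE by blast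
  have const: "h u = h u0" if "\<And>u. u \<in> U \<Longrightarrow> h differentiable (at u)" "\<And>u i. u \<in> U \<Longrightarrow> pd i h u = 0" "u \<in> ball u0 r"
    for h :: "real^'n \<Rightarrow> 'b::real_normed_vector" and u
  proof (rule has_derivative_zero_unique[of "ball u0 r"])
    fix v assume "v \<in> ball u0 r"
    then have "v \<in> U" using r by blast
    then have "(h has_derivative (\<lambda>h. 0)) (at v)"
      using has_derivative_pd[OF that(1), of v] that(2) by simp
    then show "(h has_derivative (\<lambda>h. 0)) (at v within ball u0 r)"
      by (rule has_derivative_at_withinI)
  qed (use that r in auto)
  have fc: "f u = f u0" if "u \<in> ball u0 r" for u
    using const[of f u] df pf that by blast
  have Nc: "N u - f u0 *\<^sub>R X u = N u0 - f u0 *\<^sub>R X u0" if u: "u \<in> ball u0 r" for u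
  proof -
    obtain r' where r': "r' > 0" "ball u r' \<subseteq> ball u0 r" using u by (meson open_ball openE)
    have d: "(\<lambda>u. f u0 *\<^sub>R X u) differentiable (at v)" if "v \<in> U" for v
      by (rule differentiable_linear[OF bounded_linear_scaleR_right dX(1)[OF that]])
    have pz: "pd i (\<lambda>u. N u - f u0 *\<^sub>R X u) v = 0" if v: "v \<in> ball u0 r" for v i
    proof -
      have vU: "v \<in> U" using v r by blast
      show ?thesis
        by (simp add: pd_diff[OF N(1)[OF vU] d[OF vU]] pd_bounded_linear[OF bounded_linear_scaleR_right dX(1)[OF vU]]
            eq[OF vU] fc[OF v])
    qed
    show ?thesis
    proof (rule has_derivative_zero_unique[of "ball u0 r" "\<lambda>u. N u - f u0 *\<^sub>R X u"])
      fix v assume v: "v \<in> ball u0 r"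
      then have vU: "v \<in> U" using r by blast
      have "((\<lambda>u. N u - f u0 *\<^sub>R X u) has_derivative (\<lambda>h. 0)) (at v)"
        using has_derivative_pd[OF differentiable_diff[OF N(1)[OF vU] d[OF vU]]] pz[OF v] by simp
      then show "((\<lambda>u. N u - f u0 *\<^sub>R X u) has_derivative (\<lambda>h. 0)) (at v within ball u0 r)"
        by (rule has_derivative_at_withinI)
    qed (use u r in auto)
  qed
  have "\<forall>u\<in>ball u0 r. f u = f u0 \<and> N u = f u0 *\<^sub>R X u + (N u0 - f u0 *\<^sub>R X u0)"
  proof (intro ballI conjI)
    fix u assume u: "u \<in> ball u0 r"
    show "f u = f u0" by (rule fc[OF u])
    show "N u = f u0 *\<^sub>R X u + (N u0 - f u0 *\<^sub>R X u0)"
      unfolding Nc[OF u, symmetric] by simp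
  qed
  moreover have "open (ball u0 r)" "convex (ball u0 r)" "u0 \<in> ball u0 r" using r by auto
  ultimately show ?thesis using r(2) by blast
qed

text \<open>\<open>M\<close> is cut out by the quadrics in \<open>A\<close>, at most one of them in the models; homogeneity is
  the remaining property of the models that the proof uses.\<close>

locale space_form =
  fixes T :: "'k::finite set" and M :: "(real^'k) set" and A :: "(real \<times> (real^'k) \<times> real) set"
    and e :: "real \<times> (real^'k) \<times> real \<Rightarrow> real" and m_type :: "'m::finite itself"
  assumes finite_A: "finite A" and card_A: "CARD('m) + card A = CARD('k)"
    and quad_M: "\<And>y a. y \<in> M \<Longrightarrow> a \<in> A \<Longrightarrow> quad T a y = 0"
    and nrm_M: "\<And>y a b. y \<in> M \<Longrightarrow> a \<in> A \<Longrightarrow> b \<in> A \<Longrightarrow>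
      eta T (nrm a y) (nrm b y) = (if a = b then e a else 0)"
    and e_nz: "\<And>a. a \<in> A \<Longrightarrow> e a \<noteq> 0"
    and homogeneous: "\<And>L p q y. eta_isometry T L \<Longrightarrow> p \<in> M \<Longrightarrow> q \<in> M \<Longrightarrow>
      (\<And>a. a \<in> A \<Longrightarrow> L (nrm a p) = nrm a q) \<Longrightarrow> y \<in> M \<Longrightarrow> q + L (y - p) \<in> M"
begin

text \<open>The connected components of the sets \<open>cap a\<close> are the complete umbilical hypersurfaces with
  space-like normal; \<open>fst a\<close> is the factor \<open>\<sigma>\<close>.\<close>

definition cap :: "real \<times> (real^'k) \<times> real \<Rightarrow> (real^'k) set"
  where "cap a = {y \<in> M. quad T a y = 0 \<and> eta T (nrm a y) (nrm a y) = 1 \<and> (\<forall>b\<in>A. eta T (nrm b y) (nrm a y) = 0)}"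

section \<open>Caps and the umbilical equation in a chart\<close>

lemma chart_immersion:
  fixes Y :: "real^'m \<Rightarrow> real^'k"
  assumes "local_param M V Y"
  shows "quadric_immersion T V Y A e"
proof -
  note Y = local_paramD[OF assms]
  show ?thesis
    by (rule quadric_immersion.intro) (use Y finite_A card_A quad_M nrm_M e_nz in blast)+
qed

text \<open>For \<open>a\<close> in \<open>A\<close> the orthogonality clause of \<open>cap\<close>
  with \<open>b = a\<close> contradicts the normalisation to 1. Thus adjoining \<open>a\<close> to
  \<open>A\<close> really adds one quadric.\<close>

lemma cap_not_in: "y \<in> cap a \<Longrightarrow> a \<notin> A"
  by (auto simp: cap_def)

lemma cap_immersion:
  fixes x :: "real^'n::finite \<Rightarrow> real^'k"
  assumes x: "local_param S U x" and a: "x ` U \<subseteq> cap a" and U: "U \<noteq> {}" and card: "CARD('m) = CARD('n) + 1"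
  shows "quadric_immersion T U x (insert a A) (e(a := 1))"
proof -
  have nA: "a \<notin> A" using a U cap_not_in by blast
  have *: "x u \<in> M" "quad T a (x u) = 0" "eta T (nrm a (x u)) (nrm a (x u)) = 1"
    "\<And>b. b \<in> A \<Longrightarrow> eta T (nrm b (x u)) (nrm a (x u)) = 0" if "u \<in> U" for u
    using a that by (auto simp: cap_def)
  show ?thesis
  proof (rule quadric_immersion.intro)
    show "CARD('n) + card (insert a A) = CARD('k)" using nA finite_A card_A card by simp
    show "quad T b (x u) = 0" if "u \<in> U" "b \<in> insert a A" for u b
      using that *(2)[OF that(1)] quad_M[OF *(1)[OF that(1)], of b] by auto
    show "eta T (nrm b (x u)) (nrm d (x u)) = (if b = d then (e(a := 1)) b else 0)"
      if "u \<in> U" "b \<in> insert a A" "d \<in> insert a A" for u b d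
      using that(2,3) *(3)[OF that(1)] *(4)[OF that(1), of b] *(4)[OF that(1), of d]
        nrm_M[OF *(1)[OF that(1)], of b d] nA eta_commute[of T "nrm a (x u)" "nrm d (x u)"]
      by (cases "b = a"; cases "d = a") simp_all
    show "(e(a := 1)) b \<noteq> 0" if "b \<in> insert a A" for b using that e_nz[of b] by auto
  qed (use local_paramD[OF x] finite_A in auto)
qed

text \<open>On a common patch the two normals agree up to sign, the normal space within
  \<open>M\<close> being a line. If they agree at one point, the triples are equal; if they are
  opposite everywhere, the leading coefficient vanishes and the triples are negatives of each other,
  with the same cap.\<close>

lemma cap_unique:
  fixes x :: "real^'n::finite \<Rightarrow> real^'k"
  assumes lx: "local_param S U x" and a: "x ` U \<subseteq> cap a" and b: "x ` U \<subseteq> cap b"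
    and U': "U \<noteq> {}" and card: "CARD('m) = CARD('n) + 1" and ab: "fst a = fst b"
  shows "cap a = cap b"
proof -
  have in_a: "quad T a (x u) = 0" "eta T (nrm a (x u)) (nrm a (x u)) = 1"
      "\<And>d. d \<in> A \<Longrightarrow> eta T (nrm d (x u)) (nrm a (x u)) = 0"
    and in_b: "quad T b (x u) = 0" "eta T (nrm b (x u)) (nrm b (x u)) = 1"
      "\<And>d. d \<in> A \<Longrightarrow> eta T (nrm d (x u)) (nrm b (x u)) = 0" if "u \<in> U" for u
    using a b that by (auto simp: cap_def)
  interpret quadric_immersion T U x "insert b A" "e(b := 1)"
    using cap_immersion[OF lx b U' card] .
  have pm: "nrm a (x u) = nrm b (x u) \<or> nrm a (x u) = - nrm b (x u)" if u: "u \<in> U" for u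
  proof -
    interpret frame T "frechet_derivative x (at u)" "insert b A" "\<lambda>a. nrm a (x u)" "e(b := 1)"
      using frame[OF u] .
    define s where "s = eta T (nrm b (x u)) (nrm a (x u))"
    have "nrm a (x u) - s *\<^sub>R nrm b (x u) = 0"
    proof (rule frame_zero)
      show "eta T (frechet_derivative x (at u) h) (nrm a (x u) - s *\<^sub>R nrm b (x u)) = 0" for h
        using quad_tangent[OF local_paramD(1)[OF lx] u diff_x[OF u] in_a(1), of h]
          quad_tangent[OF local_paramD(1)[OF lx] u diff_x[OF u] in_b(1), of h]
        by (simp add: eta.diff_right eta.scaleR_right eta_commute[of T "frechet_derivative x (at u) h"])
      show "eta T (nrm d (x u)) (nrm a (x u) - s *\<^sub>R nrm b (x u)) = 0" if "d \<in> insert b A" for d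
        using that in_a(3)[OF u, of d] in_b(3)[OF u, of d] in_b(2)[OF u]
        by (auto simp: eta.diff_right eta.scaleR_right s_def)
    qed
    then have s: "nrm a (x u) = s *\<^sub>R nrm b (x u)" by simp
    then have "s * s = 1"
      using in_a(2)[OF u] in_b(2)[OF u] by (simp add: eta.scaleR_left eta.scaleR_right)
    then have "s = 1 \<or> s = -1" using square_eq_1_iff by blast
    then show ?thesis using s by auto
  qed
  show ?thesis
  proof (cases "\<exists>u\<in>U. nrm a (x u) = nrm b (x u)")
    case True
    then obtain u where u: "u \<in> U" "nrm a (x u) = nrm b (x u)" by blast
    then have C: "fst (snd a) = fst (snd b)" using ab by (simp add: nrm_def)
    then have "snd (snd a) = snd (snd b)"
      using in_a(1)[OF u(1)] in_b(1)[OF u(1)] ab by (simp add: quad_def)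
    then have "a = b" using ab C by (simp add: prod_eq_iff)
    then show ?thesis by simp
  next
    case False
    then have neg: "nrm a (x u) = - nrm b (x u)" if "u \<in> U" for u using pm that by blast
    obtain u0 where u0: "u0 \<in> U" using U' by blast
    have c0: "fst b = 0"
    proof (rule ccontr)
      assume c: "fst b \<noteq> 0"
      \<comment> \<open>The sum of the two normals is zero. With a non-zero leading coefficient this
        would make \<open>x\<close> constant, contrary to its being an immersion.\<close>
      have *: "(2 * fst b) *\<^sub>R x u = - (fst (snd a) + fst (snd b))" if "u \<in> U" for u
      proof -
        have "(2 * fst b) *\<^sub>R x u = fst b *\<^sub>R x u + fst b *\<^sub>R x u"
          by (simp add: scaleR_left_distrib[symmetric])
        then have "(2 * fst b) *\<^sub>R x u + (fst (snd a) + fst (snd b)) = nrm a (x u) + nrm b (x u)"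
          by (simp only: nrm_def ab add_ac)
        then show ?thesis
          using neg[OF that] by (simp only: eq_neg_iff_add_eq_0) simp
      qed
      have "x u = x u0" if "u \<in> U" for u
        using *[OF that] *[OF u0] c by (metis mult_eq_0_iff scaleR_cancel_left zero_neq_numeral)
      then have "pd i x u0 = 0" for i
        using pd_transform(1)[OF local_paramD(1)[OF lx] u0, of x "\<lambda>_. x u0" i] by simp
      then have "frechet_derivative x (at u0) h = 0" for h
        by (simp add: frechet_derivative_pd[OF diff_x[OF u0]])
      then have "(axis undefined 1 :: real^'n) = 0"
        using inj_x[OF u0] by (metis injD)
      then show False by (simp add: axis_eq_0_iff)
    qed
    have C: "fst (snd a) = - fst (snd b)" using neg[OF u0] c0 ab by (simp add: nrm_def)
    have "snd (snd a) = - snd (snd b)"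
      using in_a(1)[OF u0] in_b(1)[OF u0] c0 ab C by (simp add: quad_def eta.minus_left)
    then have "quad T a y = - quad T b y" "nrm a y = - nrm b y" for y
      using C c0 ab by (simp_all add: quad_def nrm_def eta.minus_left)
    then show ?thesis by (simp add: cap_def eta.minus_left eta.minus_right)
  qed
qed

text \<open>The coordinate normal is pushed forward to an ambient field \<open>N\<close>, and
  \<open>pd i N = \<sigma> pd i X\<close> is tested against a full frame: tangents by umbilicity,
  \<open>N\<close> by its constant length, the normals of \<open>M\<close> by differentiating
  orthogonality. Hypothesis \<open>pos\<close> rules out a normal of square -1.\<close>

lemma umbilic_chart:
  fixes Y :: "real^'m \<Rightarrow> real^'k" and z n :: "real^'n::finite \<Rightarrow> real^'m"
  assumes Y: "local_param M V Y" and z: "smooth_on U z" "z ` U \<subseteq> V" and X: "local_param S U (Y \<circ> z)"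
    and n: "unit_normal T Y U z n"
    and K: "\<And>u i j. u \<in> U \<Longrightarrow> extrinsic_curvature T Y z n i j u = \<sigma> (Y (z u)) * induced_metric T (Y \<circ> z) u $ i $ j"
    and pos: "\<And>u w. u \<in> U \<Longrightarrow> \<bar>eta T w w\<bar> = 1 \<Longrightarrow> (\<And>i. eta T (pd i (Y \<circ> z) u) w = 0) \<Longrightarrow>
      (\<And>a. a \<in> A \<Longrightarrow> eta T (nrm a (Y (z u))) w = 0) \<Longrightarrow> eta T w w = 1"
    and card: "CARD('n) \<ge> 2" "CARD('m) = CARD('n) + 1" and u0: "u0 \<in> U"
  shows "\<exists>B a. open B \<and> u0 \<in> B \<and> B \<subseteq> U \<and> (\<forall>u\<in>B. \<sigma> (Y (z u)) = fst a \<and> Y (z u) \<in> cap a)"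
proof -
  interpret Y: quadric_immersion T V Y A e using chart_immersion[OF Y] .
  define X where "X = Y \<circ> z"
  define N where "N u = (\<Sum>\<beta>\<in>UNIV. n u $ \<beta> *\<^sub>R pd \<beta> Y (z u))" for u
  note XD = local_paramD[OF \<open>local_param S U (Y \<circ> z)\<close>, folded X_def] and YD = local_paramD[OF Y]
  have U: "open U" using XD by blast
  have zV: "z u \<in> V" and dz: "z differentiable (at u)" and dn: "n differentiable (at u)" if "u \<in> U" for u
    using that z n smooth_on_differentiable unfolding unit_normal_def by blast+
  have NY: "N u = frechet_derivative Y (at (z u)) (n u)" if "u \<in> U" for u
    unfolding N_def frechet_derivative_pd[OF Y.diff_x[OF zV[OF that]]] ..
  have pX: "pd i X u = frechet_derivative Y (at (z u)) (pd i z u)" if "u \<in> U" for u i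
    using pd_compose[where f = Y and z = z and p = u, OF Y.diff_x[OF zV[OF that]] dz[OF that]]
    unfolding frechet_derivative_pd[OF Y.diff_x[OF zV[OF that]]] X_def by (simp add: o_def)
  have dN: "N differentiable (at u)" "pd i N differentiable (at u)" if "u \<in> U" for u i
    using embedded_normal_differentiable[OF U that z(1) _ z(2) YD(2)] n unfolding unit_normal_def N_def by blast+
  have NN1: "\<bar>eta T (N u) (N u)\<bar> = 1" and XN: "eta T (pd i X u) (N u) = 0" if "u \<in> U" for u i
    using n that unfolding unit_normal_def
    by (auto simp: NY pX mform_induced_metric[OF Y.diff_x[OF zV[OF that]]] eta_commute)
  have AY: "eta T (nrm a (X u)) (frechet_derivative Y (at (z u)) h) = 0" if "u \<in> U" "a \<in> A" for a u h
    using quad_tangent[OF YD(1) zV[OF that(1)] Y.diff_x[OF zV[OF that(1)]], of T a] Y.quad_x that(2)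
    by (simp add: X_def)
  have NN: "eta T (N u) (N u) = 1" if "u \<in> U" for u
    using pos[OF that NN1[OF that]] XN[OF that] AY[OF that] unfolding X_def NY[OF that] by auto
  have dN': "pd i N u = \<sigma> (X u) *\<^sub>R pd i X u" if u: "u \<in> U" for u i
  proof -
    \<comment> \<open>\<open>N\<close> is not yet known to be the \<open>nrm\<close> of any triple,
      so the frame is indexed by an option type with \<open>None\<close> standing for
      \<open>N\<close>.\<close>
    define v where "v b = (case b of None \<Rightarrow> N u | Some a \<Rightarrow> nrm a (X u))" for b
    define e' where "e' b = (case b of None \<Rightarrow> 1 | Some a \<Rightarrow> e a)" for b
    have XM: "X u \<in> M" using YD(6) zV[OF u] by (auto simp: X_def)
    have XDu: "X differentiable (at u)" using XD(9) u by blast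
    interpret fr: frame T "frechet_derivative X (at u)" "insert None (Some ` A)" v e'
    proof (rule frame.intro)
      show "linear (frechet_derivative X (at u))"
        using XDu linear_frechet_derivative by blast
      show "inj (frechet_derivative X (at u))" using XD(3) u by blast
      show "CARD('n) + card (insert None (Some ` A)) = CARD('k)"
        using card_A finite_A card by (simp add: card_image)
      show "eta T (v a) (v b) = (if a = b then e' a else 0)"
        if "a \<in> insert None (Some ` A)" "b \<in> insert None (Some ` A)" for a b
      proof -
        have n0: "eta T (nrm d (X u)) (N u) = 0" "eta T (N u) (nrm d (X u)) = 0" if "d \<in> A" for d
          using AY[OF u that] NY[OF u] eta_commute[of T "N u" "nrm d (X u)"] by simp_all
        show ?thesis
          using that by (cases a; cases b) (auto simp: v_def e'_def n0 nrm_M[OF XM] NN[OF u] split: if_splits)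
      qed
      show "e' a \<noteq> 0" if "a \<in> insert None (Some ` A)" for a
        using that by (cases a) (auto simp: e'_def e_nz)
      fix a h assume a: "a \<in> insert None (Some ` A)"
      have "eta T (pd i X u) (v a) = 0" for i
        using a XN[OF u, of i] AY[OF u] pX[OF u, of i]
        by (cases a) (auto simp: v_def eta_commute[of T "frechet_derivative Y (at (z u)) (pd i z u)"])
      then show "eta T (v a) (frechet_derivative X (at u) h) = 0"
        using eta_frechet_zero[OF XDu, of T "v a" h] by (simp add: eta_commute)
    qed (simp add: finite_A)
    have ext: "eta T (pd i N u) (pd j X u) = \<sigma> (X u) * eta T (pd i X u) (pd j X u)" for j
    proof -
      have "eta T (pd i N u) (pd j X u) = extrinsic_curvature T Y z n i j u"
        unfolding extrinsic_curvature_def N_def pX[OF u]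
        using eta_cov_deriv[OF YD(1) zV[OF u] YD(2) Y.g_invertible[OF zV[OF u]] dz[OF u] dn[OF u]] by simp
      then show ?thesis using K[OF u, of i j] by (simp add: X_def induced_metric_def)
    qed
    have N0: "eta T (N u) (pd i N u) = 0"
    proof -
      have "pd i (\<lambda>u. eta T (N u) (N u)) u = pd i (\<lambda>u. 1) u"
        by (rule pd_transform(1)[OF U u]) (simp add: NN)
      then show ?thesis
        unfolding pd_bilinear[OF eta.bounded_bilinear_axioms dN(1)[OF u] dN(1)[OF u]]
        by (simp add: eta_commute[of T "pd i N u"])
    qed
    \<comment> \<open>Differentiating \<open>nrm a\<close> gives a multiple of a tangent vector,
      which is orthogonal to \<open>N\<close>; so the other term of the product rule must vanish as
      well.\<close>
    have A0: "eta T (nrm a (X u)) (pd i N u) = 0" if a: "a \<in> A" for a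
    proof -
      have dsc: "(\<lambda>u. fst a *\<^sub>R X u) differentiable (at u)"
        by (rule differentiable_linear[OF bounded_linear_scaleR_right XDu])
      then have dnr: "(\<lambda>u. nrm a (X u)) differentiable (at u)"
        unfolding nrm_def by (intro differentiable_add differentiable_const)
      have "pd i (\<lambda>u. nrm a (X u)) u = fst a *\<^sub>R pd i X u"
        unfolding nrm_def by (simp add: pd_add dsc pd_bounded_linear[OF bounded_linear_scaleR_right XDu])
      moreover have "pd i (\<lambda>u. eta T (nrm a (X u)) (N u)) u = pd i (\<lambda>u. 0) u"
        by (rule pd_transform(1)[OF U u]) (simp add: NY AY a)
      ultimately show ?thesis
        unfolding pd_bilinear[OF eta.bounded_bilinear_axioms dnr dN(1)[OF u]]
        by (simp add: eta.scaleR_left XN[OF u])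
    qed
    have "pd i N u - \<sigma> (X u) *\<^sub>R pd i X u = 0"
    proof (rule fr.frame_zero)
      have "eta T (pd j X u) (pd i N u - \<sigma> (X u) *\<^sub>R pd i X u) = 0" for j
        using ext[of j] by (simp add: eta.diff_right eta.scaleR_right eta_commute[of T "pd j X u"])
      then show "eta T (frechet_derivative X (at u) h) (pd i N u - \<sigma> (X u) *\<^sub>R pd i X u) = 0" for h
        by (intro eta_frechet_zero XDu)
      show "eta T (v a) (pd i N u - \<sigma> (X u) *\<^sub>R pd i X u) = 0" if "a \<in> insert None (Some ` A)" for a
        using that fr.v_D[OF that, of "axis i 1"] N0 A0
        by (cases a) (auto simp: v_def eta.diff_right eta.scaleR_right pd_def[of i X])
    qed
    then show ?thesis by simp
  qed
  obtain B c C where B: "open B" "convex B" "u0 \<in> B" "B \<subseteq> U"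
    and NC: "\<And>u. u \<in> B \<Longrightarrow> \<sigma> (X u) = c \<and> N u = c *\<^sub>R X u + C"
    using proportional_derivatives[OF U u0 XD(2,3) dN, of "\<lambda>u. \<sigma> (X u)"] dN' card(1) by auto
  \<comment> \<open>\<open>c\<close> and \<open>C\<close> are the constants of integration, which
    make \<open>nrm a\<close> equal to \<open>N\<close> along the patch. The last entry puts
    \<open>X u0\<close> on the quadric; the whole patch follows because the gradient
    \<open>N\<close> is normal to it.\<close>
  define a where "a = (c, C, quad T (c, C, 0) (X u0))"
  have nrm_a: "nrm a (X u) = N u" if "u \<in> B" for u
    using NC[OF that] by (simp add: a_def nrm_def)
  have "quad T a (X u) = quad T a (X u0)" if u: "u \<in> B" for u
  proof (rule has_derivative_zero_unique[OF B(2) _ u B(3)])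
    fix v assume v: "v \<in> B"
    then have vU: "v \<in> U" using B by blast
    have "eta T (N v) (frechet_derivative X (at v) h) = 0" for h
      using eta_frechet_zero[OF XD(9)[OF vU], of T "N v" h] XN[OF vU] by (simp add: eta_commute)
    then have "((\<lambda>u. quad T a (X u)) has_derivative (\<lambda>h. 0)) (at v)"
      using has_derivative_quad[OF XD(9)[OF vU], of T a] nrm_a[OF v] by simp
    then show "((\<lambda>u. quad T a (X u)) has_derivative (\<lambda>h. 0)) (at v within B)"
      by (rule has_derivative_at_withinI)
  qed
  moreover have "quad T a (X u0) = 0" by (simp add: a_def quad_def)
  ultimately have q0: "quad T a (X u) = 0" if "u \<in> B" for u using that by simp
  have fa: "fst a = c" by (simp add: a_def)
  have "\<sigma> (X u) = fst a \<and> X u \<in> cap a" if u: "u \<in> B" for u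
  proof -
    have uU: "u \<in> U" using u B(4) by blast
    have "X u \<in> M" using YD(6) zV[OF uU] by (auto simp: X_def)
    moreover have "\<forall>b\<in>A. eta T (nrm b (X u)) (N u) = 0" using AY[OF uU] NY[OF uU] by simp
    ultimately show ?thesis
      using NC[OF u] q0[OF u] NN[OF uU] unfolding cap_def
      by (simp add: nrm_a[OF u] fa)
  qed
  then have "\<forall>u\<in>B. \<sigma> (Y (z u)) = fst a \<and> Y (z u) \<in> cap a" by (simp add: X_def)
  then show ?thesis using B by blast
qed

end

section \<open>Affine isometries\<close>

lemma affine_isometry_homeomorphism:
  assumes L: "eta_isometry T L"
  shows "\<exists>\<psi>. homeomorphism S ((\<lambda>y. b + L y) ` S) (\<lambda>y. b + L y) \<psi>"
proof -
  have lL: "linear L" using L by (auto simp: eta_isometry_def)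
  then have bL: "bounded_linear L" by (simp add: linear_conv_bounded_linear)
  have "inj L" using eta_isometry_bij[OF L] by (simp add: bij_def)
  then obtain L' where L': "linear L'" "L' \<circ> L = id" using linear_injective_left_inverse[OF lL] by blast
  have "homeomorphism S ((\<lambda>y. b + L y) ` S) (\<lambda>y. b + L y) (\<lambda>y. L' (y - b))"
  proof (rule homeomorphismI)
    show "continuous_on S (\<lambda>y. b + L y)"
      by (intro continuous_intros linear_continuous_on bL)
    show "continuous_on ((\<lambda>y. b + L y) ` S) (\<lambda>y. L' (y - b))"
      by (intro linear_continuous_on_compose[OF _ L'(1)] continuous_intros)
  qed (use L'(2) in \<open>auto simp: o_def fun_eq_iff\<close>)
  then show ?thesis by blast
qed

lemma affine_isometry_local_param:
  fixes b :: "real^'k::finite" and x :: "real^'m::finite \<Rightarrow> real^'k"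
  assumes L: "eta_isometry T L" and x: "local_param S U x"
  defines "\<phi> \<equiv> \<lambda>y. b + L y"
  shows "local_param (\<phi> ` S) U (\<phi> \<circ> x)" "\<And>u. u \<in> U \<Longrightarrow> induced_metric T (\<phi> \<circ> x) u = induced_metric T x u"
proof -
  note xD = local_paramD[OF x]
  have lL: "linear L" and pres: "\<And>x y. eta T (L x) (L y) = eta T x y" using L by (auto simp: eta_isometry_def)
  then have bL: "bounded_linear L" by (simp add: linear_conv_bounded_linear)
  have injL: "inj L" using eta_isometry_bij[OF L] by (simp add: bij_def)
  have comp: "\<phi> \<circ> x = (\<lambda>u. b + L (x u))" by (auto simp: \<phi>_def)
  have dLx: "(\<lambda>u. L (x u)) differentiable (at u)" if "u \<in> U" for u
    by (rule differentiable_linear[OF bL xD(9)[OF that]])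
  have pd: "pd i (\<phi> \<circ> x) u = L (pd i x u)" if "u \<in> U" for u i
    unfolding comp by (simp add: pd_add dLx[OF that] pd_bounded_linear[OF bL xD(9)[OF that]])
  then show "\<And>u. u \<in> U \<Longrightarrow> induced_metric T (\<phi> \<circ> x) u = induced_metric T x u"
    by (simp add: induced_metric_def pres)
  have smooth: "smooth_on U (\<phi> \<circ> x)"
    unfolding comp by (rule smooth_on_affine[OF xD(1) bL xD(2)])
  have "inj (frechet_derivative (\<phi> \<circ> x) (at u))" if u: "u \<in> U" for u
  proof -
    have "frechet_derivative (\<phi> \<circ> x) (at u) h = L (frechet_derivative x (at u) h)" for h
      using smooth_on_differentiable[OF smooth u] xD(9)[OF u] pd[OF u]
      by (simp add: frechet_derivative_pd linear_sum[OF lL] linear_cmul[OF lL])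
    then have "frechet_derivative (\<phi> \<circ> x) (at u) = L \<circ> frechet_derivative x (at u)" by auto
    then show ?thesis using injL xD(3)[OF u] by (simp add: inj_compose)
  qed
  moreover have "openin (top_of_set (\<phi> ` S)) ((\<phi> \<circ> x) ` U)"
  proof -
    obtain \<psi> where "homeomorphism S (\<phi> ` S) \<phi> \<psi>"
      using affine_isometry_homeomorphism[OF L] unfolding \<phi>_def by blast
    from homeomorphism_imp_open_map[OF this xD(4)] show ?thesis by (simp add: image_comp)
  qed
  moreover have "\<exists>y. homeomorphism U ((\<phi> \<circ> x) ` U) (\<phi> \<circ> x) y"
  proof -
    obtain y where y: "homeomorphism U (x ` U) x y" using xD(5) by blast
    obtain \<psi> where "homeomorphism (x ` U) (\<phi> ` x ` U) \<phi> \<psi>"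
      using affine_isometry_homeomorphism[OF L] unfolding \<phi>_def by blast
    from homeomorphism_compose[OF y this] show ?thesis by (auto simp: image_comp)
  qed
  ultimately show "local_param (\<phi> ` S) U (\<phi> \<circ> x)"
    unfolding local_param_def using smooth xD(1) by blast
qed

lemma affine_isometry_metric_isometry:
  assumes L: "eta_isometry T L" and S': "(\<lambda>y. b + L y) ` S = S'"
  shows "metric_isometry TYPE('m::finite) T S S' (\<lambda>y. b + L y)"
proof -
  have "inj L" using eta_isometry_bij[OF L] by (simp add: bij_def)
  then have "inj_on (\<lambda>y. b + L y) S" by (intro inj_onI) (simp add: inj_eq)
  then have "bij_betw (\<lambda>y. b + L y) S S'" using S' by (simp add: bij_betw_def)
  then show ?thesis
    unfolding metric_isometry_def
    using affine_isometry_local_param[OF L, where b = b and S = S, unfolded S'] by blast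
qed

section \<open>Hypersurfaces inside a cap\<close>

lemma umbilical_hypersurfaceD:
  assumes "umbilical_hypersurface TYPE('m::finite) TYPE('n::finite) T M S \<sigma>"
  shows "S \<noteq> {}" "connected S"
    "\<forall>p\<in>S. \<exists>(V :: (real^'m) set) Y (U :: (real^'n) set) z n.
      local_param M V Y \<and> smooth_on U z \<and> z ` U \<subseteq> V \<and>
      local_param S U (Y \<circ> z) \<and> p \<in> (Y \<circ> z) ` U \<and> unit_normal T Y U z n \<and>
      (\<forall>u\<in>U. \<forall>i j. extrinsic_curvature T Y z n i j u =
        \<sigma> (Y (z u)) * induced_metric T (Y \<circ> z) u $ i $ j)"
proof -
  note * = assms[unfolded umbilical_hypersurface_def]
  show "S \<noteq> {}" using * by (rule conjunct1)
  note ** = conjunct2[OF *]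
  show "connected S" using ** by (rule conjunct1)
  show "\<forall>p\<in>S. \<exists>(V :: (real^'m) set) Y (U :: (real^'n) set) z n.
      local_param M V Y \<and> smooth_on U z \<and> z ` U \<subseteq> V \<and>
      local_param S U (Y \<circ> z) \<and> p \<in> (Y \<circ> z) ` U \<and> unit_normal T Y U z n \<and>
      (\<forall>u\<in>U. \<forall>i j. extrinsic_curvature T Y z n i j u =
        \<sigma> (Y (z u)) * induced_metric T (Y \<circ> z) u $ i $ j)"
    using ** by (rule conjunct2)
qed

context space_form
begin

text \<open>The projection along the normal space at a point \<open>p\<close> is injective on the cap near \<open>p\<close>, so
  invariance of domain applies to its composition with a parametrisation.\<close>

lemma openin_cap:
  fixes S :: "(real^'k) set"
  assumes S: "S \<subseteq> cap a" and card: "CARD('m) = CARD('n::finite) + 1"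
    and param: "\<And>p. p \<in> S \<Longrightarrow> \<exists>(U :: (real^'n) set) x. local_param S U x \<and> p \<in> x ` U"
  shows "openin (top_of_set (cap a)) S"
proof (subst openin_subopen, rule ballI)
  fix p assume p: "p \<in> S"
  obtain U :: "(real^'n) set" and x where x: "local_param S U x" and pU: "p \<in> x ` U" using param[OF p] by blast
  then obtain u0 where u0: "u0 \<in> U" "x u0 = p" by blast
  note xD = local_paramD[OF x]
  interpret q: quadric_immersion T U x "insert a A" "e(a := 1)"
    using cap_immersion[OF x _ _ card, of a] S xD(6) u0 by blast
  interpret f: frame T "frechet_derivative x (at u0)" "insert a A" "\<lambda>a. nrm a (x u0)" "e(a := 1)"
    using q.frame[OF u0(1)] .
  \<comment> \<open>\<open>\<pi>\<close> records the pairings with the tangent vectors at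
    \<open>p\<close>: two points with the same image differ by a vector normal to \<open>S\<close>
    at \<open>p\<close>.\<close>
  define \<pi> where "\<pi> y = (\<chi> i. eta T (pd i x u0) y)" for y
  obtain K where K: "K > 0" "\<And>v w. norm (eta T v w) \<le> norm v * norm w * K"
    using eta.pos_bounded by blast
  \<comment> \<open>The constant of the estimate \<open>norm w \<le> K' * norm d * norm w\<close>
    proved below, with the continuity bound \<open>K\<close> of \<open>eta\<close> inserted.\<close>
  define K' where "K' = (\<Sum>b\<in>insert a A. \<bar>fst b\<bar> * K / \<bar>2 * (e(a := 1)) b\<bar> * norm (nrm b p))"
  have K'0: "K' \<ge> 0" unfolding K'_def using K by (intro sum_nonneg) auto
  \<comment> \<open>In a ball of this radius \<open>norm d\<close> is at most \<open>2 * r\<close>,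
    so the factor in front of \<open>norm w\<close> is below 1. Adding 1 covers the case
    \<open>K' = 0\<close>.\<close>
  define r where "r = 1 / (2 * (K' + 1))"
  have r: "r > 0" "K' * (2 * r) < 1" using K'0 by (auto simp: r_def field_simps)
  have inj: "y = y'" if y: "y \<in> cap a" "y' \<in> cap a" "y \<in> ball p r" "y' \<in> ball p r" and eq: "\<pi> y = \<pi> y'" for y y'
  proof -
    \<comment> \<open>By \<open>quad_diff\<close> each normal coefficient of the chord
      \<open>w\<close> is proportional to \<open>eta T d w\<close>, hence of size
      \<open>norm d * norm w\<close>. A chord that is purely normal at \<open>p\<close> is thus
      shorter than itself unless it is zero.\<close>
    define w d where "w = y' - y" and "d = (y - p) + (y' - p)"
    have "eta T (pd i x u0) w = 0" for i
      using eq by (simp add: \<pi>_def w_def eta.diff_right vec_eq_iff)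
    then have "w = (\<Sum>b\<in>insert a A. (eta T (nrm b (x u0)) w / (e(a := 1)) b) *\<^sub>R nrm b (x u0))"
      by (intro f.normal_expansion eta_frechet_zero xD(9) u0)
    then have w: "w = (\<Sum>b\<in>insert a A. (eta T (nrm b p) w / (e(a := 1)) b) *\<^sub>R nrm b p)"
      unfolding u0(2) .
    have s: "eta T (nrm b p) w = - (fst b * eta T d w) / 2" if b: "b \<in> insert a A" for b
    proof -
      have "quad T b y = 0" "quad T b y' = 0" using y b quad_M[of y b] quad_M[of y' b] by (auto simp: cap_def)
      then have "eta T (nrm b y + nrm b y') w = 0" using quad_diff[of T b y' y] by (simp add: w_def)
      moreover have "nrm b y + nrm b y' = 2 *\<^sub>R nrm b p + fst b *\<^sub>R d"
      proof -
        have "nrm b y = nrm b p + fst b *\<^sub>R (y - p)" "nrm b y' = nrm b p + fst b *\<^sub>R (y' - p)"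
          using nrm_add[of b p "y - p"] nrm_add[of b p "y' - p"] by simp_all
        then show ?thesis by (simp only: d_def scaleR_2 scaleR_right_distrib add_ac)
      qed
      ultimately show ?thesis by (simp only: eta.add_left eta.scaleR_left) simp
    qed
    have "norm w \<le> (\<Sum>b\<in>insert a A. norm ((eta T (nrm b p) w / (e(a := 1)) b) *\<^sub>R nrm b p))"
      by (subst w) (rule norm_sum)
    also have "\<dots> \<le> (\<Sum>b\<in>insert a A. \<bar>fst b\<bar> * K / \<bar>2 * (e(a := 1)) b\<bar> * norm (nrm b p) * (norm d * norm w))"
    proof (rule sum_mono)
      fix b assume b: "b \<in> insert a A"
      have "norm ((eta T (nrm b p) w / (e(a := 1)) b) *\<^sub>R nrm b p) =
          (\<bar>fst b\<bar> / \<bar>2 * (e(a := 1)) b\<bar> * norm (nrm b p)) * norm (eta T d w)"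
        unfolding s[OF b] by (simp add: abs_mult)
      also have "\<dots> \<le> (\<bar>fst b\<bar> / \<bar>2 * (e(a := 1)) b\<bar> * norm (nrm b p)) * (norm d * norm w * K)"
        using K by (intro mult_left_mono) auto
      finally show "norm ((eta T (nrm b p) w / (e(a := 1)) b) *\<^sub>R nrm b p) \<le>
        \<bar>fst b\<bar> * K / \<bar>2 * (e(a := 1)) b\<bar> * norm (nrm b p) * (norm d * norm w)"
        by (simp add: mult_ac)
    qed
    also have "\<dots> = K' * norm d * norm w" unfolding K'_def sum_distrib_right by (simp add: mult_ac)
    finally have le: "norm w \<le> K' * norm d * norm w" .
    have "norm d \<le> norm (y - p) + norm (y' - p)" unfolding d_def by (rule norm_triangle_ineq)
    also have "\<dots> \<le> 2 * r" using y by (simp add: dist_norm norm_minus_commute)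
    finally have "K' * norm d \<le> K' * (2 * r)" using K'0 by (rule mult_left_mono)
    then have "K' * norm d < 1" using r by linarith
    then have "w = 0"
      using le mult_strict_right_mono[of "K' * norm d" 1 "norm w"] by (cases "w = 0") auto
    then show "y = y'" by (simp add: w_def)
  qed
  define V where "V = {u \<in> U. x u \<in> ball p r}"
  have "open V"
    using continuous_open_preimage[OF xD(8,1) open_ball[of p r]] unfolding V_def by (simp add: vimage_def Int_def)
  have capV: "x u \<in> cap a" if "u \<in> V" for u using that S xD(6) by (auto simp: V_def)
  have "continuous_on UNIV (\<lambda>y. eta T (pd i x u0) y)" for i
    by (intro linear_continuous_on eta.bounded_linear_right)
  then have \<pi>c: "continuous_on UNIV \<pi>"
    unfolding \<pi>_def by (intro continuous_on_vec_lambda)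
  \<comment> \<open>\<open>V\<close> and the target of \<open>\<pi>\<close> lie in spaces of the
    same dimension, so continuity and injectivity suffice.\<close>
  have "open ((\<pi> \<circ> x) ` V)"
  proof (rule invariance_of_domain[OF _ \<open>open V\<close>])
    show "continuous_on V (\<pi> \<circ> x)"
      by (intro continuous_on_compose continuous_on_subset[OF xD(8)] continuous_on_subset[OF \<pi>c]) (auto simp: V_def)
    show "inj_on (\<pi> \<circ> x) V"
    proof (rule inj_onI)
      fix u u' assume u: "u \<in> V" "u' \<in> V" "(\<pi> \<circ> x) u = (\<pi> \<circ> x) u'"
      then have "x u = x u'" using inj[OF capV[OF u(1)] capV[OF u(2)]] by (simp add: V_def)
      then show "u = u'" using u inj_onD[OF xD(7)] by (simp add: V_def)
    qed
  qed
  then have "open (\<pi> -` ((\<pi> \<circ> x) ` V))"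
    using open_vimage[OF _ \<pi>c] by blast
  then have "open (ball p r \<inter> \<pi> -` ((\<pi> \<circ> x) ` V))" by (intro open_Int) auto
  moreover have "x ` V = cap a \<inter> (ball p r \<inter> \<pi> -` ((\<pi> \<circ> x) ` V))"
  proof (intro equalityI subsetI)
    fix y assume "y \<in> x ` V"
    then show "y \<in> cap a \<inter> (ball p r \<inter> \<pi> -` ((\<pi> \<circ> x) ` V))" using capV by (auto simp: V_def)
  next
    fix y assume y: "y \<in> cap a \<inter> (ball p r \<inter> \<pi> -` ((\<pi> \<circ> x) ` V))"
    then obtain u where u: "u \<in> V" "\<pi> y = \<pi> (x u)" by auto
    then have "y = x u" using inj[of y "x u"] y capV by (auto simp: V_def)
    then show "y \<in> x ` V" using u by blast
  qed
  ultimately have "openin (top_of_set (cap a)) (x ` V)"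
    by (metis openin_open_Int)
  moreover have "p \<in> x ` V" using u0 r by (auto simp: V_def)
  moreover have "x ` V \<subseteq> S" using xD(6) by (auto simp: V_def)
  ultimately show "\<exists>T. openin (top_of_set (cap a)) T \<and> p \<in> T \<and> T \<subseteq> S" by blast
qed

text \<open>Isolates what the signature has to provide, so that the remaining argument treats the
  Riemannian and the Lorentzian models together.\<close>

definition spacelike_normals :: "'n::finite itself \<Rightarrow> (real^'k) set \<Rightarrow> bool"
  where "spacelike_normals _ S \<longleftrightarrow> (\<forall>(U :: (real^'n) set) x u w. local_param S U x \<longrightarrow> u \<in> U \<longrightarrow> x ` U \<subseteq> M \<longrightarrow>
    \<bar>eta T w w\<bar> = 1 \<longrightarrow> (\<forall>i. eta T (pd i x u) w = 0) \<longrightarrow> (\<forall>a\<in>A. eta T (nrm a (x u)) w = 0) \<longrightarrow> eta T w w = 1)"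

text \<open>The pair of \<sigma> and the cap through a point is locally constant, hence constant on
  the connected \<open>S\<close>. The triples themselves, chosen pointwise, could jump by a
  sign.\<close>

lemma umbilical_in_cap:
  assumes card: "CARD('n::finite) \<ge> 2" "CARD('m) = CARD('n) + 1"
    and umb: "umbilical_hypersurface TYPE('m) TYPE('n) T M S \<sigma>"
    and pos: "spacelike_normals TYPE('n) S"
  shows "\<exists>a. (\<forall>p\<in>S. \<sigma> p = fst a) \<and> S \<subseteq> cap a \<and> openin (top_of_set (cap a)) S"
proof -
  have conn: "connected S" and ne: "S \<noteq> {}" using umbilical_hypersurfaceD[OF umb] by blast+
  have local: "\<exists>(U :: (real^'n) set) x a. local_param S U x \<and> p \<in> x ` U \<and> (\<forall>y\<in>x ` U. \<sigma> y = fst a \<and> y \<in> cap a)"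
    if p: "p \<in> S" for p
  proof -
    from bspec[OF umbilical_hypersurfaceD(3)[OF umb] p] obtain V :: "(real^'m) set" and Y and U :: "(real^'n) set" and z n where
      1: "local_param M V Y" "smooth_on U z" "z ` U \<subseteq> V" "local_param S U (Y \<circ> z)"
      "p \<in> (Y \<circ> z) ` U" "unit_normal T Y U z n" and
      2: "\<forall>u\<in>U. \<forall>i j. extrinsic_curvature T Y z n i j u = \<sigma> (Y (z u)) * induced_metric T (Y \<circ> z) u $ i $ j"
      by (elim exE conjE)
    obtain u0 where u0: "u0 \<in> U" "p = (Y \<circ> z) u0" using 1(5) by blast
    have "\<exists>B a. open B \<and> u0 \<in> B \<and> B \<subseteq> U \<and> (\<forall>u\<in>B. \<sigma> (Y (z u)) = fst a \<and> Y (z u) \<in> cap a)"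
    proof (intro umbilic_chart[OF 1(1,2,3,4,6) _ _ card u0(1)])
      fix u w assume "u \<in> U" "\<bar>eta T w w\<bar> = 1" "\<And>i. eta T (pd i (Y \<circ> z) u) w = 0"
        "\<And>a. a \<in> A \<Longrightarrow> eta T (nrm a (Y (z u))) w = 0"
      moreover have "(Y \<circ> z) ` U \<subseteq> M" using local_paramD(6)[OF 1(1)] 1(3) by (auto simp: image_subset_iff)
      ultimately show "eta T w w = 1"
        using pos[unfolded spacelike_normals_def, rule_format, OF 1(4), of u w] by simp
    qed (use 2 in blast)
    then obtain B a where B: "open B" "u0 \<in> B" "B \<subseteq> U" "\<forall>u\<in>B. \<sigma> (Y (z u)) = fst a \<and> Y (z u) \<in> cap a" by blast
    have "p \<in> (Y \<circ> z) ` B" using u0 B by blast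
    then show ?thesis
      using local_param_subset[OF 1(4) B(1,3)] B(4) by (intro exI[of _ B] exI[of _ "Y \<circ> z"] exI[of _ a]) auto
  qed
  then obtain a where "\<forall>p\<in>S. \<exists>(U :: (real^'n) set) x. local_param S U x \<and> p \<in> x ` U \<and> (\<forall>y\<in>x ` U. \<sigma> y = fst (a p) \<and> y \<in> cap (a p))"
    by metis
  then have a: "\<exists>(U :: (real^'n) set) x. local_param S U x \<and> p \<in> x ` U \<and> (\<forall>y\<in>x ` U. \<sigma> y = fst (a p) \<and> y \<in> cap (a p))"
    if "p \<in> S" for p using that by blast
  have "(\<lambda>p. (\<sigma> p, cap (a p))) constant_on S"
  proof (rule locally_constant_imp_constant[OF conn])
    fix p assume p: "p \<in> S"
    obtain U :: "(real^'n) set" and x where x: "local_param S U x" "p \<in> x ` U" "\<forall>y\<in>x ` U. \<sigma> y = fst (a p) \<and> y \<in> cap (a p)"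
      using a[OF p] by blast
    have "(\<sigma> q, cap (a q)) = (\<sigma> p, cap (a p))" if q: "q \<in> x ` U" for q
    proof -
      have qS: "q \<in> S" using local_paramD(6)[OF x(1)] q by blast
      obtain U' :: "(real^'n) set" and x' where x': "local_param S U' x'" "q \<in> x' ` U'" "\<forall>y\<in>x' ` U'. \<sigma> y = fst (a q) \<and> y \<in> cap (a q)"
        using a[OF qS] by blast
      obtain W where W: "open W" "x' ` U' = S \<inter> W" using local_paramD(4)[OF x'(1)] by (auto simp: openin_open)
      \<comment> \<open>The part of the first patch that also lies in the second; on it
        \<open>cap_unique\<close> compares the two caps.\<close>
      define B where "B = {u \<in> U. x u \<in> W}"
      have B: "open B" "B \<subseteq> U"
        using continuous_open_preimage[OF local_paramD(8,1)[OF x(1)] W(1)] by (auto simp: B_def vimage_def Int_def)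
      have sub: "x ` B \<subseteq> x' ` U'" using W local_paramD(6)[OF x(1)] by (auto simp: B_def)
      have "B \<noteq> {}" using q x'(2) W by (auto simp: B_def)
      moreover have "x ` B \<subseteq> cap (a q)" using sub x'(3) by blast
      moreover have "x ` B \<subseteq> cap (a p)" using x(3) B(2) by blast
      moreover have "fst (a q) = fst (a p)" using x(3) x'(3) q x'(2) by metis
      ultimately have "cap (a q) = cap (a p)"
        using cap_unique[OF local_param_subset[OF x(1) B]] card(2) by blast
      then show ?thesis using x(2,3) q by auto
    qed
    then show "\<exists>T. openin (top_of_set S) T \<and> p \<in> T \<and> (\<forall>q\<in>T. (\<sigma> q, cap (a q)) = (\<sigma> p, cap (a p)))"
      using local_paramD(4)[OF x(1)] x(2) by blast
  qed
  then obtain c Q where cQ: "\<And>p. p \<in> S \<Longrightarrow> \<sigma> p = c \<and> cap (a p) = Q"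
    unfolding constant_on_def by (metis prod.inject)
  obtain p0 where p0: "p0 \<in> S" using ne by blast
  have mem: "p \<in> cap (a p) \<and> \<sigma> p = fst (a p)" if "p \<in> S" for p using a[OF that] by blast
  have sub: "S \<subseteq> cap (a p0)" using cQ mem p0 by blast
  moreover have "\<forall>p\<in>S. \<sigma> p = fst (a p0)" using cQ mem p0 by metis
  moreover have "openin (top_of_set (cap (a p0))) S"
    using a by (intro openin_cap[OF sub card(2)]) blast
  ultimately show ?thesis by blast
qed

section \<open>Curvature and congruence of caps\<close>

lemma cap_curvature:
  assumes card: "CARD('m) = CARD('n::finite) + 1" and S: "S \<subseteq> cap a"
  shows "constant_curvature TYPE('n) T S ((\<Sum>b\<in>A. (fst b)\<^sup>2 / e b) + (fst a)\<^sup>2)"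
proof -
  have "riemann (induced_metric T x) \<mu> \<nu> \<alpha> \<beta> u = ((\<Sum>b\<in>A. (fst b)\<^sup>2 / e b) + (fst a)\<^sup>2) *
      (induced_metric T x u $ \<mu> $ \<alpha> * induced_metric T x u $ \<nu> $ \<beta> - induced_metric T x u $ \<mu> $ \<beta> * induced_metric T x u $ \<nu> $ \<alpha>)"
    if x: "local_param S U x" and u: "u \<in> U" for U :: "(real^'n) set" and x u \<mu> \<nu> \<alpha> \<beta>
  proof -
    have xu: "x u \<in> cap a" using local_paramD(6)[OF x] S u by blast
    interpret quadric_immersion T U x "insert a A" "e(a := 1)"
      using cap_immersion[OF x _ _ card, of a] S local_paramD(6)[OF x] u by blast
    have "(\<Sum>b\<in>insert a A. (fst b)\<^sup>2 / (e(a := 1)) b) = (\<Sum>b\<in>A. (fst b)\<^sup>2 / e b) + (fst a)\<^sup>2"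
    proof -
      have "(\<Sum>b\<in>A. (fst b)\<^sup>2 / (e(a := 1)) b) = (\<Sum>b\<in>A. (fst b)\<^sup>2 / e b)"
        using cap_not_in[OF xu] by (intro sum.cong) auto
      then show ?thesis using cap_not_in[OF xu] finite_A by simp
    qed
    then show ?thesis using riemann_eq[OF u, of \<mu> \<nu> \<alpha> \<beta>] by simp
  qed
  then show ?thesis unfolding constant_curvature_def Let_def by blast
qed

text \<open>\<kappa> is given only through the curvature equation of \<open>M\<close>; comparing
  that equation with \<open>riemann_eq\<close> for a chart, at a non-vanishing minor, identifies
  it.\<close>

lemma ambient_curvature:
  fixes Y :: "real^'m \<Rightarrow> real^'k"
  assumes Y: "local_param M V Y" "V \<noteq> {}" and card: "CARD('m) \<ge> 2" and cc: "constant_curvature TYPE('m) T M \<kappa>"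
  shows "\<kappa> = (\<Sum>b\<in>A. (fst b)\<^sup>2 / e b)"
proof -
  interpret quadric_immersion T V Y A e using chart_immersion[OF Y(1)] .
  obtain u where u: "u \<in> V" using Y by blast
  obtain \<mu> \<nu> \<alpha> \<beta> where "g u $ \<mu> $ \<alpha> * g u $ \<nu> $ \<beta> \<noteq> g u $ \<mu> $ \<beta> * g u $ \<nu> $ \<alpha>"
    using exists_minor_nonzero[OF g_invertible[OF u] card] by blast
  moreover have "riemann g \<mu> \<nu> \<alpha> \<beta> u = \<kappa> * (g u $ \<mu> $ \<alpha> * g u $ \<nu> $ \<beta> - g u $ \<mu> $ \<beta> * g u $ \<nu> $ \<alpha>)"
    using cc Y(1) u unfolding constant_curvature_def Let_def by blast
  ultimately show ?thesis using riemann_eq[OF u, of \<mu> \<nu> \<alpha> \<beta>] by simp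
qed

text \<open>Reversing the unit normal changes the sign of \<sigma> but not the point set, which is
  why \<sigma>^2 suffices for congruence.\<close>

lemma cap_uminus: "cap (- fst a, - fst (snd a), - snd (snd a)) = cap a"
proof -
  have "quad T (- fst a, - fst (snd a), - snd (snd a)) y = - quad T a y"
    "nrm (- fst a, - fst (snd a), - snd (snd a)) y = - nrm a y" for y
    by (simp_all add: quad_def nrm_def eta.minus_left)
  then show ?thesis by (simp add: cap_def eta.minus_left eta.minus_right)
qed

lemma cap_maps:
  assumes p: "p \<in> cap a" and q: "q \<in> cap a'" and aa: "fst a = fst a'" and L: "eta_isometry T L"
    and La: "L (nrm a p) = nrm a' q" and LA: "\<And>b. b \<in> A \<Longrightarrow> L (nrm b p) = nrm b q"
  shows "y \<in> M \<Longrightarrow> q + L (y - p) \<in> M" "y \<in> cap a \<Longrightarrow> q + L (y - p) \<in> cap a'"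
proof -
  have pM: "p \<in> M" and qM: "q \<in> M" using p q by (auto simp: cap_def)
  have lin: "linear L" and pres: "\<And>x y. eta T (L x) (L y) = eta T x y" using L by (auto simp: eta_isometry_def)
  show M: "q + L (y - p) \<in> M" if "y \<in> M" for y
    using homogeneous[OF L pM qM LA that] .
  have nL: "nrm b' (q + L (y - p)) = L (nrm b y)" if "L (nrm b p) = nrm b' q" "fst b = fst b'" for b b' y
    using that nrm_add[of b' q "L (y - p)"] nrm_add[of b p "y - p"] by (simp add: linear_add[OF lin] linear_cmul[OF lin])
  show "q + L (y - p) \<in> cap a'" if y: "y \<in> cap a"
  proof -
    have "quad T a' (q + L (y - p)) = 0"
      using quad_image[OF L La aa, of y] p q y by (simp add: cap_def)
    moreover have "q + L (y - p) \<in> M" using M y by (simp add: cap_def)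
    ultimately show ?thesis
      using y unfolding cap_def by (simp add: nL[OF La aa] nL[OF LA] pres)
  qed
qed

lemma cap_frame_isometry:
  assumes p: "p \<in> cap a" and q: "q \<in> cap a'"
  shows "\<exists>L. eta_isometry T L \<and> L (nrm a p) = nrm a' q \<and> (\<forall>b\<in>A. L (nrm b p) = nrm b q)"
proof -
  have pM: "p \<in> M" and qM: "q \<in> M" using p q by (auto simp: cap_def)
  have nA: "a \<notin> A" using p cap_not_in by blast
  \<comment> \<open>Witt's theorem needs both families over one index set; the slot of
    \<open>a\<close> therefore receives the normal of \<open>a'\<close>.\<close>
  define w where "w b = (if b = a then nrm a' q else nrm b q)" for b
  have 1: "eta T (nrm a p) (nrm a p) = 1" "eta T (nrm a' q) (nrm a' q) = 1" using p q by (auto simp: cap_def)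
  have 2: "eta T (nrm b p) (nrm a p) = 0" "eta T (nrm b q) (nrm a' q) = 0" if "b \<in> A" for b
    using p q that by (auto simp: cap_def)
  have "\<exists>L. eta_isometry T L \<and> (\<forall>b\<in>insert a A. L (nrm b p) = w b)"
  proof (rule witt[where e = "e(a := 1)"])
    show "finite (insert a A)" using finite_A by simp
    fix b d assume bd: "b \<in> insert a A" "d \<in> insert a A"
    show "eta T (nrm b p) (nrm d p) = (if b = d then (e(a := 1)) b else 0)"
      using bd nA 1 2(1)[of b] 2(1)[of d] eta_commute[of T "nrm a p" "nrm d p"] nrm_M[OF pM, of b d]
      by (cases "b = a"; cases "d = a") simp_all
    show "eta T (w b) (w d) = (if b = d then (e(a := 1)) b else 0)"
      using bd nA 1 2(2)[of b] 2(2)[of d] eta_commute[of T "nrm a' q" "nrm d q"] nrm_M[OF qM, of b d]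
      by (cases "b = a"; cases "d = a") (simp_all add: w_def)
  next
    show "(e(a := 1)) b \<noteq> 0" if "b \<in> insert a A" for b using that e_nz[of b] by auto
  qed
  then obtain L where L: "eta_isometry T L" "\<And>b. b \<in> insert a A \<Longrightarrow> L (nrm b p) = w b" by blast
  have "L (nrm a p) = nrm a' q" using L(2)[of a] by (simp add: w_def)
  moreover have "L (nrm b p) = nrm b q" if "b \<in> A" for b
  proof -
    have "b \<noteq> a" using that nA by blast
    then show ?thesis using L(2)[of b] that by (simp add: w_def)
  qed
  ultimately show ?thesis using L(1) by blast
qed

lemma cap_isometry:
  assumes p: "p \<in> cap a" and q: "q \<in> cap a'" and aa: "(fst a)\<^sup>2 = (fst a')\<^sup>2"
  shows "\<exists>L b. eta_isometry T L \<and> b + L p = q \<and> (\<lambda>y. b + L y) ` M = M \<and> (\<lambda>y. b + L y) ` cap a = cap a'"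
proof -
  \<comment> \<open>Equality of squares leaves the sign open; reversing the normal of the target cap
    if necessary aligns the leading coefficients.\<close>
  obtain a'' where a'': "cap a'' = cap a'" "fst a = fst a''"
  proof (cases "fst a' = fst a")
    case True
    then show ?thesis by (intro that[OF refl]) simp
  next
    case False
    then have "- fst a' = fst a" using aa power2_eq_iff by fastforce
    then show ?thesis by (intro that[OF cap_uminus]) simp
  qed
  have q: "q \<in> cap a''" using q a'' by simp
  obtain L where L: "eta_isometry T L" "L (nrm a p) = nrm a'' q" "\<And>b. b \<in> A \<Longrightarrow> L (nrm b p) = nrm b q"
    using cap_frame_isometry[OF p q] by blast
  define L' where "L' = inv L"
  have lin: "linear L" and pres: "\<And>x y. eta T (L x) (L y) = eta T x y" using L(1) by (auto simp: eta_isometry_def)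
  have inv: "L' (L y) = y" "L (L' y) = y" for y
    using eta_isometry_bij[OF L(1)] by (auto simp: L'_def bij_def surj_f_inv_f)
  have "linear L'"
  proof (rule linearI)
    have inj: "x = y" if "L x = L y" for x y using that inv(1) by metis
    show "L' (x + y) = L' x + L' y" "L' (c *\<^sub>R x) = c *\<^sub>R L' x" for x y c
      by (rule inj, simp add: inv linear_add[OF lin] linear_cmul[OF lin])+
  qed
  then have L': "eta_isometry T L'" unfolding eta_isometry_def using pres[of "L' _" "L' _"] inv(2) by simp
  have L'a: "L' (nrm a'' q) = nrm a p" "\<And>b. b \<in> A \<Longrightarrow> L' (nrm b q) = nrm b p"
    using L(2,3) inv(1) by metis+
  have fw: "y \<in> M \<Longrightarrow> q + L (y - p) \<in> M" "y \<in> cap a \<Longrightarrow> q + L (y - p) \<in> cap a''" for y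
    using cap_maps[OF p q a''(2) L] by blast+
  \<comment> \<open>The same inclusion for the inverse isometry upgrades the two inclusions to
    equalities.\<close>
  have bw: "y \<in> M \<Longrightarrow> p + L' (y - q) \<in> M" "y \<in> cap a'' \<Longrightarrow> p + L' (y - q) \<in> cap a" for y
    using cap_maps[OF q p a''(2)[symmetric] L' L'a] by blast+
  define \<phi> where "\<phi> y = (q - L p) + L y" for y
  have \<phi>: "\<phi> y = q + L (y - p)" for y by (simp add: \<phi>_def linear_diff[OF lin])
  have \<phi>inv: "y = \<phi> (p + L' (y - q))" for y by (simp add: \<phi> inv)
  have "\<phi> ` M = M"
  proof (intro equalityI subsetI)
    show "y \<in> \<phi> ` M" if "y \<in> M" for y using \<phi>inv bw(1)[OF that] by blast
  qed (use fw(1) in \<open>auto simp: \<phi>\<close>)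
  moreover have "\<phi> ` cap a = cap a''"
  proof (intro equalityI subsetI)
    show "y \<in> \<phi> ` cap a" if "y \<in> cap a''" for y using \<phi>inv bw(2)[OF that] by blast
  qed (use fw(2) in \<open>auto simp: \<phi>\<close>)
  moreover have "\<phi> p = q" by (simp add: \<phi>_def)
  ultimately show ?thesis
    unfolding a''(1) \<phi>_def[abs_def] using L(1) by (intro exI[of _ L] exI[of _ "q - L p"]) simp
qed

end

section \<open>Rigidity\<close>

lemma local_param_locally_equal:
  assumes x: "local_param S U x" and W: "open W" "x ` U \<subseteq> W" "S \<inter> W = S' \<inter> W"
  shows "local_param S' U x"
proof -
  obtain O' where O': "open O'" "x ` U = S \<inter> O'" using local_paramD(4)[OF x] by (auto simp: openin_open)
  then have "x ` U = S' \<inter> (W \<inter> O')" using W by blast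
  then have "openin (top_of_set S') (x ` U)" using O' W by (metis open_Int openin_open_Int)
  then show ?thesis using x unfolding local_param_def by blast
qed

lemma umbilical_hypersurface_param:
  assumes "umbilical_hypersurface TYPE('m::finite) TYPE('n::finite) T M S \<sigma>"
  shows "\<And>p. p \<in> S \<Longrightarrow> \<exists>(U :: (real^'n) set) x. local_param S U x \<and> p \<in> x ` U"
    "\<exists>(V :: (real^'m) set) Y. local_param M V Y \<and> V \<noteq> {}"
proof -
  note * = umbilical_hypersurfaceD(3)[OF assms]
  show "\<exists>(U :: (real^'n) set) x. local_param S U x \<and> p \<in> x ` U" if p: "p \<in> S" for p
    using bspec[OF * p] by (elim exE conjE) (intro exI conjI; assumption)
  obtain p where p: "p \<in> S" using umbilical_hypersurfaceD(1)[OF assms] by blast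
  from bspec[OF * p] obtain V :: "(real^'m) set" and Y and U :: "(real^'n) set" and z
    where "local_param M V Y" "z ` U \<subseteq> V" "p \<in> (Y \<circ> z) ` U" by (elim exE conjE)
  then show "\<exists>(V :: (real^'m) set) Y. local_param M V Y \<and> V \<noteq> {}" by blast
qed

context space_form
begin

text \<open>Since \<open>S\<close> and \<open>S'\<close> are only known to be open in their caps,
  carrying one cap onto the other identifies them near a chosen pair of points. Closedness in
  \<open>M\<close> makes both clopen in the pieces compared, and connectedness then gives global
  equality.\<close>

lemma rigidity:
  assumes card: "CARD('n::finite) \<ge> 2" "CARD('m) = CARD('n) + 1"
    and cc: "constant_curvature TYPE('m) T M \<kappa>"
    and umb: "umbilical_hypersurface TYPE('m) TYPE('n) T M S \<sigma>"
    and umb': "umbilical_hypersurface TYPE('m) TYPE('n) T M S' \<sigma>'"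
    and pos: "spacelike_normals TYPE('n) S" "spacelike_normals TYPE('n) S'"
  shows "(\<exists>c. (\<forall>p\<in>S. \<sigma> p = c) \<and> constant_curvature TYPE('n) T S (\<kappa> + c\<^sup>2)) \<and>
    ((\<forall>p\<in>S. \<forall>q\<in>S'. (\<sigma> p)\<^sup>2 = (\<sigma>' q)\<^sup>2) \<longrightarrow>
      locally_isometric TYPE('n) T S S' \<and>
      (\<forall>p\<in>S. \<forall>q\<in>S'. \<exists>\<phi> W. metric_isometry TYPE('m) T M M \<phi> \<and> \<phi> p = q \<and>
         open W \<and> q \<in> W \<and> \<phi> ` S \<inter> W = S' \<inter> W) \<and>
      (closedin (top_of_set M) S \<and> closedin (top_of_set M) S' \<longrightarrow>
         (\<exists>f. metric_isometry TYPE('n) T S S' f) \<and>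
         (\<exists>\<phi>. metric_isometry TYPE('m) T M M \<phi> \<and> \<phi> ` S = S')))"
proof (intro conjI impI)
  have "\<exists>a. (\<forall>p\<in>S. \<sigma> p = fst a) \<and> S \<subseteq> cap a \<and> openin (top_of_set (cap a)) S"
    by (rule umbilical_in_cap[OF card umb pos(1)])
  then obtain a where a: "\<And>p. p \<in> S \<Longrightarrow> \<sigma> p = fst a" "S \<subseteq> cap a" "openin (top_of_set (cap a)) S"
    by blast
  have "\<exists>a'. (\<forall>p\<in>S'. \<sigma>' p = fst a') \<and> S' \<subseteq> cap a' \<and> openin (top_of_set (cap a')) S'"
    by (rule umbilical_in_cap[OF card umb' pos(2)])
  then obtain a' where a': "\<And>p. p \<in> S' \<Longrightarrow> \<sigma>' p = fst a'" "S' \<subseteq> cap a'" "openin (top_of_set (cap a')) S'"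
    by blast
  obtain V :: "(real^'m) set" and Y where Y: "local_param M V Y" "V \<noteq> {}"
    using umbilical_hypersurface_param(2)[OF umb] by blast
  have "\<kappa> = (\<Sum>b\<in>A. (fst b)\<^sup>2 / e b)"
    using ambient_curvature[OF Y _ cc] card by simp
  then show "\<exists>c. (\<forall>p\<in>S. \<sigma> p = c) \<and> constant_curvature TYPE('n) T S (\<kappa> + c\<^sup>2)"
    using cap_curvature[OF card(2) a(2)] a(1) by blast
  note param = umbilical_hypersurface_param(1)[OF umb] and ne = umbilical_hypersurfaceD(1)[OF umb]
    and ne' = umbilical_hypersurfaceD(1)[OF umb'] and conn = umbilical_hypersurfaceD(2)[OF umb]
    and conn' = umbilical_hypersurfaceD(2)[OF umb']
  assume sq: "\<forall>p\<in>S. \<forall>q\<in>S'. (\<sigma> p)\<^sup>2 = (\<sigma>' q)\<^sup>2"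
  have aa: "(fst a)\<^sup>2 = (fst a')\<^sup>2"
  proof -
    obtain p q where "p \<in> S" "q \<in> S'" using ne ne' by blast
    then show ?thesis using sq a(1) a'(1) by metis
  qed
  \<comment> \<open>The moved \<open>S\<close> and \<open>S'\<close> are both relatively open in
    \<open>cap a'\<close> and contain \<open>q\<close>, so they coincide in a neighbourhood of
    \<open>q\<close>.\<close>
  have move: "\<exists>L b W. eta_isometry T L \<and> b + L p = q \<and> (\<lambda>y. b + L y) ` M = M \<and> (\<lambda>y. b + L y) ` cap a = cap a' \<and>
    openin (top_of_set (cap a')) ((\<lambda>y. b + L y) ` S) \<and> open W \<and> q \<in> W \<and> (\<lambda>y. b + L y) ` S \<inter> W = S' \<inter> W"
    if p: "p \<in> S" and q: "q \<in> S'" for p q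
  proof -
    obtain L b where L: "eta_isometry T L" "b + L p = q" "(\<lambda>y. b + L y) ` M = M" "(\<lambda>y. b + L y) ` cap a = cap a'"
      using cap_isometry[of p a q a'] p q a(2) a'(2) aa by blast
    obtain \<psi> where "homeomorphism (cap a) (cap a') (\<lambda>y. b + L y) \<psi>"
      using affine_isometry_homeomorphism[OF L(1), of "cap a" b] L(4) by auto
    then have o: "openin (top_of_set (cap a')) ((\<lambda>y. b + L y) ` S)"
      using homeomorphism_imp_open_map a(3) by blast
    obtain W1 where W1: "open W1" "(\<lambda>y. b + L y) ` S = cap a' \<inter> W1" using o by (auto simp: openin_open)
    obtain W2 where W2: "open W2" "S' = cap a' \<inter> W2" using a'(3) by (auto simp: openin_open)
    have "q \<in> (\<lambda>y. b + L y) ` S" using p L(2) by blast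
    then have "q \<in> W1 \<inter> W2" using q W1(2) W2(2) by blast
    moreover have "(\<lambda>y. b + L y) ` S \<inter> (W1 \<inter> W2) = S' \<inter> (W1 \<inter> W2)"
      using W1(2) W2(2) by blast
    moreover have "open (W1 \<inter> W2)" using W1(1) W2(1) by blast
    ultimately show ?thesis using L o by blast
  qed
  show "locally_isometric TYPE('n) T S S'"
    unfolding locally_isometric_def
  proof (intro ballI)
    fix p q assume p: "p \<in> S" and q: "q \<in> S'"
    obtain L b W where L: "eta_isometry T L" "b + L p = q" and W: "open W" "q \<in> W" "(\<lambda>y. b + L y) ` S \<inter> W = S' \<inter> W"
      using move[OF p q] by blast
    obtain U :: "(real^'n) set" and x where x: "local_param S U x" "p \<in> x ` U" using param[OF p] by blast
    obtain u where u: "u \<in> U" "x u = p" using x(2) by blast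
    \<comment> \<open>The parametrisation is shrunk until its moved image stays where the moved
      \<open>S\<close> and \<open>S'\<close> agree; it then parametrises \<open>S'\<close>
      too.\<close>
    define B where "B = {v \<in> U. b + L (x v) \<in> W}"
    have bL: "bounded_linear L" using L(1) by (simp add: eta_isometry_def linear_conv_bounded_linear)
    have "continuous_on U (\<lambda>v. b + L (x v))"
      by (intro continuous_on_add continuous_on_const bounded_linear.continuous_on[OF bL] local_paramD(8)[OF x(1)])
    from continuous_open_preimage[OF this local_paramD(1)[OF x(1)] W(1)] have B: "open B" "B \<subseteq> U"
      by (auto simp: B_def vimage_def Int_def)
    note xB = local_param_subset[OF x(1) B]
    have img: "((\<lambda>y. b + L y) \<circ> x) ` B \<subseteq> W" by (auto simp: B_def)
    have "local_param S' B ((\<lambda>y. b + L y) \<circ> x)"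
      by (rule local_param_locally_equal[OF affine_isometry_local_param(1)[OF L(1) xB] W(1) img W(3)])
    moreover have "\<forall>v\<in>B. induced_metric T x v = induced_metric T ((\<lambda>y. b + L y) \<circ> x) v"
      using affine_isometry_local_param(2)[OF L(1) xB] by simp
    moreover have "u \<in> B" "((\<lambda>y. b + L y) \<circ> x) u = q" using u L(2) W(2) by (auto simp: B_def)
    ultimately show "\<exists>(U :: (real^'n) set) x x'. \<exists>u\<in>U. local_param S U x \<and> local_param S' U x' \<and> x u = p \<and> x' u = q \<and>
      (\<forall>v\<in>U. induced_metric T x v = induced_metric T x' v)"
      using xB u(2) by blast
  qed
  show "\<forall>p\<in>S. \<forall>q\<in>S'. \<exists>\<phi> W. metric_isometry TYPE('m) T M M \<phi> \<and> \<phi> p = q \<and>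
         open W \<and> q \<in> W \<and> \<phi> ` S \<inter> W = S' \<inter> W"
  proof (intro ballI)
    fix p q assume p: "p \<in> S" and q: "q \<in> S'"
    obtain L b W where L: "eta_isometry T L" "b + L p = q" "(\<lambda>y. b + L y) ` M = M"
      and W: "open W" "q \<in> W" "(\<lambda>y. b + L y) ` S \<inter> W = S' \<inter> W"
      using move[OF p q] by blast
    have "metric_isometry TYPE('m) T M M (\<lambda>y. b + L y)"
      by (rule affine_isometry_metric_isometry[OF L(1,3)])
    then show "\<exists>\<phi> W. metric_isometry TYPE('m) T M M \<phi> \<and> \<phi> p = q \<and>
         open W \<and> q \<in> W \<and> \<phi> ` S \<inter> W = S' \<inter> W"
      using L(2) W by (intro exI[of _ "\<lambda>y. b + L y"] exI[of _ W]) simp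
  qed
  assume cl: "closedin (top_of_set M) S \<and> closedin (top_of_set M) S'"
  obtain p q where p: "p \<in> S" and q: "q \<in> S'" using ne ne' by blast
  obtain L b where L: "eta_isometry T L" "b + L p = q" "(\<lambda>y. b + L y) ` M = M"
    and o: "openin (top_of_set (cap a')) ((\<lambda>y. b + L y) ` S)"
    using move[OF p q] by blast
  define R where "R = (\<lambda>y. b + L y) ` S"
  obtain \<psi> where "homeomorphism M M (\<lambda>y. b + L y) \<psi>"
    using affine_isometry_homeomorphism[OF L(1), of M b] L(3) by auto
  then have clR: "closedin (top_of_set M) R"
    using homeomorphism_imp_closed_map cl unfolding R_def by blast
  obtain \<psi>' where "homeomorphism S R (\<lambda>y. b + L y) \<psi>'"
    using affine_isometry_homeomorphism[OF L(1), of S b] unfolding R_def by auto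
  then have "continuous_on S (\<lambda>y. b + L y)" "(\<lambda>y. b + L y) ` S = R" by (auto simp: homeomorphism_def)
  then have connR: "connected R" using connected_continuous_image[OF _ conn] by metis
  have Rcap: "R \<subseteq> cap a'" and S'cap: "S' \<subseteq> cap a'"
    using o a'(2) openin_imp_subset unfolding R_def by blast+
  \<comment> \<open>\<open>X \<inter> Z\<close> is non-empty, open in \<open>X\<close> because
    \<open>Z\<close> is open in the cap, and closed in \<open>X\<close> because \<open>Z\<close> is
    closed in \<open>M\<close>. Used in both directions, this gives equality.\<close>
  have incl: "X \<subseteq> Z" if X: "connected X" "X \<subseteq> cap a'" and Z: "openin (top_of_set (cap a')) Z" "closedin (top_of_set M) Z"
    and "q \<in> X" "q \<in> Z" for X Z
  proof -
    have "cap a' \<subseteq> M" by (auto simp: cap_def)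
    obtain K where K: "closed K" "Z = M \<inter> K" using Z(2) by (auto simp: closedin_closed)
    have "openin (top_of_set X) (X \<inter> Z)"
      using Z(1) X(2) by (auto simp: openin_open)
    moreover have "X \<inter> Z = X \<inter> K" using K X \<open>cap a' \<subseteq> M\<close> by blast
    then have "closedin (top_of_set X) (X \<inter> Z)" using K(1) by (auto simp: closedin_closed)
    ultimately have "X \<inter> Z = {} \<or> X \<inter> Z = X" using X(1) connected_clopen by blast
    then show ?thesis using that by blast
  qed
  have qR: "q \<in> R" unfolding R_def using p L(2) by blast
  have RS: "R = S'"
    using incl[OF connR Rcap a'(3) _ qR q] incl[OF conn' S'cap o[folded R_def] clR q qR] cl by blast
  then have "metric_isometry TYPE('n) T S S' (\<lambda>y. b + L y)"
    unfolding R_def by (rule affine_isometry_metric_isometry[OF L(1)])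
  then show "\<exists>f. metric_isometry TYPE('n) T S S' f" by blast
  have "metric_isometry TYPE('m) T M M (\<lambda>y. b + L y)"
    by (rule affine_isometry_metric_isometry[OF L(1,3)])
  then show "\<exists>\<phi>. metric_isometry TYPE('m) T M M \<phi> \<and> \<phi> ` S = S'"
    using RS unfolding R_def by blast
qed

end

section \<open>The models\<close>

text \<open>If the orthogonal negative vectors indexed by \<open>F\<close> already exhaust the
  negative directions of \<open>eta\<close>, a further one of square -1 would contradict
  \<open>card_negative_le\<close>.\<close>

lemma unit_normal_spacelike:
  assumes F: "finite F" "card T \<le> card F"
    and v: "\<And>a b. a \<in> F \<Longrightarrow> b \<in> F \<Longrightarrow> a \<noteq> b \<Longrightarrow> eta T (v a) (v b) = 0"
    and neg: "\<And>a. a \<in> F \<Longrightarrow> eta T (v a) (v a) < 0"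
    and w: "\<bar>eta T w w\<bar> = 1" "\<And>a. a \<in> F \<Longrightarrow> eta T (v a) w = 0"
  shows "eta T w w = 1"
proof (rule ccontr)
  assume "eta T w w \<noteq> 1"
  then have ww: "eta T w w < 0" using w(1) by linarith
  define v' where "v' a = (case a of None \<Rightarrow> w | Some a \<Rightarrow> v a)" for a
  have w': "eta T w (v a) = 0" if "a \<in> F" for a using w(2)[OF that] by (simp add: eta_commute)
  have "card (insert None (Some ` F)) \<le> card T"
  proof (rule card_negative_le[where v = v'])
    show "eta T (v' a) (v' b) = 0" if "a \<in> insert None (Some ` F)" "b \<in> insert None (Some ` F)" "a \<noteq> b" for a b
      using that w(2) w' v by (cases a; cases b) (auto simp: v'_def)
    show "eta T (v' a) (v' a) < 0" if "a \<in> insert None (Some ` F)" for a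
      using that ww neg by (cases a) (auto simp: v'_def)
  qed (simp add: F)
  then show False using F by (simp add: card_image)
qed

lemma space_form_flat:
  assumes "CARD('k) = CARD('m)"
  shows "space_form TYPE('m::finite) (T :: 'k::finite set) UNIV {} (\<lambda>_. 1)"
  by unfold_locales (use assms in auto)

text \<open>The triple is scaled so that \<open>nrm\<close> is the unit radial vector
  \<open>y / r\<close>, of square \<open>s\<close>. Its contribution to the curvature is
  \<open>1 / (s * r^2)\<close>, the expected value for \<open>s\<close> equal to 1 or -1.\<close>

lemma space_form_quadric:
  fixes T :: "'k::finite set"
  assumes card: "CARD('k) = CARD('m) + 1" and r: "r > 0" and s: "s \<noteq> 0" and M: "\<And>y. y \<in> M \<Longrightarrow> eta T y y = s * r\<^sup>2"
    and hom: "\<And>L p y. eta_isometry T L \<Longrightarrow> p \<in> M \<Longrightarrow> L p \<in> M \<Longrightarrow> y \<in> M \<Longrightarrow> L y \<in> M"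
  shows "space_form TYPE('m::finite) T M {(1 / r, 0, s * r)} (\<lambda>_. s)"
proof
  show "quad T a y = 0" if "y \<in> M" "a \<in> {(1 / r, 0, s * r)}" for y a
    using M[OF that(1)] that(2) r by (simp add: quad_def eta.zero_left power2_eq_square)
  show "eta T (nrm a y) (nrm b y) = (if a = b then s else 0)"
    if "y \<in> M" "a \<in> {(1 / r, 0, s * r)}" "b \<in> {(1 / r, 0, s * r)}" for y a b
    using M[OF that(1)] that(2,3) r by (simp add: nrm_def eta.scaleR_left eta.scaleR_right power2_eq_square)
  show "q + L (y - p) \<in> M" if L: "eta_isometry T L" and "p \<in> M" "q \<in> M"
    and eq: "\<And>a. a \<in> {(1 / r, 0, s * r)} \<Longrightarrow> L (nrm a p) = nrm a q" and "y \<in> M" for L p q y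
  proof -
    have lin: "linear L" using L by (simp add: eta_isometry_def)
    have "L p = q" using eq r by (simp add: nrm_def linear_cmul[OF lin])
    then show ?thesis using hom[OF L \<open>p \<in> M\<close> _ \<open>y \<in> M\<close>] \<open>q \<in> M\<close> by (simp add: linear_diff[OF lin])
  qed
qed (use card s in auto)

text \<open>For two time-like vectors the product of time components outweighs the spatial product,
  by Cauchy-Schwarz, and so decides the sign. This expresses lying on the same sheet through
  \<open>eta\<close> alone, which isometries preserve.\<close>

lemma hyperbolic_sheet:
  fixes y p :: "real^'k::finite"
  assumes "eta {t} y y < 0" "eta {t} p p < 0"
  shows "eta {t} y p < 0 \<longleftrightarrow> 0 < y $ t * p $ t"
proof -
  define P where "P y = (\<chi> i. if i = t then 0 else y $ i)" for y :: "real^'k"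
  have e: "eta {t} y p = P y \<bullet> P p - y $ t * p $ t" for y p
  proof -
    have "eta {t} y p = - (y $ t * p $ t) + (\<Sum>i\<in>UNIV - {t}. y $ i * p $ i)"
      unfolding eta_def by (subst sum.remove[of _ t]) auto
    moreover have "P y \<bullet> P p = (\<Sum>i\<in>UNIV - {t}. y $ i * p $ i)"
      unfolding inner_vec_def P_def by (subst sum.remove[of _ t]) auto
    ultimately show ?thesis by simp
  qed
  have "norm (P y) < \<bar>y $ t\<bar>" if "eta {t} y y < 0" for y
  proof (rule power2_less_imp_less)
    have "P y \<bullet> P y < y $ t * y $ t" using that unfolding e by linarith
    then show "(norm (P y))\<^sup>2 < \<bar>y $ t\<bar>\<^sup>2"
      by (simp only: power2_norm_eq_inner power2_abs power2_eq_square[of "y $ t"])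
  qed simp
  from this[OF assms(1)] this[OF assms(2)] have "norm (P y) * norm (P p) < \<bar>y $ t\<bar> * \<bar>p $ t\<bar>"
    by (intro mult_strict_mono') auto
  then have "\<bar>P y \<bullet> P p\<bar> < \<bar>y $ t * p $ t\<bar>"
    using Cauchy_Schwarz_ineq2[of "P y" "P p"] by (simp add: abs_mult)
  then show ?thesis unfolding e by linarith
qed

text \<open>The cardinality clause says that the normals of \<open>M\<close> absorb all negative
  directions of \<open>eta\<close>: none for Euclidean space and the sphere, one for hyperbolic
  space.\<close>

lemma riemannian_space_form:
  fixes T :: "'k::finite set"
  assumes "riemannian_model CARD('m::finite) T M"
  shows "\<exists>A e. space_form TYPE('m) T M A e \<and> card T = card {a \<in> A. e a < 0}"
  using assms unfolding riemannian_model_def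
proof (elim disjE conjE exE)
  assume "CARD('k) = CARD('m)" "T = {}" "M = UNIV"
  then show ?thesis using space_form_flat[where T = T and 'm = 'm] by (intro exI[of _ "{}"] exI[of _ "\<lambda>_. 1"]) simp
next
  fix r :: real assume T: "T = {}" and c: "CARD('k) = CARD('m) + 1" and r: "r > 0" and M: "M = sphere 0 r"
  have e: "eta T y y = (norm y)\<^sup>2" for y by (simp add: T eta_def power2_norm_eq_inner inner_vec_def)
  have "y \<in> M \<longleftrightarrow> eta T y y = r\<^sup>2" for y
    using r by (simp add: M e)
  then have "space_form TYPE('m) T M {(1 / r, 0, 1 * r)} (\<lambda>_. 1)"
    using c r by (intro space_form_quadric) (auto simp: eta_isometry_def)
  then show ?thesis using T by (intro exI[of _ "{(1 / r, 0, 1 * r)}"] exI[of _ "\<lambda>_. 1"]) simp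
next
  fix t and r :: real
  assume T: "T = {t}" and c: "CARD('k) = CARD('m) + 1" and r: "r > 0"
    and M: "M = {x. eta T x x = - r\<^sup>2 \<and> 0 < x $ t}"
  have "space_form TYPE('m) T M {(1 / r, 0, - 1 * r)} (\<lambda>_. - 1)"
  proof (rule space_form_quadric[OF c r])
    \<comment> \<open>An isometry could exchange the two sheets; that \<open>L p\<close> is on the
      upper one prevents it.\<close>
    show "L y \<in> M" if L: "eta_isometry T L" and p: "p \<in> M" "L p \<in> M" and y: "y \<in> M" for L p y
    proof -
      have pres: "eta {t} (L x) (L y) = eta {t} x y" for x y using L T by (simp add: eta_isometry_def)
      have n: "eta {t} y y < 0" "eta {t} p p < 0" using y p r by (auto simp: M T)
      then have n': "eta {t} (L y) (L y) < 0" "eta {t} (L p) (L p) < 0" by (simp_all add: pres)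
      have "0 < y $ t * p $ t" using y p by (simp add: M)
      then have "0 < L y $ t * L p $ t"
        using hyperbolic_sheet[OF n] hyperbolic_sheet[OF n'] by (simp add: pres)
      then have "0 < L y $ t" using p(2) by (simp add: M zero_less_mult_iff)
      then show ?thesis using y by (simp add: M T pres)
    qed
  qed (auto simp: M)
  then show ?thesis using T by (intro exI[of _ "{(1 / r, 0, - 1 * r)}"] exI[of _ "\<lambda>_. - 1"]) simp
qed

text \<open>Exactly one negative direction is left for the tangent space of \<open>M\<close>: the
  counts are 1 and 0 for Minkowski and de Sitter, 2 and 1 for anti-de Sitter spacetime.\<close>

lemma lorentzian_space_form:
  fixes T :: "'k::finite set"
  assumes "lorentzian_model CARD('m::finite) T M"
  shows "\<exists>A e. space_form TYPE('m) T M A e \<and> card T = card {a \<in> A. e a < 0} + 1"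
  using assms unfolding lorentzian_model_def
proof (elim disjE conjE exE)
  assume "CARD('k) = CARD('m)" "card T = 1" "M = UNIV"
  then show ?thesis using space_form_flat[where T = T and 'm = 'm] by (intro exI[of _ "{}"] exI[of _ "\<lambda>_. 1"]) simp
next
  fix r :: real assume T: "card T = 1" and c: "CARD('k) = CARD('m) + 1" and r: "r > 0" and M: "M = {x. eta T x x = r\<^sup>2}"
  have "space_form TYPE('m) T M {(1 / r, 0, 1 * r)} (\<lambda>_. 1)"
    using c r by (intro space_form_quadric) (auto simp: eta_isometry_def M)
  then show ?thesis using T by (intro exI[of _ "{(1 / r, 0, 1 * r)}"] exI[of _ "\<lambda>_. 1"]) simp
next
  fix r :: real assume T: "card T = 2" and c: "CARD('k) = CARD('m) + 1" and r: "r > 0" and M: "M = {x. eta T x x = - r\<^sup>2}"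
  have "space_form TYPE('m) T M {(1 / r, 0, - 1 * r)} (\<lambda>_. - 1)"
    using c r by (intro space_form_quadric) (auto simp: eta_isometry_def M)
  then show ?thesis using T by (intro exI[of _ "{(1 / r, 0, - 1 * r)}"] exI[of _ "\<lambda>_. - 1"]) simp
qed

lemma lorentzian_matrix_negative:
  fixes G :: "real^'m::finite^'m"
  assumes "lorentzian_matrix G"
  shows "\<exists>h. mform G h h = -1"
proof -
  obtain P :: "real^'m^'m" and t where P: "transpose P ** G ** P = (\<chi> i j. if i = j then (if i = t then -1 else 1) else 0)"
    using assms unfolding lorentzian_matrix_def by blast
  define h where "h = P *v axis t 1"
  have "mform G h h = (G *v h) \<bullet> (P *v axis t 1)"
    by (simp add: mform_def h_def inner_commute)
  also have "\<dots> = ((G *v h) v* P) \<bullet> axis t 1"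
    by (simp only: dot_lmul_matrix)
  also have "(G *v h) v* P = (transpose P ** G ** P) *v axis t 1"
    unfolding h_def transpose_matrix_vector[symmetric] matrix_vector_mul_assoc matrix_mul_assoc ..
  also have "((transpose P ** G ** P) *v axis t 1) \<bullet> axis t 1 = -1"
    unfolding P by (simp add: matrix_vector_mult_basis column_def inner_axis)
  finally show ?thesis by blast
qed

section \<open>Signature and the square of the unit normal\<close>

lemma (in space_form) spacelike_normals_riemannian:
  assumes "card T = card {a \<in> A. e a < 0}"
  shows "spacelike_normals TYPE('n::finite) S"
  unfolding spacelike_normals_def
proof (intro allI impI)
  fix U :: "(real^'n) set" and x u w
  assume u: "u \<in> U" "x ` U \<subseteq> M" and w: "\<bar>eta T w w\<bar> = 1" "\<forall>a\<in>A. eta T (nrm a (x u)) w = 0"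
  have "x u \<in> M" using u by blast
  from nrm_M[OF this] show "eta T w w = 1"
    using finite_A assms w by (intro unit_normal_spacelike[of "{a \<in> A. e a < 0}" T "\<lambda>a. nrm a (x u)"]) auto
qed

lemma (in space_form) spacelike_normals_timelike:
  assumes neg: "card T = card {a \<in> A. e a < 0} + 1" and S: "timelike TYPE('n::finite) T S"
  shows "spacelike_normals TYPE('n) S"
  unfolding spacelike_normals_def
proof (intro allI impI)
  fix U :: "(real^'n) set" and x u w
  assume x: "local_param S U x" and u: "u \<in> U" and xM: "x ` U \<subseteq> M"
    and w: "\<bar>eta T w w\<bar> = 1" "\<forall>i. eta T (pd i x u) w = 0" "\<forall>a\<in>A. eta T (nrm a (x u)) w = 0"
  note dx = local_paramD(9)[OF x u]
  have "lorentzian_matrix (induced_metric T x u)" using S x u unfolding timelike_def by blast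
  from lorentzian_matrix_negative[OF this]
  obtain h where h: "eta T (frechet_derivative x (at u) h) (frechet_derivative x (at u) h) = -1"
    unfolding mform_induced_metric[OF dx] by blast
  \<comment> \<open>The one negative direction not taken by the normals of \<open>M\<close> is
    occupied by a time-like tangent vector of \<open>S\<close>, the entry \<open>None\<close>;
    nothing negative is left for \<open>w\<close>.\<close>
  define F where "F = insert None (Some ` {a \<in> A. e a < 0})"
  define v where "v b = (case b of None \<Rightarrow> frechet_derivative x (at u) h | Some a \<Rightarrow> nrm a (x u))" for b
  have xu: "x u \<in> M" using xM u by blast
  have "eta T (nrm a (x u)) (frechet_derivative x (at u) h) = 0" if a: "a \<in> A" for a
  proof (rule quad_tangent[OF local_paramD(1)[OF x] u dx])
    show "quad T a (x u) = 0" if "u \<in> U" for u using quad_M[of "x u" a] that xM a by blast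
  qed
  then have tan: "eta T (nrm a (x u)) (frechet_derivative x (at u) h) = 0"
      "eta T (frechet_derivative x (at u) h) (nrm a (x u)) = 0" if "a \<in> A" for a
    using that by (simp_all add: eta_commute[of T "frechet_derivative x (at u) h" "nrm a (x u)"])
  show "eta T w w = 1"
  proof (rule unit_normal_spacelike[of F T v])
    show "finite F" "card T \<le> card F" using finite_A neg by (simp_all add: F_def card_image)
    show "eta T (v a) (v b) = 0" if "a \<in> F" "b \<in> F" "a \<noteq> b" for a b
      using that tan nrm_M[OF xu] by (cases a; cases b) (auto simp: F_def v_def split: if_splits)
    show "eta T (v a) (v a) < 0" if "a \<in> F" for a
      using that h nrm_M[OF xu] by (cases a) (auto simp: F_def v_def)
    show "eta T (v a) w = 0" if "a \<in> F" for a
      using that w(3) eta_frechet_zero[OF dx, of T w h] w(2) by (cases a) (auto simp: F_def v_def)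
  qed (rule w(1))
qed

section \<open>Rigidity of umbilical hypersurfaces in the models\<close>

theorem mainTheorem3:
  fixes T :: "'k::finite set" and M S S' :: "(real^'k) set"
    and \<kappa> :: real and \<sigma> \<sigma>' :: "real^'k \<Rightarrow> real"
  assumes "CARD('n::finite) \<ge> 2" and "CARD('m::finite) = CARD('n) + 1"
    and "riemannian_model CARD('m) T M \<or> lorentzian_model CARD('m) T M"
    and "constant_curvature TYPE('m) T M \<kappa>"
    and "umbilical_hypersurface TYPE('m) TYPE('n) T M S \<sigma>"
    and "umbilical_hypersurface TYPE('m) TYPE('n) T M S' \<sigma>'"
    and "lorentzian_model CARD('m) T M \<longrightarrow> timelike TYPE('n) T S \<and> timelike TYPE('n) T S'"
  shows "(\<exists>c. (\<forall>p\<in>S. \<sigma> p = c) \<and> constant_curvature TYPE('n) T S (\<kappa> + c\<^sup>2)) \<and>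
    ((\<forall>p\<in>S. \<forall>q\<in>S'. (\<sigma> p)\<^sup>2 = (\<sigma>' q)\<^sup>2) \<longrightarrow>
      locally_isometric TYPE('n) T S S' \<and>
      (\<forall>p\<in>S. \<forall>q\<in>S'. \<exists>\<phi> W. metric_isometry TYPE('m) T M M \<phi> \<and> \<phi> p = q \<and>
         open W \<and> q \<in> W \<and> \<phi> ` S \<inter> W = S' \<inter> W) \<and>
      (closedin (top_of_set M) S \<and> closedin (top_of_set M) S' \<longrightarrow>
         (\<exists>f. metric_isometry TYPE('n) T S S' f) \<and>
         (\<exists>\<phi>. metric_isometry TYPE('m) T M M \<phi> \<and> \<phi> ` S = S')))"
  using assms(3)
proof
  assume "riemannian_model CARD('m) T M"
  then obtain A e where sf: "space_form TYPE('m) T M A e" and neg: "card T = card {a \<in> A. e a < 0}"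
    using riemannian_space_form by blast
  show ?thesis
    by (intro space_form.rigidity[OF sf assms(1,2,4,5,6)] space_form.spacelike_normals_riemannian[OF sf neg])
next
  assume lor: "lorentzian_model CARD('m) T M"
  then obtain A e where sf: "space_form TYPE('m) T M A e" and neg: "card T = card {a \<in> A. e a < 0} + 1"
    using lorentzian_space_form by blast
  show ?thesis
    using assms(7) lor
    by (intro space_form.rigidity[OF sf assms(1,2,4,5,6)] space_form.spacelike_normals_timelike[OF sf neg]) blast+
qed

end
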